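(* Let $f_1,f_2:[0,\infty)\to(0,\infty)$ be right-continuous functions with left limits such that $\int_0^\infty f_i(u)\,du=\infty$ for $i=1,2$. Let $(e_n)_{n\ge 1}$ be independent random variables such that for all $n\ge1$ and $t\ge 0$, $$\mathbb{P}(e_{2n-1}>t)=\exp\Big(-\int_0^t f_2(u)\,du\Big),\qquad \mathbb{P}(e_{2n}>t)=\exp\Big(-\int_0^t f_1(u)\,du\Big).$$ For $t\ge 0$ put $$N^0(t)=\sum_{n\ge1}\mathbf 1_{\{e_1+\cdots+e_n\le t\}},\qquad m(t)=t-\sup\{e_1+\cdots+e_k:\ k\ge 0,\ e_1+\cdots+e_k\le t\}$$ (the empty sum being $0$), and $$S^0(t)=\int_0^t(-1)^{N^0(s)}\,ds .$$ For each small $\varepsilon>0$ let $(X_n,M_n)_{n\ge0}$ be the $\{-1,1\}\times\mathbb{N}^*$-valued Markov chain (depending on $\varepsilon$) described in the context, started at $X_0=M_0=1$, with coefficients $\alpha_{i,n}\in(0,1)$ of the form $$\alpha_{i,n}=f_i(n\varepsilon)\varepsilon+\tilde\alpha_{i,n,\varepsilon}\,\varepsilon,\qquad n\ge1,\ i=1,2,$$ where $\tilde\alpha_{i,n,\varepsilon}\in\mathbb{R}$ and $\lim_{\varepsilon\to0}\sup_{i,n}|\tilde\alpha_{i,n,\varepsilon}|=0$. Then: (i) For every $n\ge1$, the vector $(\varepsilon T_1,\varepsilon(T_2-T_1),\ldots,\varepsilon(T_n-T_{n-1}))$ converges in distribution to $(e_1,\ldots,e_n)$ as $\varepsilon\to0$.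 (ii) As $\varepsilon\to 0$, the process $(S^\varepsilon(t),X^\varepsilon(t),M^\varepsilon(t))_{t\ge0}$ converges in distribution, in Skorohod's topology, to $(S^0(t),(-1)^{N^0(t)},m(t))_{t\ge0}$. Moreover, $(S^0(t),(-1)^{N^0(t)},m(t))_{t\ge0}$ and $((-1)^{N^0(t)},m(t))_{t\ge0}$ are Markov processes.
   Context: $\mathbb{N}^*=\{1,2,\ldots\}$. With $a_1=-1$, $a_2=1$, the Markov chain $(X_n,M_n)_{n\ge0}$ on $\{-1,1\}\times\mathbb{N}^*$ has transition probabilities: from $(a_i,n)$ it goes to $(a_i,n+1)$ with probability $1-\alpha_{i,n}$ and to $(a_j,1)$, $j\ne i$, with probability $\alpha_{i,n}$. The change times are $T_0=0$ and $T_n=\inf\{i\ge T_{n-1}: X_i\ne X_{T_{n-1}}\}$ for $n\ge1$. The persistent random walk is $S_n=\sum_{k=0}^nX_k$, $n\ge0$. Scaling: for $t\in\varepsilon\mathbb{N}$, $S^\varepsilon(t)=\varepsilon S_{t/\varepsilon}$, $M^\varepsilon(t)=\varepsilon M_{t/\varepsilon}$, $X^\varepsilon(t)=X_{t/\varepsilon}$. The process $S^\varepsilon$ is extended to $t\in[0,\infty)$ by linear interpolation, and $X^\varepsilon$, $M^\varepsilon$ are extended to $[0,\infty)$ as piecewise constant right-continuous functions (constant on each $[n\varepsilon,(n+1)\varepsilon)$). *)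

theory Defs
  imports "HOL-Probability.Probability"
begin

section \<open>Cadlag functions on the half-line and Skorohod's topology\<close>

text \<open>Functions on \<open>[0,\<infinity>)\<close> are represented by functions on the reals whose values at negative
  arguments play no role.\<close>

definition cadlag :: "(real \<Rightarrow> 'a::topological_space) \<Rightarrow> bool" where
  "cadlag x \<longleftrightarrow>
     (\<forall>t\<ge>0. (x \<longlongrightarrow> x t) (at_right t)) \<and> (\<forall>t>0. \<exists>l. (x \<longlongrightarrow> l) (at_left t))"

text \<open>A time change is a strictly increasing bijection of \<open>[0,\<infinity>)\<close> onto itself; it is
  automatically continuous.\<close>

definition time_change :: "(real \<Rightarrow> real) \<Rightarrow> bool" where
  "time_change \<tau> \<longleftrightarrow> strict_mono_on {0..} \<tau> \<and> \<tau> ` {0..} = {0..}"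

text \<open>Skorohod's J1 topology on the space of cadlag functions is the metrizable topology in which
  \<open>y\<^sub>n\<close> converges to \<open>x\<close> iff there are time changes \<open>\<tau>\<^sub>n\<close> with
  \<open>sup\<^sub>s \<bar>\<tau>\<^sub>n s - s\<bar> \<longlonglongrightarrow> 0\<close> and \<open>sup\<^bsub>s \<le> N\<^esub> dist (y\<^sub>n (\<tau>\<^sub>n s)) (x s) \<longlonglongrightarrow> 0\<close> for every \<open>N\<close>.
  The sets \<open>{y. skorohod_close r x y}\<close>, \<open>r > 0\<close>, form a neighbourhood base at \<open>x\<close>; see
  \<open>limitin_skorohod\<close> and \<open>limitin_skorohod_sequentially\<close> below.\<close>

definition skorohod_close :: "real \<Rightarrow> (real \<Rightarrow> 'a::metric_space) \<Rightarrow> (real \<Rightarrow> 'a) \<Rightarrow> bool" where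
  "skorohod_close r x y \<longleftrightarrow>
     (\<exists>\<tau>. time_change \<tau> \<and> (\<forall>s\<ge>0. \<bar>\<tau> s - s\<bar> \<le> r) \<and> (\<forall>s\<in>{0..1/r}. dist (y (\<tau> s)) (x s) \<le> r))"

definition skorohod_topology :: "(real \<Rightarrow> 'a::metric_space) topology" where
  "skorohod_topology = topology (\<lambda>U. U \<subseteq> Collect cadlag \<and>
     (\<forall>x\<in>U. \<exists>r>0. \<forall>y. cadlag y \<and> skorohod_close r x y \<longrightarrow> y \<in> U))"

lemma time_change_id: "time_change (\<lambda>s. s)"
  by (auto simp: time_change_def strict_mono_on_def)

lemma time_change_nonneg: "time_change l \<Longrightarrow> 0 \<le> s \<Longrightarrow> 0 \<le> l s"
  unfolding time_change_def by (metis atLeast_iff imageI)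

lemma time_change_compose:
  assumes "time_change l" "time_change m" shows "time_change (\<lambda>s. m (l s))"
proof -
  have "(\<lambda>s. m (l s)) ` {0..} = m ` (l ` {0..})"
    by (simp add: image_image)
  then show ?thesis
    using assms time_change_nonneg[OF assms(1)] by (auto simp: time_change_def strict_mono_on_def)
qed

lemma skorohod_close_refl: "0 < r \<Longrightarrow> skorohod_close r x x"
  unfolding skorohod_close_def using time_change_id by (intro exI[of _ "\<lambda>s. s"]) auto

lemma skorohod_close_mono:
  assumes "skorohod_close r x y" "0 < r" "r \<le> r'" shows "skorohod_close r' x y"
proof -
  have "1 / r' \<le> 1 / r" using assms by (intro divide_left_mono) auto
  then have "{0..1/r'} \<subseteq> {0..1/r}" by auto
  then show ?thesis using assms unfolding skorohod_close_def by (meson order_trans subsetD)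
qed

lemma skorohod_close_trans:
  assumes xy: "skorohod_close r x y" and yz: "skorohod_close q y z"
    and r: "0 < r" and q: "0 < q" "q \<le> r" "q \<le> 1 / (1 / r + r)"
  shows "skorohod_close (2 * r) x z"
proof -
  obtain l where l: "time_change l" "\<And>s. 0 \<le> s \<Longrightarrow> \<bar>l s - s\<bar> \<le> r"
    "\<And>s. s \<in> {0..1/r} \<Longrightarrow> dist (y (l s)) (x s) \<le> r"
    using xy unfolding skorohod_close_def by auto
  obtain m where m: "time_change m" "\<And>s. 0 \<le> s \<Longrightarrow> \<bar>m s - s\<bar> \<le> q"
    "\<And>s. s \<in> {0..1/q} \<Longrightarrow> dist (z (m s)) (y s) \<le> q"
    using yz unfolding skorohod_close_def by auto
  have "0 < 1 / r + r" using r by (simp add: add_pos_pos)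
  then have hor: "1 / r + r \<le> 1 / q" using q by (simp add: field_simps)
  have a: "\<bar>m (l s) - s\<bar> \<le> 2 * r" if "0 \<le> s" for s
    using l(2)[OF that] m(2)[OF time_change_nonneg[OF l(1) that]] q by linarith
  have b: "dist (z (m (l s))) (x s) \<le> 2 * r" if s: "s \<in> {0..1/(2*r)}" for s
  proof -
    have "1 / (2 * r) \<le> 1 / r" using r by (simp add: field_simps)
    then have s': "s \<in> {0..1/r}" using s by auto
    then have "l s \<in> {0..1/q}"
      using l(2)[of s] time_change_nonneg[OF l(1), of s] hor by auto
    from m(3)[OF this] l(3)[OF s'] q show ?thesis
      using dist_triangle[of "z (m (l s))" "x s" "y (l s)"] by linarith
  qed
  show ?thesis
    unfolding skorohod_close_def using time_change_compose[OF l(1) m(1)] a b by blast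
qed

lemma openin_skorohod:
  "openin skorohod_topology U \<longleftrightarrow> U \<subseteq> Collect cadlag \<and>
     (\<forall>x\<in>U. \<exists>r>0. \<forall>y. cadlag y \<and> skorohod_close r x y \<longrightarrow> y \<in> U)"
proof -
  have "istopology (\<lambda>U::(real \<Rightarrow> 'a) set. U \<subseteq> Collect cadlag \<and>
     (\<forall>x\<in>U. \<exists>r>0. \<forall>y. cadlag y \<and> skorohod_close r x y \<longrightarrow> y \<in> U))"
    (is "istopology ?P")
    unfolding istopology_def
  proof (intro conjI allI impI)
    fix S T assume S: "?P S" and T: "?P T"
    show "S \<inter> T \<subseteq> Collect cadlag" using S by blast
    show "\<forall>x\<in>S \<inter> T. \<exists>r>0. \<forall>y. cadlag y \<and> skorohod_close r x y \<longrightarrow> y \<in> S \<inter> T"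
    proof
      fix x assume x: "x \<in> S \<inter> T"
      obtain r where r: "r > 0" "\<And>y. cadlag y \<Longrightarrow> skorohod_close r x y \<Longrightarrow> y \<in> S"
        using S x by blast
      obtain q where q: "q > 0" "\<And>y. cadlag y \<Longrightarrow> skorohod_close q x y \<Longrightarrow> y \<in> T"
        using T x by blast
      have "skorohod_close (min r q) x y \<Longrightarrow> skorohod_close r x y \<and> skorohod_close q x y" for y
        using r(1) q(1) skorohod_close_mono[of "min r q" x y] by simp
      then show "\<exists>r>0. \<forall>y. cadlag y \<and> skorohod_close r x y \<longrightarrow> y \<in> S \<inter> T"
        using r q by (intro exI[of _ "min r q"]) auto
    qed
  next
    fix K assume K: "\<forall>S\<in>K. ?P S"
    show "\<Union>K \<subseteq> Collect cadlag" using K by blast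
    show "\<forall>x\<in>\<Union>K. \<exists>r>0. \<forall>y. cadlag y \<and> skorohod_close r x y \<longrightarrow> y \<in> \<Union>K"
      using K by (meson UnionE UnionI)
  qed
  then show ?thesis unfolding skorohod_topology_def by (simp add: topology_inverse')
qed

lemma topspace_skorohod [simp]: "topspace skorohod_topology = Collect cadlag"
proof -
  have "openin skorohod_topology (Collect (cadlag :: (real \<Rightarrow> 'a) \<Rightarrow> bool))"
    unfolding openin_skorohod using zero_less_one by blast
  then show ?thesis
    using openin_subset openin_skorohod by (metis openin_topspace subset_antisym)
qed

lemma limitin_skorohod:
  "limitin skorohod_topology y x F \<longleftrightarrow>
     cadlag x \<and> (\<forall>r>0. \<forall>\<^sub>F i in F. cadlag (y i) \<and> skorohod_close r x (y i))"
proof (cases "cadlag x")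
  case x: True
  have "\<forall>\<^sub>F i in F. cadlag (y i) \<and> skorohod_close r x (y i)"
    if lim: "limitin skorohod_topology y x F" and r: "0 < r" for r
  proof -
    define U where "U = {z. cadlag z \<and> (\<exists>q>0. \<forall>w. cadlag w \<and> skorohod_close q z w \<longrightarrow> skorohod_close r x w)}"
    have "openin skorohod_topology U"
      unfolding openin_skorohod
    proof (intro conjI ballI)
      show "U \<subseteq> Collect cadlag" by (auto simp: U_def)
      fix z assume "z \<in> U"
      then obtain q where q: "q > 0" "\<And>w. cadlag w \<Longrightarrow> skorohod_close q z w \<Longrightarrow> skorohod_close r x w"
        unfolding U_def by auto
      have "w \<in> U" if w: "cadlag w" "skorohod_close (q / 2) z w" for w
      proof -
        define p where "p = min (q / 2) (1 / (1 / (q / 2) + q / 2))"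
        have p: "0 < p" "p \<le> q / 2" "p \<le> 1 / (1 / (q / 2) + q / 2)"
          using q(1) by (auto simp: p_def add_pos_pos)
        have "skorohod_close r x v" if "cadlag v" "skorohod_close p w v" for v
          using skorohod_close_trans[OF w(2) that(2) _ p] q that(1) by simp
        then show ?thesis using w p unfolding U_def by auto
      qed
      then show "\<exists>q>0. \<forall>w. cadlag w \<and> skorohod_close q z w \<longrightarrow> w \<in> U"
        using q(1) by (intro exI[of _ "q / 2"]) auto
    qed
    moreover have "x \<in> U" using x r unfolding U_def by auto
    ultimately have "\<forall>\<^sub>F i in F. y i \<in> U" using lim unfolding limitin_def by blast
    then show ?thesis
      by (rule eventually_mono) (auto simp: U_def intro: skorohod_close_refl)
  qed
  moreover have "limitin skorohod_topology y x F"
    if ev: "\<forall>r>0. \<forall>\<^sub>F i in F. cadlag (y i) \<and> skorohod_close r x (y i)"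
    unfolding limitin_def
  proof (intro conjI allI impI)
    show "x \<in> topspace skorohod_topology" using x by simp
    fix U assume "openin skorohod_topology U \<and> x \<in> U"
    then obtain r where r: "r > 0" "\<And>z. cadlag z \<Longrightarrow> skorohod_close r x z \<Longrightarrow> z \<in> U"
      unfolding openin_skorohod by blast
    show "\<forall>\<^sub>F i in F. y i \<in> U"
      using ev[rule_format, OF r(1)] by (rule eventually_mono) (auto intro: r)
  qed
  ultimately show ?thesis using x by blast
qed (auto simp: limitin_def)

lemma limitin_skorohod_sequentially:
  assumes "cadlag x" "\<And>n. cadlag (y n)"
  shows "limitin skorohod_topology y x sequentially \<longleftrightarrow>
    (\<exists>\<tau>. (\<forall>n. time_change (\<tau> n)) \<and> (\<forall>r>0. \<forall>\<^sub>F n in sequentially. \<forall>s\<ge>0. \<bar>\<tau> n s - s\<bar> \<le> r) \<and>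
      (\<forall>N r. r > 0 \<longrightarrow> (\<forall>\<^sub>F n in sequentially. \<forall>s\<in>{0..N}. dist (y n (\<tau> n s)) (x s) \<le> r)))"
    (is "?L \<longleftrightarrow> ?R")
proof
  assume ?L
  then have ev: "\<forall>\<^sub>F n in sequentially. skorohod_close r x (y n)" if "r > 0" for r
    using that unfolding limitin_skorohod by (auto elim: eventually_mono)
  define G where "G n k l \<longleftrightarrow> time_change l \<and> (\<forall>s\<ge>0. \<bar>l s - s\<bar> \<le> inverse (real (Suc k))) \<and>
      (\<forall>s\<in>{0..real (Suc k)}. dist (y n (l s)) (x s) \<le> inverse (real (Suc k)))" for n k l
  have G_ev: "\<forall>\<^sub>F n in sequentially. \<exists>l. G n k l" for k
    using ev[of "inverse (real (Suc k))"] unfolding skorohod_close_def G_def by (simp add: field_simps)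
  \<comment> \<open>for each \<open>n\<close> use the best precision \<open>k \<le> n\<close> that is available\<close>
  have "\<exists>l. time_change l \<and> (\<forall>k\<le>n. (\<exists>l. G n k l) \<longrightarrow> (\<exists>j\<ge>k. G n j l))" for n
  proof (cases "\<exists>k\<le>n. \<exists>l. G n k l")
    case True
    define j where "j = Max {k. k \<le> n \<and> (\<exists>l. G n k l)}"
    have "j \<in> {k. k \<le> n \<and> (\<exists>l. G n k l)}"
      unfolding j_def using True by (intro Max_in) auto
    then obtain l where l: "G n j l" by auto
    have "k \<le> j" if "k \<le> n" "\<exists>l. G n k l" for k
      unfolding j_def using that by (intro Max_ge) auto
    then show ?thesis using l G_def by blast
  qed (use time_change_id in blast)
  then obtain l where l: "\<And>n. time_change (l n)"
    "\<And>n k. k \<le> n \<Longrightarrow> \<exists>l. G n k l \<Longrightarrow> \<exists>j\<ge>k. G n j (l n)" by metis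
  have G_l: "\<forall>\<^sub>F n in sequentially. \<exists>j\<ge>k. G n j (l n)" for k
    using G_ev[of k] eventually_ge_at_top[of k] by eventually_elim (auto intro: l(2))
  show ?R
  proof (intro exI[of _ l] conjI allI impI)
    show "time_change (l n)" for n by (rule l)
  next
    fix r :: real assume "r > 0"
    then obtain k where k: "inverse (real (Suc k)) < r" using reals_Archimedean by blast
    show "\<forall>\<^sub>F n in sequentially. \<forall>s\<ge>0. \<bar>l n s - s\<bar> \<le> r"
      using G_l[of k]
    proof eventually_elim
      case (elim n)
      then obtain j where j: "j \<ge> k" "G n j (l n)" by blast
      have a: "inverse (real (Suc j)) \<le> inverse (real (Suc k))" using j by (intro le_imp_inverse_le) auto
      show ?case
      proof (intro allI impI)
        fix s :: real assume "0 \<le> s"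
        then have "\<bar>l n s - s\<bar> \<le> inverse (real (Suc j))" using j(2) unfolding G_def by blast
        then show "\<bar>l n s - s\<bar> \<le> r" using a k by linarith
      qed
    qed
  next
    fix N r :: real assume "r > 0"
    then obtain k1 where k1: "inverse (real (Suc k1)) < r" using reals_Archimedean by blast
    obtain k2 where k2: "N \<le> real k2" using real_arch_simple by blast
    show "\<forall>\<^sub>F n in sequentially. \<forall>s\<in>{0..N}. dist (y n (l n s)) (x s) \<le> r"
      using G_l[of "max k1 k2"]
    proof eventually_elim
      case (elim n)
      then obtain j where j: "j \<ge> max k1 k2" "G n j (l n)" by blast
      have a: "inverse (real (Suc j)) \<le> inverse (real (Suc k1))" using j by (intro le_imp_inverse_le) auto
      have b: "N \<le> real (Suc j)" using j k2 by linarith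
      show ?case
      proof
        fix s assume "s \<in> {0..N}"
        then have "s \<in> {0..real (Suc j)}" using b by auto
        then have "dist (y n (l n s)) (x s) \<le> inverse (real (Suc j))" using j(2) unfolding G_def by blast
        then show "dist (y n (l n s)) (x s) \<le> r" using a k1 by linarith
      qed
    qed
  qed
next
  assume ?R
  then obtain l where L: "(\<forall>n. time_change (l n)) \<and> (\<forall>r>0. \<forall>\<^sub>F n in sequentially. \<forall>s\<ge>0. \<bar>l n s - s\<bar> \<le> r) \<and>
      (\<forall>N r. r > 0 \<longrightarrow> (\<forall>\<^sub>F n in sequentially. \<forall>s\<in>{0..N}. dist (y n (l n s)) (x s) \<le> r))"
    by (rule exE)
  have l: "\<And>n. time_change (l n)"
    "\<And>r. r > 0 \<Longrightarrow> \<forall>\<^sub>F n in sequentially. \<forall>s\<ge>0. \<bar>l n s - s\<bar> \<le> r"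
    "\<And>N r. r > 0 \<Longrightarrow> \<forall>\<^sub>F n in sequentially. \<forall>s\<in>{0..N}. dist (y n (l n s)) (x s) \<le> r"
    using L by simp_all
  have "\<forall>\<^sub>F n in sequentially. cadlag (y n) \<and> skorohod_close r x (y n)" if "r > 0" for r
    using l(2)[OF that] l(3)[OF that, of "1 / r"]
  proof eventually_elim
    case (elim n)
    then show ?case using assms(2) l(1) unfolding skorohod_close_def by blast
  qed
  then show ?L using assms unfolding limitin_skorohod by blast
qed


section \<open>Convergence in distribution\<close>

text \<open>Random elements are only required to take values in the space almost surely and to be Borel
  measurable up to null sets; hence the completions.  The laws, and the expectations of bounded
  continuous functions, do not depend on the null sets involved.\<close>

definition random_element :: "'x topology \<Rightarrow> 'b measure \<Rightarrow> ('b \<Rightarrow> 'x) \<Rightarrow> bool" where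
  "random_element T M Z \<longleftrightarrow> (AE \<omega> in M. Z \<omega> \<in> topspace T) \<and>
     (\<forall>U. openin T U \<longrightarrow> {\<omega> \<in> space M. Z \<omega> \<in> U} \<in> sets (completion M))"

definition conv_in_distribution ::
  "'x topology \<Rightarrow> ('i \<Rightarrow> 'b measure) \<Rightarrow> ('i \<Rightarrow> 'b \<Rightarrow> 'x) \<Rightarrow> 'c measure \<Rightarrow> ('c \<Rightarrow> 'x) \<Rightarrow> 'i filter \<Rightarrow> bool"
  where
  "conv_in_distribution T P Z M Z0 F \<longleftrightarrow>
     (\<forall>\<^sub>F i in F. random_element T (P i) (Z i)) \<and> random_element T M Z0 \<and>
     (\<forall>\<phi>. continuous_map T euclideanreal \<phi> \<and> bounded (\<phi> ` topspace T) \<longrightarrow>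
       ((\<lambda>i. \<integral>\<omega>. \<phi> (Z i \<omega>) \<partial>completion (P i)) \<longlongrightarrow> (\<integral>\<omega>. \<phi> (Z0 \<omega>) \<partial>completion M)) F)"


section \<open>Markov chains and Markov processes\<close>

definition markov_chain ::
  "'b measure \<Rightarrow> 's set \<Rightarrow> ('s \<Rightarrow> 's pmf) \<Rightarrow> (nat \<Rightarrow> 'b \<Rightarrow> 's) \<Rightarrow> bool" where
  "markov_chain P E K Y \<longleftrightarrow> (\<forall>n. Y n \<in> P \<rightarrow>\<^sub>M count_space E) \<and>
     (\<forall>n y. y \<in> {..Suc n} \<rightarrow> E \<and> \<P>(\<omega> in P. \<forall>k\<le>n. Y k \<omega> = y k) > 0 \<longrightarrow>
        \<P>(\<omega> in P. Y (Suc n) \<omega> = y (Suc n) \<bar> \<forall>k\<le>n. Y k \<omega> = y k) = pmf (K (y n)) (y (Suc n)))"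

definition generated_sigma :: "'c measure \<Rightarrow> (real \<Rightarrow> 'c \<Rightarrow> 's::topological_space) \<Rightarrow> real set \<Rightarrow> 'c measure"
  where
  "generated_sigma M Z I = sigma (space M) (\<Union>u\<in>I. {Z u -` A \<inter> space M |A. A \<in> sets borel})"

text \<open>The Markov property with respect to the natural filtration.\<close>

definition markov_process :: "'c measure \<Rightarrow> (real \<Rightarrow> 'c \<Rightarrow> 's::topological_space) \<Rightarrow> bool" where
  "markov_process M Z \<longleftrightarrow> (\<forall>t\<ge>0. Z t \<in> borel_measurable M) \<and>
     (\<forall>s t A. 0 \<le> s \<and> s \<le> t \<and> A \<in> sets borel \<longrightarrow>
        (AE \<omega> in M. real_cond_exp M (generated_sigma M Z {0..s}) (\<lambda>\<omega>. indicator A (Z t \<omega>)) \<omega> =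
                     real_cond_exp M (generated_sigma M Z {s}) (\<lambda>\<omega>. indicator A (Z t \<omega>)) \<omega>))"


section \<open>The persistent random walk\<close>

text \<open>The position \<open>a\<^sub>i\<close> has index \<open>i = 1\<close> for \<open>-1\<close> and \<open>i = 2\<close> for \<open>1\<close>.\<close>

definition prw_states :: "(real \<times> nat) set" where
  "prw_states = {-1, 1} \<times> {1..}"

definition prw_kernel :: "(nat \<Rightarrow> nat \<Rightarrow> real) \<Rightarrow> real \<times> nat \<Rightarrow> (real \<times> nat) pmf" where
  "prw_kernel \<alpha> = (\<lambda>(x, n). map_pmf (\<lambda>change. if change then (-x, 1) else (x, n + 1))
     (bernoulli_pmf (\<alpha> (if x = -1 then 1 else 2) n)))"

lemma pmf_prw_kernel:
  assumes "0 \<le> \<alpha> i n" "\<alpha> i n \<le> 1" "(i = 1 \<and> a = -1) \<or> (i = 2 \<and> a = 1)"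
  shows "pmf (prw_kernel \<alpha> (a, n)) (a, n + 1) = 1 - \<alpha> i n"
    and "pmf (prw_kernel \<alpha> (a, n)) (-a, 1) = \<alpha> i n"
proof -
  have a: "a \<noteq> - a" and i: "(if a = -1 then 1 else 2) = i" using assms(3) by auto
  have 1: "(\<lambda>c. if c then (-a, 1) else (a, n + 1)) -` {(a, n + 1)} = {False}"
    and 2: "(\<lambda>c. if c then (-a, 1) else (a, n + 1)) -` {(-a, 1)} = {True}"
    using a by (auto split: if_splits)
  show "pmf (prw_kernel \<alpha> (a, n)) (a, n + 1) = 1 - \<alpha> i n"
    unfolding prw_kernel_def prod.case i pmf_map 1 using assms by (simp add: measure_pmf_single)
  show "pmf (prw_kernel \<alpha> (a, n)) (-a, 1) = \<alpha> i n"
    unfolding prw_kernel_def prod.case i pmf_map 2 using assms by (simp add: measure_pmf_single)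
qed

text \<open>Change times may be infinite; \<open>Inf {} = \<infinity>\<close> in \<^typ>\<open>enat\<close>, and the set below is empty when
  the previous change time is infinite.\<close>

primrec change_time :: "(nat \<Rightarrow> real) \<Rightarrow> nat \<Rightarrow> enat" where
  "change_time x 0 = 0"
| "change_time x (Suc n) =
     Inf {enat i |i. change_time x n \<le> enat i \<and> x i \<noteq> x (the_enat (change_time x n))}"

text \<open>The differences are taken in \<^typ>\<open>enat\<close>, where \<open>\<infinity> - \<infinity> = \<infinity>\<close>.\<close>

definition scaled_gap :: "real \<Rightarrow> (nat \<Rightarrow> real) \<Rightarrow> nat \<Rightarrow> ereal" where
  "scaled_gap \<epsilon> x k = ereal \<epsilon> * ereal_of_enat (change_time x k - change_time x (k - 1))"

definition walk :: "(nat \<Rightarrow> real) \<Rightarrow> nat \<Rightarrow> real" where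
  "walk x n = (\<Sum>k=0..n. x k)"

definition lin_interp :: "(nat \<Rightarrow> real) \<Rightarrow> real \<Rightarrow> real" where
  "lin_interp s u = (1 - frac u) * s (nat \<lfloor>u\<rfloor>) + frac u * s (nat \<lfloor>u\<rfloor> + 1)"

definition scaled_walk :: "real \<Rightarrow> (nat \<Rightarrow> real) \<Rightarrow> real \<Rightarrow> real" where
  "scaled_walk \<epsilon> x t = \<epsilon> * lin_interp (walk x) (t / \<epsilon>)"

definition scaled_step :: "real \<Rightarrow> (nat \<Rightarrow> real) \<Rightarrow> real \<Rightarrow> real" where
  "scaled_step \<epsilon> x t = x (nat \<lfloor>t / \<epsilon>\<rfloor>)"

definition scaled_age :: "real \<Rightarrow> (nat \<Rightarrow> nat) \<Rightarrow> real \<Rightarrow> real" where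
  "scaled_age \<epsilon> m t = \<epsilon> * real (m (nat \<lfloor>t / \<epsilon>\<rfloor>))"


section \<open>The limit process\<close>

text \<open>The sequence \<open>e\<close> is indexed from 1; its value at 0 is not used.\<close>

definition renewal_count :: "(nat \<Rightarrow> real) \<Rightarrow> real \<Rightarrow> nat" where
  "renewal_count e t = (\<Sum>n. if (\<Sum>k=1..Suc n. e k) \<le> t then 1 else 0)"

definition renewal_age :: "(nat \<Rightarrow> real) \<Rightarrow> real \<Rightarrow> real" where
  "renewal_age e t = t - Sup {\<Sum>j=1..k. e j |k. (\<Sum>j=1..k. e j) \<le> t}"

definition telegraph :: "(nat \<Rightarrow> real) \<Rightarrow> real \<Rightarrow> real" where
  "telegraph e t = (-1) ^ renewal_count e t"

definition integrated_telegraph :: "(nat \<Rightarrow> real) \<Rightarrow> real \<Rightarrow> real" where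
  "integrated_telegraph e t = (LBINT s:{0..t}. telegraph e s)"

end

theory Submission
  imports Defs
begin

text \<open>Both convergences come from one coupling on the space that carries \<open>e\<close>. Let the \<open>k\<close>-th sojourn
  of the walk be the least \<open>n\<close> with \<open>(1 - \<alpha>\<^bsub>i,1\<^esub>) \<dots> (1 - \<alpha>\<^bsub>i,n\<^esub>) \<le> G\<^sub>i(e\<^sub>k)\<close>, where
  \<open>G\<^sub>i(t) = exp (- \<integral>\<^sub>0\<^sup>t f\<^sub>i)\<close> is the survival function of \<open>e\<^sub>k\<close>. Since \<open>G\<^sub>i(e\<^sub>k)\<close> is uniform, these
  sojourns are those of the chain; since the products up to \<open>t/\<epsilon>\<close> converge to the strictly
  decreasing \<open>G\<^sub>i(t)\<close>, the sojourns times \<open>\<epsilon>\<close> converge to the \<open>e\<^sub>k\<close> pointwise. A piecewise linear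
  time change carrying the jump times of the limit to those of the walk then gives Skorohod
  convergence of the coupled paths, almost surely.

  For the Markov property, fix \<open>s\<close> and the number \<open>k\<close> of renewals before \<open>s\<close>. The past is then a
  function of \<open>e\<^sub>1, \<dots>, e\<^sub>k\<close>, and the future a function of the present state and of
  \<open>e\<^bsub>k+1\<^esub>, e\<^bsub>k+2\<^esub>, \<dots>\<close>; integrating out the latter by Fubini's theorem leaves a function of the
  present state only.\<close>

section \<open>Cadlag rates\<close>

text \<open>The chains for different \<open>\<epsilon>\<close> live on unrelated spaces, so
  pointwise convergence of the coupled walk says nothing about them until two facts are in place:
  kernel and starting point determine the law of the whole sequence, and the functionals involved
  are measurable functions of that sequence. Positivity of the rates makes \<open>G\<^sub>i\<close>
  strictly decreasing, which turns convergence of the products at fixed times into convergence of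
  their inverses; divergence of the integrals makes \<open>G\<^sub>i\<close> reach every level in
  (0,1], so that the coupled sojourns have exactly the law of the chain. A Skorohod neighbourhood of
  radius r only inspects [0, 1/r], hence finitely many sojourns, provided the renewal times do not
  accumulate. As the waiting times alternate between two laws, this is obtained from a common lower
  bound on the two medians and independence. The limit path is known to be cadlag only almost
  surely, so its measurability holds up to completion. In the Markov part the number of past
  renewals is hidden; only its parity is visible in the state, and this suffices because the rates
  have period two.\<close>

definition grid_above :: "real \<Rightarrow> real \<Rightarrow> real" where
  "grid_above h u = h * (of_int \<lfloor>u / h\<rfloor> + 1)"

lemma grid_above_bounds:
  assumes "h > 0" shows "u < grid_above h u" "grid_above h u \<le> u + h"
proof -
  have "u / h < of_int \<lfloor>u / h\<rfloor> + 1" by linarith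
  then show "u < grid_above h u" using assms by (simp add: grid_above_def field_simps)
  have "h * of_int \<lfloor>u / h\<rfloor> \<le> h * (u / h)" using assms by (intro mult_left_mono) auto
  then show "grid_above h u \<le> u + h" using assms by (simp add: grid_above_def distrib_left)
qed

text \<open>The right end of the mesh cell of \<open>u\<close> lies strictly above \<open>u\<close>,
  even at mesh points, so the approach is from the right and right-continuity transfers it to cadlag
  functions.\<close>

lemma grid_above_tendsto:
  assumes e: "\<And>n. e n > 0" "e \<longlonglongrightarrow> (0::real)"
  shows "filterlim (\<lambda>n. grid_above (e n) u) (at_right u) sequentially"
proof -
  have "(\<lambda>n. grid_above (e n) u) \<longlonglongrightarrow> u"
  proof (rule tendsto_sandwich[of "\<lambda>_. u" _ _ "\<lambda>n. u + e n"])
    show "\<forall>\<^sub>F n in sequentially. u \<le> grid_above (e n) u"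
      using grid_above_bounds(1)[OF e(1)] by (auto intro: always_eventually less_imp_le)
    show "\<forall>\<^sub>F n in sequentially. grid_above (e n) u \<le> u + e n"
      using grid_above_bounds(2)[OF e(1)] by (auto intro: always_eventually)
    show "(\<lambda>n. u + e n) \<longlonglongrightarrow> u" using tendsto_add[OF tendsto_const e(2), of u] by simp
  qed auto
  then show ?thesis
    using grid_above_bounds(1)[OF e(1)] by (auto simp: filterlim_at intro!: always_eventually
        less_imp_neq[symmetric])
qed

lemma filterlim_at_right_0:
  fixes e :: "nat \<Rightarrow> real"
  assumes "\<And>n. 0 < e n" "e \<longlonglongrightarrow> 0"
  shows "filterlim e (at_right 0) sequentially"
  using assms by (auto simp: filterlim_at intro!: always_eventually less_imp_neq[symmetric])

text \<open>Near each point the right and left limits bound \<open>f\<close> on either side; the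
  bisection principle \<open>Bolzano\<close> turns these local bounds into one bound on
  \<open>[0, T]\<close>.\<close>

lemma cadlag_bounded:
  fixes f :: "real \<Rightarrow> real"
  assumes f: "cadlag f" and T: "0 \<le> T"
  obtains C where "C \<ge> 0" "\<And>u. 0 \<le> u \<Longrightarrow> u \<le> T \<Longrightarrow> \<bar>f u\<bar> \<le> C"
proof -
  define P where "P a b \<longleftrightarrow> (\<exists>C. \<forall>u. 0 \<le> u \<and> a \<le> u \<and> u \<le> b \<longrightarrow> \<bar>f u\<bar> \<le> C)" for a b
  have "P 0 T"
    using T
  proof (induction rule: Bolzano)
    case (trans a b c)
    from trans(1)[unfolded P_def] obtain C where "\<forall>u. 0 \<le> u \<and> a \<le> u \<and> u \<le> b \<longrightarrow> \<bar>f u\<bar> \<le> C" ..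
    moreover from trans(2)[unfolded P_def] obtain D where "\<forall>u. 0 \<le> u \<and> b \<le> u \<and> u \<le> c \<longrightarrow> \<bar>f u\<bar> \<le> D" ..
    ultimately have "\<bar>f u\<bar> \<le> max C D" if "0 \<le> u" "a \<le> u" "u \<le> c" for u
      using that by (cases "u \<le> b") (auto simp: le_max_iff_disj)
    then show ?case unfolding P_def by blast
  next
    case (local x)
    have "\<forall>\<^sub>F u in at_right x. dist (f u) (f x) < 1"
      using f local by (intro tendstoD[of f "f x"]) (auto simp: cadlag_def)
    then obtain b where b: "b > x" "\<And>u. x < u \<Longrightarrow> u < b \<Longrightarrow> dist (f u) (f x) < 1"
      unfolding eventually_at_right_field by blast
    have "\<exists>a C. a < x \<and> (\<forall>u. 0 \<le> u \<and> a < u \<and> u < x \<longrightarrow> \<bar>f u\<bar> \<le> C)"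
    \<comment> \<open>At 0 there is no left limit, but the condition \<open>0 \<le> u\<close>
      empties the left neighbourhood.\<close>
    proof (cases "x = 0")
      case True
      then show ?thesis by (intro exI[of _ "-1"]) auto
    next
      case False
      then obtain l where "(f \<longlongrightarrow> l) (at_left x)" using f local unfolding cadlag_def by force
      then have "\<forall>\<^sub>F u in at_left x. dist (f u) l < 1" by (rule tendstoD) simp
      then obtain a where a: "a < x" "\<And>u. a < u \<Longrightarrow> u < x \<Longrightarrow> dist (f u) l < 1"
        unfolding eventually_at_left_field by blast
      have "\<bar>f u\<bar> \<le> \<bar>l\<bar> + 1" if "a < u" "u < x" for u
        using a(2)[OF that] by (simp add: dist_real_def)
      then show ?thesis using a(1) by blast
    qed
    then obtain a C where a: "a < x" "\<And>u. 0 \<le> u \<Longrightarrow> a < u \<Longrightarrow> u < x \<Longrightarrow> \<bar>f u\<bar> \<le> C" by blast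
    have bd: "\<bar>f u\<bar> \<le> max C (\<bar>f x\<bar> + 1)" if "0 \<le> u" "a < u" "u < b" for u
    proof (cases u x rule: linorder_cases)
      case less then show ?thesis using a(2)[of u] that by auto
    next
      case equal then show ?thesis by auto
    next
      case greater
      then show ?thesis using b(2)[of u] that by (simp add: dist_real_def)
    qed
    show ?case
    proof (intro exI[of _ "min (b - x) (x - a)"] conjI allI impI)
      show "0 < min (b - x) (x - a)" using a b by simp
      fix p q assume "p \<le> x \<and> x \<le> q \<and> q - p < min (b - x) (x - a)"
      then have "a < p" "q < b" by auto
      then show "P p q"
        unfolding P_def using bd by (intro exI[of _ "max C (\<bar>f x\<bar> + 1)"]) auto
    qed
  qed
  then obtain C where "\<forall>u. 0 \<le> u \<and> u \<le> T \<longrightarrow> \<bar>f u\<bar> \<le> C" unfolding P_def by blast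
  then show ?thesis using that[of "max C 0"] by (auto simp: le_max_iff_disj)
qed

text \<open>The map factors through the integer \<open>floor (u / h)\<close>, and every function on
  a discrete space is measurable.\<close>

lemma borel_measurable_grid_above:
  "(\<lambda>u. f (grid_above h u)) \<in> borel_measurable borel"
proof -
  have "(\<lambda>u. \<lfloor>u / h\<rfloor>) \<in> borel \<rightarrow>\<^sub>M count_space UNIV" by measurable
  moreover have "(\<lambda>i::int. f (h * (of_int i + 1))) \<in> count_space UNIV \<rightarrow>\<^sub>M borel" by simp
  ultimately show ?thesis unfolding grid_above_def by (rule measurable_compose)
qed

text \<open>By right-continuity \<open>f\<close> is the pointwise limit of its step functions along
  \<open>grid_above\<close>; the indicator discards the unconstrained values at negative
  arguments.\<close>

lemma cadlag_borel_measurable: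
  fixes f :: "real \<Rightarrow> real"
  assumes f: "cadlag f"
  shows "(\<lambda>u. indicator {0..} u * f u) \<in> borel_measurable borel"
proof (rule borel_measurable_LIMSEQ_real)
  show "(\<lambda>u. indicator {0..} u * f (grid_above (1 / real (Suc n)) u)) \<in> borel_measurable borel" for n
    using borel_measurable_grid_above by measurable
  fix u :: real
  have "(\<lambda>n. 1 / real (Suc n)) \<longlonglongrightarrow> 0" by (rule LIMSEQ_Suc[OF lim_1_over_n])
  then have lim: "filterlim (\<lambda>n. grid_above (1 / real (Suc n)) u) (at_right u) sequentially"
    by (intro grid_above_tendsto) auto
  show "(\<lambda>n. indicator {0..} u * f (grid_above (1 / real (Suc n)) u)) \<longlonglongrightarrow> indicator {0..} u * f u"
  proof (cases "u \<ge> 0")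
    case True
    then have "(f \<longlongrightarrow> f u) (at_right u)" using f by (auto simp: cadlag_def)
    from filterlim_compose[OF this lim] show ?thesis by (intro tendsto_mult_left)
  qed simp
qed

lemma cadlag_set_integrable:
  fixes f :: "real \<Rightarrow> real"
  assumes f: "cadlag f" and A: "A \<in> sets borel" "A \<subseteq> {0..T}"
  shows "set_integrable lborel A f"
proof (cases "0 \<le> T")
  case True
  then obtain C where C: "C \<ge> 0" "\<And>u. 0 \<le> u \<Longrightarrow> u \<le> T \<Longrightarrow> \<bar>f u\<bar> \<le> C" by (rule cadlag_bounded[OF f]) auto
  have eq: "(\<lambda>u. indicator A u *\<^sub>R f u) = (\<lambda>u. indicator A u * (indicator {0..} u * f u))"
    using A by (auto simp: fun_eq_iff indicator_def)
  show ?thesis unfolding set_integrable_def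
  proof (rule Bochner_Integration.integrable_bound[of lborel "\<lambda>u. indicator {0..T} u * C"])
    show "integrable lborel (\<lambda>u. indicator {0..T} u * C)"
      using True by (intro integrable_mult_left integrable_real_indicator) auto
    show "(\<lambda>u. indicator A u *\<^sub>R f u) \<in> borel_measurable lborel"
      unfolding eq using A(1) cadlag_borel_measurable[OF f] by simp
    show "AE u in lborel. norm (indicator A u *\<^sub>R f u) \<le> norm (indicator {0..T} u * C)"
      using A(2) C by (intro AE_I2) (auto simp: indicator_def subset_iff)
  qed
next
  case False
  then have "A = {}" using A by auto
  then show ?thesis by (simp add: set_integrable_def)
qed

text \<open>Each half-open cell carries the value of \<open>f\<close> at its right end. This matches
  the jump probabilities, which sample the rate at \<open>n * \<epsilon>\<close> with
  \<open>n \<ge> 1\<close>.\<close>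

lemma Riemann_sum_eq_integral:
  assumes h: "h > 0"
  shows "set_integrable lborel {0..<real N * h} (\<lambda>u. f (grid_above h u) :: real) \<and>
     (LBINT u:{0..<real N * h}. f (grid_above h u)) = (\<Sum>n=1..N. f (real n * h) * h)"
proof (induction N)
  case 0 then show ?case by (simp add: set_integrable_def set_lebesgue_integral_def)
next
  case (Suc N)
  have split: "{0..<real (Suc N) * h} = {0..<real N * h} \<union> {real N * h..<real (Suc N) * h}"
    using h by (intro ivl_disj_un(17)[symmetric]) auto
  have gr: "grid_above h u = real (Suc N) * h" if "u \<in> {real N * h..<real (Suc N) * h}" for u
  proof -
    have "\<lfloor>u / h\<rfloor> = int N" using that h by (intro floor_unique) (auto simp: field_simps)
    then show ?thesis by (simp add: grid_above_def algebra_simps)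
  qed
  have eq: "(\<lambda>u. indicator {real N * h..<real (Suc N) * h} u *\<^sub>R f (grid_above h u)) =
     (\<lambda>u. indicator {real N * h..<real (Suc N) * h} u *\<^sub>R f (real (Suc N) * h))"
    using gr by (auto simp: fun_eq_iff indicator_def)
  have le: "real N * h \<le> real (Suc N) * h" using h by (simp add: mult_right_mono)
  have I: "set_integrable lborel {real N * h..<real (Suc N) * h} (\<lambda>u. f (grid_above h u))"
    unfolding set_integrable_def eq using le by simp
  have V: "(LBINT u:{real N * h..<real (Suc N) * h}. f (grid_above h u)) = f (real (Suc N) * h) * h"
    unfolding set_lebesgue_integral_def eq using le by (simp add: algebra_simps)
  show ?case unfolding split
    using Suc.IH I V by (subst set_integral_Un) (auto intro: set_integrable_Un)
qed

text \<open>Dominated convergence: the sums are integrals of step functions that converge pointwise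
  by right-continuity.\<close>

lemma Riemann_sum_tendsto:
  fixes f :: "real \<Rightarrow> real"
  assumes f: "cadlag f" and t: "0 \<le> t" and e: "\<And>n. e n > 0" "e \<longlonglongrightarrow> (0::real)"
  shows "(\<lambda>j. \<Sum>n=1..nat \<lfloor>t / e j\<rfloor>. f (real n * e j) * e j) \<longlonglongrightarrow> (LBINT u:{0..t}. f u)"
proof -
  define N where "N j = nat \<lfloor>t / e j\<rfloor>" for j
  have N: "real (N j) * e j \<le> t" "t < real (N j) * e j + e j" for j
  proof -
    have "real (N j) = of_int \<lfloor>t / e j\<rfloor>" using t e(1)[of j] by (simp add: N_def)
    then have "real (N j) \<le> t / e j" "t / e j < real (N j) + 1" by linarith+
    then show "real (N j) * e j \<le> t" "t < real (N j) * e j + e j" using e(1)[of j] by (simp_all add: field_simps)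
  qed
  \<comment> \<open>The sample point for \<open>u\<close> may exceed \<open>u\<close> by one mesh
    width; a common bound \<open>B\<close> on the widths gives one compact interval on which
    \<open>f\<close> is bounded.\<close>
  have "Bseq e" using e(2) by (simp add: convergent_imp_Bseq convergent_def exI[of _ 0])
  then obtain B where B: "B > 0" "\<And>j. e j \<le> B" by (auto simp: Bseq_def abs_le_iff)
  obtain C where C: "C \<ge> 0" "\<And>u. 0 \<le> u \<Longrightarrow> u \<le> t + B \<Longrightarrow> \<bar>f u\<bar> \<le> C"
    by (rule cadlag_bounded[OF f, of "t + B"]) (use t B in auto)
  have "(\<lambda>j. \<integral>u. indicator {0..<real (N j) * e j} u *\<^sub>R f (grid_above (e j) u) \<partial>lborel)
    \<longlonglongrightarrow> (\<integral>u. indicator {0..t} u *\<^sub>R f u \<partial>lborel)"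
  proof (rule integral_dominated_convergence[where w = "\<lambda>u. indicator {0..t} u * C"])
    show "(\<lambda>u. indicator {0..t} u *\<^sub>R f u) \<in> borel_measurable lborel"
      using cadlag_set_integrable[OF f, of "{0..t}" t] by (simp add: set_integrable_def borel_measurable_integrable)
    show "(\<lambda>u. indicator {0..<real (N j) * e j} u *\<^sub>R f (grid_above (e j) u)) \<in> borel_measurable lborel" for j
      using borel_measurable_grid_above[of f "e j"] by simp
    show "integrable lborel (\<lambda>u. indicator {0..t} u * C)"
      using t by (intro integrable_mult_left integrable_real_indicator) auto
    show "AE u in lborel. norm (indicator {0..<real (N j) * e j} u *\<^sub>R f (grid_above (e j) u)) \<le>
        indicator {0..t} u * C" for j
    proof (rule AE_I2)
      fix u
      show "norm (indicator {0..<real (N j) * e j} u *\<^sub>R f (grid_above (e j) u)) \<le> indicator {0..t} u * C"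
      proof (cases "u \<in> {0..<real (N j) * e j}")
        case True
        then have "0 \<le> grid_above (e j) u" "grid_above (e j) u \<le> t + B"
          using grid_above_bounds[OF e(1)[of j], of u] N(1)[of j] B(2)[of j] by auto
        then show ?thesis using True N(1)[of j] C(2) by (auto simp: indicator_def)
      qed (use C in \<open>auto simp: indicator_def\<close>)
    qed
    \<comment> \<open>A point of \<open>[0, t)\<close> is eventually covered by the complete cells,
      and outside \<open>[0, t]\<close> both integrands vanish; only \<open>u = t\<close> is left, a
      null set.\<close>
    have "AE u in lborel. u \<noteq> t" by (rule AE_lborel_singleton)
    then show "AE u in lborel. (\<lambda>j. indicator {0..<real (N j) *
        e j} u *\<^sub>R f (grid_above (e j) u)) \<longlonglongrightarrow> indicator {0..t} u *\<^sub>R f u"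
    proof eventually_elim
      case (elim u)
      show ?case
      proof (cases "u \<in> {0..<t}")
        case True
        then have "(f \<longlongrightarrow> f u) (at_right u)" using f by (auto simp: cadlag_def)
        from filterlim_compose[OF this grid_above_tendsto[OF e]]
        have 1: "(\<lambda>j. f (grid_above (e j) u)) \<longlonglongrightarrow> f u" by simp
        have "\<forall>\<^sub>F j in sequentially. e j < t - u" using e(2) True by (auto simp: order_tendsto_iff)
        then have "\<forall>\<^sub>F j in sequentially. indicator {0..<real (N j) * e j} u *\<^sub>R f (grid_above (e j) u) =
            f (grid_above (e j) u)"
        proof eventually_elim
          case (elim j)
          then show ?case using N(2)[of j] True by (auto simp: indicator_def)
        qed
        then have "(\<lambda>j. indicator {0..<real (N j) * e j} u *\<^sub>R f (grid_above (e j) u)) \<longlonglongrightarrow> f u"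
          by (rule tendsto_cong[THEN iffD2]) (rule 1)
        then show ?thesis using True by (simp add: indicator_def)
      next
        case False
        then have "indicator {0..<real (N j) * e j} u = (0::real)" for j
          using N(1)[of j] elim by (auto simp: indicator_def)
        moreover have "indicator {0..t} u = (0::real)" using False elim by (auto simp: indicator_def)
        ultimately show ?thesis by simp
      qed
    qed
  qed
  moreover have "(\<integral>u. indicator {0..<real (N j) * e j} u *\<^sub>R f (grid_above (e j) u) \<partial>lborel) =
      (\<Sum>n=1..N j. f (real n * e j) * e j)" for j
    using Riemann_sum_eq_integral[OF e(1)[of j], where N = "N j" and f = f] by (simp add: set_lebesgue_integral_def)
  ultimately show ?thesis by (simp add: N_def set_lebesgue_integral_def)
qed

text \<open>Take logarithms: \<open>ln (1 - a) = - a + O(a\<^sup>2)\<close> with each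
  \<open>a\<close> of order \<open>\<epsilon>\<close>. There are at most
  \<open>t / \<epsilon>\<close> factors, so the quadratic errors add up to order
  \<open>\<epsilon>\<close>, the perturbations \<open>\<beta>\<close> to at most
  \<open>\<eta> * t\<close>, and the main terms form a Riemann sum of the hazard.\<close>

lemma survival_product_tendsto:
  fixes f :: "real \<Rightarrow> real" and \<alpha> \<beta> :: "real \<Rightarrow> nat \<Rightarrow> real"
  assumes f: "cadlag f" and t: "0 \<le> t" and e0: "\<epsilon>0 > 0"
    and range: "\<And>\<epsilon> n. \<epsilon> \<in> {0<..<\<epsilon>0} \<Longrightarrow> n \<ge> 1 \<Longrightarrow> 0 < \<alpha> \<epsilon> n \<and> \<alpha> \<epsilon> n < 1"
    and eq: "\<And>\<epsilon> n. \<epsilon> \<in> {0<..<\<epsilon>0} \<Longrightarrow> n \<ge> 1 \<Longrightarrow> \<alpha> \<epsilon> n = f (real n * \<epsilon>) * \<epsilon> + \<beta> \<epsilon> n * \<epsilon>"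
    and lim: "\<And>\<eta>. \<eta> > 0 \<Longrightarrow> \<forall>\<^sub>F \<epsilon> in at_right 0. \<forall>n\<ge>1. \<bar>\<beta> \<epsilon> n\<bar> \<le> \<eta>"
  shows "((\<lambda>\<epsilon>. \<Prod>n=1..nat \<lfloor>t / \<epsilon>\<rfloor>. 1 - \<alpha> \<epsilon> n) \<longlongrightarrow> exp (- (LBINT u:{0..t}. f u))) (at_right 0)"
proof (rule tendsto_at_right_sequentially[OF e0])
  fix e :: "nat \<Rightarrow> real"
  assume e: "\<And>n. 0 < e n" "\<And>n. e n < \<epsilon>0" "decseq e" "e \<longlonglongrightarrow> 0"
  define N where "N j = nat \<lfloor>t / e j\<rfloor>" for j
  have N: "real (N j) * e j \<le> t" for j
  proof -
    have "real (N j) = of_int \<lfloor>t / e j\<rfloor>" using t e(1)[of j] by (simp add: N_def)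
    then have "real (N j) \<le> t / e j" by linarith
    then show "real (N j) * e j \<le> t" using e(1)[of j] by (simp_all add: field_simps)
  qed
  obtain C where C: "C \<ge> 0" "\<And>u. 0 \<le> u \<Longrightarrow> u \<le> t \<Longrightarrow> \<bar>f u\<bar> \<le> C"
    using cadlag_bounded[OF f t] by blast
  have right: "filterlim e (at_right 0) sequentially"
    by (rule filterlim_at_right_0[OF e(1,4)])
  have D: "(\<lambda>j. (\<Sum>n=1..N j. ln (1 - \<alpha> (e j) n)) + (\<Sum>n=1..N j. f (real n * e j) * e j)) \<longlonglongrightarrow> 0"
  proof (rule LIMSEQ_I)
    fix r :: real assume r: "0 < r"
    \<comment> \<open>The bound 1 gives \<open>\<alpha> \<le> (C + 1) * \<epsilon>\<close>; the
      other one limits the contribution of \<open>\<beta>\<close> to \<open>r / 4\<close>, with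
      \<open>t + 1\<close> instead of \<open>t\<close> to allow \<open>t = 0\<close>.\<close>
    define \<eta> where "\<eta> = min 1 (r / (4 * (t + 1)))"
    have \<eta>: "\<eta> > 0" "\<eta> \<le> 1" "\<eta> * t \<le> r / 4"
    proof -
      show "\<eta> > 0" "\<eta> \<le> 1" using r t by (auto simp: \<eta>_def)
      have "\<eta> * t \<le> r / (4 * (t + 1)) * t" using t by (intro mult_right_mono) (auto simp: \<eta>_def)
      also have "\<dots> \<le> r / 4" using r t by (simp add: field_simps)
      finally show "\<eta> * t \<le> r / 4" .
    qed
    have ev1: "\<forall>\<^sub>F j in sequentially. \<forall>n\<ge>1. \<bar>\<beta> (e j) n\<bar> \<le> \<eta>"
      using eventually_compose_filterlim[OF lim[OF \<eta>(1)] right] .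
    have "(\<lambda>j. (C + 1) * e j) \<longlonglongrightarrow> 0" "(\<lambda>j. t * (2 * (C + 1)\<^sup>2 * e j)) \<longlonglongrightarrow> 0"
      using e(4) by (auto intro!: tendsto_eq_intros)
      from order_tendstoD(2)[OF this(1), of "1 / 2"] order_tendstoD(2)[OF this(2), of "r / 4"]
    have ev2: "\<forall>\<^sub>F j in sequentially. (C + 1) * e j < 1 / 2"
      and ev3: "\<forall>\<^sub>F j in sequentially. t * (2 * (C + 1)\<^sup>2 * e j) < r / 4"
      using r by simp_all
    have "\<forall>\<^sub>F j in sequentially. \<bar>(\<Sum>n=1..N j. ln (1 - \<alpha> (e j) n)) + (\<Sum>n=1..N j. f (real n * e j) * e j)\<bar> < r"
      using ev1 ev2 ev3
    proof eventually_elim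
      case (elim j)
      have ej: "e j \<in> {0<..<\<epsilon>0}" using e by auto
      have bnd: "\<bar>ln (1 - \<alpha> (e j) n) + f (real n * e j) * e j\<bar> \<le> (2 * (C + 1)\<^sup>2 * e j + \<eta>) * e j"
        if n: "n \<in> {1..N j}" for n
      proof -
        let ?a = "\<alpha> (e j) n"
        have "real n * e j \<le> real (N j) * e j" using n e(1)[of j] by (simp add: mult_right_mono)
        then have "\<bar>f (real n * e j)\<bar> \<le> C"
          using C(2)[of "real n * e j"] order_trans[OF _ N[of j]] e(1)[of j] by (simp add: less_imp_le)
        moreover have b: "\<bar>\<beta> (e j) n\<bar> \<le> \<eta>" using elim(1) n by auto
        ultimately have "f (real n * e j) + \<beta> (e j) n \<le> C + 1" using \<eta>(2) by linarith
        then have a: "?a \<le> (C + 1) * e j"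
          using eq[OF ej, of n] n e(1)[of j] by (simp add: distrib_right[symmetric] mult_right_mono)
        have a0: "0 < ?a" using range[OF ej] n by auto
        \<comment> \<open>This quadratic bound for the logarithm holds for arguments in [-1/2, 0],
          which \<open>elim(2)\<close> provides.\<close>
        have "\<bar>ln (1 + (- ?a)) - (- ?a)\<bar> \<le> 2 * (- ?a)\<^sup>2"
          using a a0 elim(2) by (intro abs_ln_one_plus_x_minus_x_bound_nonpos) auto
        also have "\<dots> \<le> 2 * ((C + 1) * e j)\<^sup>2" using a a0 by (simp add: power_mono)
        finally have 1: "\<bar>ln (1 - ?a) + ?a\<bar> \<le> 2 * (C + 1)\<^sup>2 * e j * e j"
            by (simp add: power2_eq_square algebra_simps)
        have "\<bar>\<beta> (e j) n * e j\<bar> \<le> \<eta> * e j" using b e(1)[of j] by (simp add: abs_mult)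
        moreover have "f (real n * e j) * e j = ?a - \<beta> (e j) n * e j" using eq[OF ej, of n] n by simp
        ultimately show ?thesis using 1 by (simp add: distrib_right)
      qed
      have "\<bar>(\<Sum>n=1..N j. ln (1 - \<alpha> (e j) n)) + (\<Sum>n=1..N j. f (real n * e j) * e j)\<bar>
        \<le> (\<Sum>n=1..N j. \<bar>ln (1 - \<alpha> (e j) n) + f (real n * e j) * e j\<bar>)"
        unfolding sum.distrib[symmetric] by (rule sum_abs)
      also have "\<dots> \<le> (\<Sum>n=1..N j. (2 * (C + 1)\<^sup>2 * e j + \<eta>) * e j)" by (rule sum_mono[OF bnd])
      also have "\<dots> = (2 * (C + 1)\<^sup>2 * e j + \<eta>) * (real (N j) * e j)" by simp
      also have "\<dots> \<le> (2 * (C + 1)\<^sup>2 * e j + \<eta>) * t"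
        using N[of j] C(1) e(1)[of j] \<eta>(1) by (intro mult_left_mono add_nonneg_nonneg) auto
      also have "\<dots> = t * (2 * (C + 1)\<^sup>2 * e j) + \<eta> * t" by (simp add: algebra_simps)
      also have "\<dots> < r" using elim(3) \<eta>(3) r by linarith
      finally show ?case .
    qed
    then show "\<exists>no. \<forall>n\<ge>no. norm ((\<Sum>na = 1..N n. ln (1 - \<alpha> (e n) na)) + (\<Sum>na = 1..N n. f (real na * e n) *
        e n) - 0) < r"
      by (simp add: eventually_sequentially)
  qed
  have "(\<lambda>j. \<Sum>n=1..N j. f (real n * e j) * e j) \<longlonglongrightarrow> (LBINT u:{0..t}. f u)"
    unfolding N_def by (rule Riemann_sum_tendsto[OF f t e(1,4)])
  from tendsto_diff[OF D this] have "(\<lambda>j. \<Sum>n=1..N j. ln (1 - \<alpha> (e j) n)) \<longlonglongrightarrow> - (LBINT u:{0..t}. f u)" by simp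
  then have "(\<lambda>j. exp (\<Sum>n=1..N j. ln (1 - \<alpha> (e j) n))) \<longlonglongrightarrow> exp (- (LBINT u:{0..t}. f u))"
    by (rule tendsto_exp)
  moreover have "exp (\<Sum>n=1..N j. ln (1 - \<alpha> (e j) n)) = (\<Prod>n=1..N j. 1 - \<alpha> (e j) n)" for j
    using range[of "e j"] e(1,2) by (auto simp: exp_sum intro!: prod.cong)
  ultimately show "(\<lambda>j. \<Prod>n=1..nat \<lfloor>t / e j\<rfloor>. 1 - \<alpha> (e j) n) \<longlonglongrightarrow> exp (- (LBINT u:{0..t}. f u))"
    by (simp add: N_def)
qed

section \<open>Survival functions and quantile transform\<close>

definition survival :: "(real \<Rightarrow> real) \<Rightarrow> real \<Rightarrow> real" where
  "survival f t = exp (- (LBINT u:{0..t}. f u))"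

lemma survival_pos: "survival f t > 0" by (simp add: survival_def)

lemma survival_nonpos: "t \<le> 0 \<Longrightarrow> survival f t = 1"
proof (cases "t = 0")
  case True
  have "(\<lambda>x. indicator {0} x *\<^sub>R f x) = (\<lambda>x::real. indicator {0} x * f 0)"
    by (auto simp: indicator_def)
  then show ?thesis using True by (simp add: survival_def set_lebesgue_integral_def)
qed (simp add: survival_def set_lebesgue_integral_def)

lemma cadlag_set_integrable_Ioc:
  fixes f :: "real \<Rightarrow> real"
  assumes "cadlag f" "0 \<le> s" shows "set_integrable lborel {s<..t} f"
proof -
  have "{s<..t} \<subseteq> {0..t}" using assms(2) by auto
  then show ?thesis by (intro cadlag_set_integrable[OF assms(1)]) auto
qed

lemma hazard_diff:
  fixes f :: "real \<Rightarrow> real"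
  assumes f: "cadlag f" and "0 \<le> s" "s \<le> t"
  shows "(LBINT u:{0..t}. f u) - (LBINT u:{0..s}. f u) = (LBINT u:{s<..t}. f u)"
proof -
  have "{0..t} = {0..s} \<union> {s<..t}" using assms by auto
  moreover have "set_integrable lborel {0..s} f" "set_integrable lborel {s<..t} f"
    using assms by (auto intro!: cadlag_set_integrable[OF f, where T = t])
  ultimately have "(LBINT u:{0..t}. f u) = (LBINT u:{0..s}. f u) + (LBINT u:{s<..t}. f u)"
    by (simp only:) (rule set_integral_Un, auto)
  then show ?thesis by simp
qed

text \<open>The rate has no uniform positive lower bound at hand, so the argument is qualitative: a
  vanishing integral would force \<open>f = 0\<close> almost everywhere on an interval of positive
  length.\<close>

lemma hazard_diff_pos:
  fixes f :: "real \<Rightarrow> real"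
  assumes f: "cadlag f" "\<forall>t\<ge>0. f t > 0" and st: "0 \<le> s" "s < t"
  shows "(LBINT u:{s<..t}. f u) > 0"
proof -
  have int: "integrable lborel (\<lambda>u. indicator {s<..t} u *\<^sub>R f u)"
    using cadlag_set_integrable_Ioc[OF f(1) st(1)] by (simp only: set_integrable_def)
  have "0 < (\<integral>u. indicator {s<..t} u *\<^sub>R f u \<partial>lborel)"
  proof (rule ccontr)
    assume "\<not> ?thesis"
    moreover have "0 \<le> indicator {s<..t} u *\<^sub>R f u" for u
      using f(2)[rule_format, of u] st by (cases "u \<in> {s<..t}") auto
    then have nn: "AE u in lborel. 0 \<le> indicator {s<..t} u *\<^sub>R f u" by (rule AE_I2)
    ultimately have "(\<integral>u. indicator {s<..t} u *\<^sub>R f u \<partial>lborel) = 0"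
      using integral_nonneg_AE[OF nn] by linarith
    then have "AE u in lborel. indicator {s<..t} u *\<^sub>R f u = 0"
      using integral_nonneg_eq_0_iff_AE[OF int nn] by simp
    then have "AE u in lborel. u \<notin> {s<..t}"
    proof eventually_elim
      case (elim u)
      then show ?case using f(2)[rule_format, of u] st by (auto simp: indicator_def)
    qed
    then have "emeasure lborel {s<..t} = 0"
      by (subst (asm) AE_iff_measurable[of "{s<..t}"]) auto
    then show False using st by simp
  qed
  then show ?thesis by (simp add: set_lebesgue_integral_def)
qed

lemma survival_strict_antimono:
  fixes f :: "real \<Rightarrow> real"
  assumes f: "cadlag f" "\<forall>t\<ge>0. f t > 0" and st: "0 \<le> s" "s < t"
  shows "survival f t < survival f s"
  using hazard_diff[OF f(1) st(1), of t] hazard_diff_pos[OF f st] st(2) by (simp add: survival_def)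

text \<open>Translates events about \<open>survival f (e k)\<close> into events about
  \<open>e k\<close>. The argument \<open>x\<close> ranges over all reals because a waiting time may
  be nonpositive on a null set.\<close>

lemma survival_less_iff:
  fixes f :: "real \<Rightarrow> real"
  assumes f: "cadlag f" "\<forall>t\<ge>0. f t > 0" and t: "0 \<le> t"
  shows "survival f x < survival f t \<longleftrightarrow> t < x"
proof (cases "x < 0")
  case True
  then show ?thesis
    using t survival_nonpos[of x f] survival_strict_antimono[OF f, of 0 t] survival_nonpos[of 0 f]
    by (cases "t = 0") auto
next
  case False
  then show ?thesis
    using survival_strict_antimono[OF f, of x t] survival_strict_antimono[OF f, of t x] t
    by (cases x t rule: linorder_cases) auto
qed

lemma survival_borel_measurable:
  fixes f :: "real \<Rightarrow> real"
  assumes f: "cadlag f" "\<forall>t\<ge>0. f t > 0"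
  shows "survival f \<in> borel_measurable borel"
proof -
  have "mono (\<lambda>t. - survival f t)"
  proof (rule monoI)
    fix s t :: real assume "s \<le> t"
    then show "- survival f s \<le> - survival f t"
      using survival_less_iff[OF f, of t s] survival_nonpos[of s f] survival_nonpos[of t f]
      by (cases "0 \<le> t") auto
  qed
  then have "(\<lambda>t. - survival f t) \<in> borel_measurable borel" by (rule borel_measurable_mono)
  then have "(\<lambda>t. - (- survival f t)) \<in> borel_measurable borel" by measurable
  then show ?thesis by simp
qed

text \<open>On a compact interval the rate is bounded by some \<open>C\<close>, so the hazard is
  \<open>C\<close>-Lipschitz there.\<close>

lemma survival_continuous_on:
  fixes f :: "real \<Rightarrow> real"
  assumes f: "cadlag f" and T: "0 \<le> T"
  shows "continuous_on {0..T} (survival f)"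
proof -
  obtain C where C: "C \<ge> 0" "\<And>u. 0 \<le> u \<Longrightarrow> u \<le> T \<Longrightarrow> \<bar>f u\<bar> \<le> C" using cadlag_bounded[OF f T] by blast
  have bd: "\<bar>(LBINT u:{0..t}. f u) - (LBINT u:{0..s}. f u)\<bar> \<le> C * (t - s)" if st: "0 \<le> s" "s \<le> t" "t \<le> T" for s t
  proof -
    have i: "set_integrable lborel {s<..t} f" by (rule cadlag_set_integrable_Ioc[OF f st(1)])
    have "\<bar>\<integral>u. indicator {s<..t} u *\<^sub>R f u \<partial>lborel\<bar> \<le> (\<integral>u. norm (indicator {s<..t} u *\<^sub>R f u) \<partial>lborel)"
      using integral_norm_bound[of lborel "\<lambda>u. indicator {s<..t} u *\<^sub>R f u"] by simp
    also have "\<dots> \<le> (\<integral>u. indicator {s<..t} u * C \<partial>lborel)"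
    proof (rule integral_mono)
      show "integrable lborel (\<lambda>u. norm (indicator {s<..t} u *\<^sub>R f u))"
        using i by (auto simp: set_integrable_def)
      show "integrable lborel (\<lambda>u. indicator {s<..t} u * C)"
        using st by (intro integrable_mult_left integrable_real_indicator) auto
      show "norm (indicator {s<..t} u *\<^sub>R f u) \<le> indicator {s<..t} u * C" for u
        using C(2)[of u] st by (auto simp: indicator_def)
    qed
    also have "\<dots> = C * (t - s)" using st by simp
    finally show ?thesis using hazard_diff[OF f st(1,2)] by (simp add: set_lebesgue_integral_def)
  qed
  have "C-lipschitz_on {0..T} (\<lambda>t. LBINT u:{0..t}. f u)"
  proof (rule lipschitz_onI)
    fix s t assume "s \<in> {0..T}" "t \<in> {0..T}"
    then show "dist (LBINT u:{0..s}. f u) (LBINT u:{0..t}. f u) \<le> C * dist s t"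
      using bd[of s t] bd[of t s] by (cases "s \<le> t") (auto simp: dist_real_def abs_minus_commute)
  qed (rule C)
  then have "continuous_on {0..T} (\<lambda>t. LBINT u:{0..t}. f u)" by (rule lipschitz_on_continuous_on)
  then show ?thesis unfolding survival_def by (intro continuous_intros)
qed

text \<open>Monotone convergence along \<open>[0, n]\<close>: if all truncated integrals stayed
  below \<open>C\<close>, so would the full one.\<close>

lemma hazard_unbounded:
  fixes f :: "real \<Rightarrow> real"
  assumes f: "cadlag f" "\<forall>t\<ge>0. f t > 0"
    and inf: "(\<integral>\<^sup>+u\<in>{0..}. ennreal (f u) \<partial>lborel) = \<infinity>"
  shows "\<exists>n::nat. C < (LBINT u:{0..real n}. f u)"
proof (rule ccontr)
  assume "\<not> ?thesis"
  then have C: "(LBINT u:{0..real n}. f u) \<le> C" for n :: nat by (simp add: not_less)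
  define g where "g n u = ennreal (indicator {0..real n} u *\<^sub>R f u)" for n :: nat and u
  have nn: "0 \<le> indicator A u *\<^sub>R f u" if "A \<subseteq> {0..}" for A u
    using f(2)[rule_format, of u] that by (cases "u \<in> A") auto
  have meas: "g n \<in> borel_measurable lborel" for n
    using cadlag_set_integrable[OF f(1), of "{0..real n}" n]
    unfolding g_def set_integrable_def by (auto simp: borel_measurable_integrable)
  have "(\<integral>\<^sup>+u. g n u \<partial>lborel) = ennreal (LBINT u:{0..real n}. f u)" for n
    unfolding g_def set_lebesgue_integral_def
    using cadlag_set_integrable[OF f(1), of "{0..real n}" n] nn
    by (intro nn_integral_eq_integral) (auto simp: set_integrable_def)
  then have le: "(\<integral>\<^sup>+u. g n u \<partial>lborel) \<le> ennreal C" for n using C by (simp add: ennreal_leI)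
  have inc: "incseq g"
    unfolding incseq_def le_fun_def g_def
  proof (intro allI impI ennreal_leI)
    fix m n :: nat and u :: real assume "m \<le> n"
    then show "indicator {0..real m} u *\<^sub>R f u \<le> indicator {0..real n} u *\<^sub>R f u"
      using nn[of "{0..real n}" u] by (cases "u \<in> {0..real m}") auto
  qed
  have sup: "(SUP n. g n u) = ennreal (f u) * indicator {0..} u" for u
  proof (cases "u \<ge> 0")
    case True
    obtain m :: nat where m: "u \<le> real m" using real_arch_simple by blast
    have "(SUP n. g n u) = g m u"
    proof (rule antisym[OF SUP_least])
      show "g n u \<le> g m u" for n
        using m True f(2)[rule_format, of u] by (cases "u \<le> real n") (auto simp: g_def)
      show "g m u \<le> (SUP n. g n u)" by (rule SUP_upper) simp
    qed
    then show ?thesis using True m by (simp add: g_def)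
  qed (simp add: g_def)
  have "(\<integral>\<^sup>+u. (SUP n. g n u) \<partial>lborel) = (SUP n. \<integral>\<^sup>+u. g n u \<partial>lborel)"
    by (rule nn_integral_monotone_convergence_SUP[OF inc meas])
  also have "\<dots> \<le> ennreal C" using le by (rule SUP_least)
  finally show False using inf unfolding sup by (simp add: top_unique)
qed

text \<open>Intermediate value theorem. Since every level in (0,1] equals
  \<open>survival f t\<close> for some \<open>t\<close>, the tail of \<open>e\<close> at that
  \<open>t\<close> has exactly this probability; this is the uniformity of the transformed waiting
  time.\<close>

lemma survival_attains:
  fixes f :: "real \<Rightarrow> real"
  assumes f: "cadlag f" "\<forall>t\<ge>0. f t > 0"
    and inf: "(\<integral>\<^sup>+u\<in>{0..}. ennreal (f u) \<partial>lborel) = \<infinity>"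
    and c: "0 < c" "c \<le> 1"
  obtains t where "t \<ge> 0" "survival f t = c"
proof -
  obtain n :: nat where "- ln c < (LBINT u:{0..real n}. f u)" using hazard_unbounded[OF f inf] by blast
  then have "ln (survival f (real n)) < ln c" by (simp add: survival_def)
  then have "survival f (real n) \<le> c" using c survival_pos[of f "real n"] by simp
  moreover have "c \<le> survival f 0" using c by (simp add: survival_nonpos)
  ultimately have "\<exists>x. 0 \<le> x \<and> x \<le> real n \<and> survival f x = c"
    using survival_continuous_on[OF f(1), of "real n"] by (intro IVT2') auto
  then show ?thesis using that by blast
qed

text \<open>The probability that a sojourn with jump probabilities \<open>a 1, a 2, ...\<close>
  exceeds \<open>n\<close> steps.\<close>

definition discrete_survival :: "(nat \<Rightarrow> real) \<Rightarrow> nat \<Rightarrow> real" where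
  "discrete_survival a n = (\<Prod>j=1..n. 1 - a j)"

text \<open>The bound \<open>1 \<le> n\<close> rules out length 0, which would arise for
  \<open>c = 1\<close>, that is, at nonpositive waiting times. The value is an \<open>enat\<close>
  because for fixed \<open>\<epsilon>\<close> the products may stay above \<open>c\<close>
  forever.\<close>

definition quantile_gap :: "(nat \<Rightarrow> real) \<Rightarrow> real \<Rightarrow> enat" where
  "quantile_gap a c = Inf {enat n |n. 1 \<le> n \<and> discrete_survival a n \<le> c}"

lemma discrete_survival_Suc: "discrete_survival a (Suc n) = discrete_survival a n * (1 - a (Suc n))"
  by (simp add: discrete_survival_def)

lemma discrete_survival_pos:
  assumes "\<forall>n\<ge>1. 0 < a n \<and> a n < 1" shows "0 < discrete_survival a n"
  unfolding discrete_survival_def using assms by (intro prod_pos) auto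

lemma discrete_survival_antimono:
  assumes a: "\<forall>n\<ge>1. 0 < a n \<and> a n < 1" and "m \<le> n"
  shows "discrete_survival a n \<le> discrete_survival a m"
  using assms(2)
proof (induction n rule: dec_induct)
  case (step n)
  have "discrete_survival a (Suc n) \<le> discrete_survival a n * 1"
    unfolding discrete_survival_Suc using a[rule_format, of "Suc n"] discrete_survival_pos[OF a, of n]
    by (intro mult_left_mono) auto
  then show ?case using step by simp
qed simp

lemma discrete_survival_less_1:
  assumes a: "\<forall>n\<ge>1. 0 < a n \<and> a n < 1" and "1 \<le> n"
  shows "discrete_survival a n < 1"
proof -
  have "discrete_survival a n \<le> discrete_survival a 1" using discrete_survival_antimono[OF a] assms by blast
  also have "\<dots> < 1" using a[rule_format, of 1] by (simp add: discrete_survival_def)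
  finally show ?thesis .
qed

text \<open>The products decrease, so the set defining the infimum is upward closed. At
  \<open>n = 0\<close> the inequality holds for every \<open>c\<close> because the gap is at least
  1.\<close>

lemma less_quantile_gap_iff:
  assumes a: "\<forall>n\<ge>1. 0 < a n \<and> a n < 1"
  shows "enat n < quantile_gap a c \<longleftrightarrow> n = 0 \<or> c < discrete_survival a n"
proof
  assume L: "enat n < quantile_gap a c"
  show "n = 0 \<or> c < discrete_survival a n"
  proof (rule ccontr)
    assume "\<not> ?thesis"
    then have "quantile_gap a c \<le> enat n" unfolding quantile_gap_def by (intro Inf_lower) auto
    then show False using L by simp
  qed
next
  assume R: "n = 0 \<or> c < discrete_survival a n"
  have "enat (Suc n) \<le> quantile_gap a c"
    unfolding quantile_gap_def
  proof (rule Inf_greatest, safe)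
    fix m assume m: "1 \<le> m" "discrete_survival a m \<le> c"
    show "enat (Suc n) \<le> enat m"
    proof (rule ccontr)
      assume "\<not> ?thesis"
      then have "m \<le> n" by simp
      then show False using R m discrete_survival_antimono[OF a, of m n] by auto
    qed
  qed
  then show "enat n < quantile_gap a c" by (simp add: Suc_ile_eq)
qed

lemma measurable_quantile_gap:
  assumes a: "\<forall>n\<ge>1. 0 < a n \<and> a n < 1"
  shows "quantile_gap a \<in> borel \<rightarrow>\<^sub>M count_space UNIV"
proof -
  have gt: "{c. enat n < quantile_gap a c} \<in> sets borel" for n
    unfolding less_quantile_gap_iff[OF a] by (cases "n = 0") auto
  have fin: "quantile_gap a -` {enat n} \<in> sets borel" for n
  proof (cases n)
    case 0
    have "quantile_gap a c \<noteq> enat 0" for c using less_quantile_gap_iff[OF a, of 0 c] by auto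
    then have "quantile_gap a -` {enat n} = {}" using 0 by auto
    then show ?thesis by simp
  next
    case (Suc m)
    have "x = enat (Suc m) \<longleftrightarrow> enat m < x \<and> \<not> enat (Suc m) < x" for x :: enat by (cases x) auto
    then have "quantile_gap a -` {enat n} = {c. enat m < quantile_gap a c} - {c. enat (Suc m) < quantile_gap a c}"
      using Suc by auto
    then show ?thesis using gt by simp
  qed
  have "quantile_gap a -` {x} \<in> sets borel" for x
  proof (cases x)
    case (enat n) then show ?thesis using fin by simp
  next
    case infinity
    have "y = \<infinity> \<longleftrightarrow> (\<forall>n. enat n < y)" for y :: enat by (cases y) auto
    then have "quantile_gap a -` {x} = (\<Inter>n. {c. enat n < quantile_gap a c})"
      unfolding infinity by blast
    then show ?thesis using gt by auto
  qed
  then show ?thesis by (subst measurable_count_space_eq_countable) auto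
qed

lemma quantile_gap_ge_1: "1 \<le> quantile_gap a c"
  unfolding quantile_gap_def by (rule Inf_greatest) (auto simp: one_enat_def)

text \<open>Bracket \<open>x\<close> by \<open>t1 < x < t2\<close>. Strict monotonicity separates
  the three survival values, so for small \<open>\<epsilon>\<close> the products at
  \<open>t1 / \<epsilon>\<close> and \<open>t2 / \<epsilon>\<close> lie on opposite sides of
  \<open>survival f x\<close>, and the gap is trapped between these indices.\<close>

lemma scaled_quantile_gap_tendsto:
  fixes f :: "real \<Rightarrow> real" and a :: "real \<Rightarrow> nat \<Rightarrow> real"
  assumes f: "cadlag f" "\<forall>t\<ge>0. f t > 0" and e0: "\<epsilon>0 > 0"
    and a: "\<And>\<epsilon>. \<epsilon> \<in> {0<..<\<epsilon>0} \<Longrightarrow> \<forall>n\<ge>1. 0 < a \<epsilon> n \<and> a \<epsilon> n < 1"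
    and lim: "\<And>t. t \<ge> 0 \<Longrightarrow> ((\<lambda>\<epsilon>. discrete_survival (a \<epsilon>) (nat \<lfloor>t / \<epsilon>\<rfloor>)) \<longlongrightarrow> survival f t) (at_right 0)"
    and x: "x > 0" and \<delta>: "\<delta> > 0"
  shows "\<forall>\<^sub>F \<epsilon> in at_right 0. \<exists>n. quantile_gap (a \<epsilon>) (survival f x) = enat n \<and> \<bar>\<epsilon> * real n - x\<bar> \<le> \<delta>"
proof -
  \<comment> \<open>The maximum keeps \<open>t1\<close> nonnegative, where the products are known to
    converge; it stays below \<open>x\<close> because \<open>x > 0\<close>.\<close>
  define t1 t2 where "t1 = max 0 (x - \<delta>)" and "t2 = x + \<delta>"
  have t: "0 \<le> t1" "t1 < x" "x < t2" "0 \<le> t2" using x \<delta> by (auto simp: t1_def t2_def)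
  have 1: "\<forall>\<^sub>F \<epsilon> in at_right 0. survival f x < discrete_survival (a \<epsilon>) (nat \<lfloor>t1 / \<epsilon>\<rfloor>)"
    using t survival_strict_antimono[OF f] by (intro order_tendstoD(1)[OF lim]) auto
  have 2: "\<forall>\<^sub>F \<epsilon> in at_right 0. discrete_survival (a \<epsilon>) (nat \<lfloor>t2 / \<epsilon>\<rfloor>) < survival f x"
    using t x survival_strict_antimono[OF f] by (intro order_tendstoD(2)[OF lim]) auto
  \<comment> \<open>With \<open>\<epsilon> < t2\<close> the index at \<open>t2\<close> is at least
    1, which excludes the exceptional case \<open>n = 0\<close> of
    \<open>less_quantile_gap_iff\<close>.\<close>
  have 3: "\<forall>\<^sub>F \<epsilon> in at_right 0. \<epsilon> \<in> {0<..<min \<epsilon>0 t2}" using e0 t x by (intro eventually_at_right_real) auto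
  show ?thesis using 1 2 3
  proof eventually_elim
    case (elim \<epsilon>)
    have e: "\<epsilon> \<in> {0<..<\<epsilon>0}" "0 < \<epsilon>" "1 \<le> t2 / \<epsilon>" using elim(3) by auto
    let ?g = "quantile_gap (a \<epsilon>) (survival f x)"
    have g1: "enat (nat \<lfloor>t1 / \<epsilon>\<rfloor>) < ?g" using elim(1) less_quantile_gap_iff[OF a[OF e(1)]] by blast
    have "\<not> enat (nat \<lfloor>t2 / \<epsilon>\<rfloor>) < ?g"
      using elim(2) e(3) less_quantile_gap_iff[OF a[OF e(1)], of "nat \<lfloor>t2 / \<epsilon>\<rfloor>"] by auto
    then obtain n where n: "?g = enat n" "n \<le> nat \<lfloor>t2 / \<epsilon>\<rfloor>" by (cases ?g) auto
    have "nat \<lfloor>t1 / \<epsilon>\<rfloor> < n" using g1 n by simp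
    then have "t1 / \<epsilon> < real n" by linarith
    moreover have "real n \<le> t2 / \<epsilon>" using n(2) e(3) by linarith
    ultimately have "t1 < \<epsilon> * real n" "\<epsilon> * real n \<le> t2" using e(2) by (simp_all add: field_simps)
    then show ?case using n(1) by (intro exI[of _ n]) (auto simp: t1_def t2_def)
  qed
qed

section \<open>Chains built from their sojourn times\<close>

text \<open>The state is the number of completed sojourns together with the age of the running one.\<close>

primrec gap_state :: "(nat \<Rightarrow> enat) \<Rightarrow> nat \<Rightarrow> nat \<times> nat" where
  "gap_state g 0 = (0, 1)"
| "gap_state g (Suc n) = (case gap_state g n of (j, a) \<Rightarrow> if g j = enat a then (Suc j, 1) else (j, Suc a))"

definition gap_chain :: "(nat \<Rightarrow> enat) \<Rightarrow> nat \<Rightarrow> real \<times> nat" where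
  "gap_chain g n = (case gap_state g n of (j, a) \<Rightarrow> ((-1) ^ j, a))"

lemma gap_state_age_ge_1: "1 \<le> snd (gap_state g n)"
  by (cases n) (auto split: prod.split)

lemma gap_chain_in_states: "gap_chain g n \<in> prw_states"
proof -
  obtain j a where ja: "gap_state g n = (j, a)" by fastforce
  have "(-1::real) ^ j \<in> {-1, 1}" by (cases "even j") auto
  then show ?thesis using gap_state_age_ge_1[of g n] ja by (simp add: gap_chain_def prw_states_def)
qed

text \<open>A history of the chain fixes the completed sojourns and bounds the running one from below, so that its
  probability factorizes over independent sojourns.\<close>

lemma gap_chain_history:
  "(\<forall>g. (\<forall>k. 1 \<le> g k) \<longrightarrow> \<not> (\<forall>k\<le>n. gap_chain g k = y k)) \<or>
   (\<exists>j D. \<forall>g. (\<forall>k. 1 \<le> g k) \<longrightarrow>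
      ((\<forall>k\<le>n. gap_chain g k = y k) \<longleftrightarrow> (\<forall>i<j. g i = enat (D i)) \<and> enat (snd (y n)) \<le> g j) \<and>
      ((\<forall>k\<le>n. gap_chain g k = y k) \<longrightarrow> gap_state g n = (j, snd (y n))))"
proof (induction n)
  case 0
  show ?case
  proof (cases "y 0 = (1, 1)")
    case True
    then show ?thesis
      by (intro disjI2 exI[of _ 0]) (auto simp: gap_chain_def one_enat_def)
  next
    case False
    then show ?thesis by (auto simp: gap_chain_def)
  qed
next
  case (Suc n)
  have Suc_iff: "(\<forall>k\<le>Suc n. gap_chain g k = y k) \<longleftrightarrow>
     (\<forall>k\<le>n. gap_chain g k = y k) \<and> gap_chain g (Suc n) = y (Suc n)" for g
    using le_Suc_eq by auto
  from Suc show ?case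
  proof (elim disjE exE)
    assume "\<forall>g. (\<forall>k. 1 \<le> g k) \<longrightarrow> \<not> (\<forall>k\<le>n. gap_chain g k = y k)"
    then show ?thesis unfolding Suc_iff by blast
  next
    fix j D
    define a where "a = snd (y n)"
    assume "\<forall>g. (\<forall>k. 1 \<le> g k) \<longrightarrow>
      ((\<forall>k\<le>n. gap_chain g k = y k) \<longleftrightarrow> (\<forall>i<j. g i = enat (D i)) \<and> enat (snd (y n)) \<le> g j) \<and>
      ((\<forall>k\<le>n. gap_chain g k = y k) \<longrightarrow> gap_state g n = (j, snd (y n)))"
    then have IH: "(\<forall>k\<le>n. gap_chain g k = y k) \<longleftrightarrow> (\<forall>i<j. g i = enat (D i)) \<and> enat a \<le> g j"
      "(\<forall>k\<le>n. gap_chain g k = y k) \<Longrightarrow> gap_state g n = (j, a)" if "\<forall>k. 1 \<le> g k" for g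
      using that unfolding a_def by blast+
    have step: "gap_chain g (Suc n) = (if g j = enat a then ((-1) ^ Suc j, 1) else ((-1) ^ j, Suc a))"
      "gap_state g (Suc n) = (if g j = enat a then (Suc j, 1) else (j, Suc a))"
      if "\<forall>k. 1 \<le> g k" "\<forall>k\<le>n. gap_chain g k = y k" for g
      using IH(2)[OF that] by (auto simp: gap_chain_def)
    \<comment> \<open>The sign tells a jump from a continuation, so the new state reveals whether
      sojourn \<open>j\<close> ends at age \<open>a\<close>.\<close>
    have sgn: "(-1::real) ^ Suc j \<noteq> (-1) ^ j" by (cases "even j") auto
    consider "y (Suc n) = ((-1) ^ Suc j, 1)" | "y (Suc n) = ((-1) ^ j, Suc a)"
      | "y (Suc n) \<notin> {((-1) ^ Suc j, 1), ((-1) ^ j, Suc a)}" by blast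
    then show ?thesis
    proof cases
      case 1
      \<comment> \<open>A jump fixes sojourn \<open>j\<close> at length \<open>a\<close>; the lower
        bound on the next sojourn is 1, which all sojourns satisfy.\<close>
      have "((\<forall>k\<le>Suc n. gap_chain g k = y k) \<longleftrightarrow>
           (\<forall>i<Suc j. g i = enat ((D(j := a)) i)) \<and> enat (snd (y (Suc n))) \<le> g (Suc j)) \<and>
         ((\<forall>k\<le>Suc n. gap_chain g k = y k) \<longrightarrow> gap_state g (Suc n) = (Suc j, snd (y (Suc n))))"
        if g: "\<forall>k. 1 \<le> g k" for g
      proof -
        have "(\<forall>i<Suc j. g i = enat ((D(j := a)) i)) \<longleftrightarrow> (\<forall>i<j. g i = enat (D i)) \<and> g j = enat a"
          by (auto simp: less_Suc_eq)
        moreover have "enat (snd (y (Suc n))) \<le> g (Suc j)" using g 1 by (simp add: one_enat_def)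
        ultimately show ?thesis
          unfolding Suc_iff using IH(1)[OF g] step[OF g] sgn 1 by auto
      qed
      then show ?thesis by blast
    next
      case 2
      have "((\<forall>k\<le>Suc n. gap_chain g k = y k) \<longleftrightarrow>
           (\<forall>i<j. g i = enat (D i)) \<and> enat (snd (y (Suc n))) \<le> g j) \<and>
         ((\<forall>k\<le>Suc n. gap_chain g k = y k) \<longrightarrow> gap_state g (Suc n) = (j, snd (y (Suc n))))"
        if g: "\<forall>k. 1 \<le> g k" for g
      proof -
        have "enat (Suc a) \<le> x \<longleftrightarrow> enat a \<le> x \<and> x \<noteq> enat a" for x by (cases x) auto
        then show ?thesis
          unfolding Suc_iff using IH(1)[OF g] step[OF g] sgn 2 by auto
      qed
      then show ?thesis by blast
    next
      case 3
      have "\<not> (\<forall>k\<le>Suc n. gap_chain g k = y k)" if g: "\<forall>k. 1 \<le> g k" for g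
        unfolding Suc_iff using step(1)[OF g] 3 by (auto split: if_splits)
      then show ?thesis by blast
    qed
  qed
qed

context prob_space begin

lemma indep_vars_prefix_prob:
  fixes g :: "nat \<Rightarrow> 'a \<Rightarrow> enat"
  assumes ind: "indep_vars (\<lambda>_. count_space UNIV) g UNIV"
  shows "prob {\<omega>\<in>space M. (\<forall>i<j. g i \<omega> = D i) \<and> g j \<omega> \<in> B} =
    prob {\<omega>\<in>space M. \<forall>i<j. g i \<omega> = D i} * prob {\<omega>\<in>space M. g j \<omega> \<in> B}"
proof -
  have prod: "prob {\<omega>\<in>space M. \<forall>i<j. g i \<omega> \<in> A i} = (\<Prod>i<j. prob {\<omega>\<in>space M. g i \<omega> \<in> A i})" for A j
  proof (cases "j = 0")
    case True then show ?thesis by (simp add: prob_space)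
  next
    case False
    have "{\<omega>\<in>space M. \<forall>i<j. g i \<omega> \<in> A i} = (\<Inter>i\<in>{..<j}. g i -` A i \<inter> space M)"
      using False by auto
    also have "prob \<dots> = (\<Prod>i<j. prob (g i -` A i \<inter> space M))"
      using False by (intro indep_varsD[OF ind]) auto
    finally show ?thesis by (simp add: vimage_def Collect_conj_eq Int_commute)
  qed
  define A where "A i = (if i < j then {D i} else B)" for i
  have "{\<omega>\<in>space M. (\<forall>i<j. g i \<omega> = D i) \<and> g j \<omega> \<in> B} = {\<omega>\<in>space M. \<forall>i<Suc j. g i \<omega> \<in> A i}"
    by (auto simp: A_def less_Suc_eq)
  also have "prob \<dots> = (\<Prod>i<j. prob {\<omega>\<in>space M. g i \<omega> \<in> A i}) * prob {\<omega>\<in>space M. g j \<omega> \<in> A j}"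
    unfolding prod by simp
  also have "(\<Prod>i<j. prob {\<omega>\<in>space M. g i \<omega> \<in> A i}) = prob {\<omega>\<in>space M. \<forall>i<j. g i \<omega> \<in> A i}"
    by (rule prod[symmetric])
  also have "\<dots> = prob {\<omega>\<in>space M. \<forall>i<j. g i \<omega> = D i}"
    by (auto simp: A_def intro!: arg_cong[where f = prob])
  finally show ?thesis by (simp add: A_def)
qed

lemma measurable_gap_state:
  fixes g :: "nat \<Rightarrow> 'a \<Rightarrow> enat"
  assumes [measurable]: "\<And>k. g k \<in> M \<rightarrow>\<^sub>M count_space UNIV"
  shows "(\<lambda>\<omega>. gap_state (\<lambda>k. g k \<omega>) n) \<in> M \<rightarrow>\<^sub>M count_space UNIV"
proof (induction n)
  case (Suc n)
  have "(\<lambda>\<omega>. (\<lambda>s \<omega>. case s of (j, a) \<Rightarrow> if g j \<omega> = enat a then (Suc j, 1) else (j, Suc a))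
       (gap_state (\<lambda>k. g k \<omega>) n) \<omega>) \<in> M \<rightarrow>\<^sub>M count_space UNIV"
    by (rule measurable_compose_countable[OF _ Suc]) (auto split: prod.split)
  then show ?case by simp
qed simp

lemma measurable_gap_chain:
  fixes g :: "nat \<Rightarrow> 'a \<Rightarrow> enat"
  assumes "\<And>k. g k \<in> M \<rightarrow>\<^sub>M count_space UNIV"
  shows "(\<lambda>\<omega>. gap_chain (\<lambda>k. g k \<omega>) n) \<in> M \<rightarrow>\<^sub>M count_space prw_states"
proof -
  have "(\<lambda>\<omega>. (\<lambda>(j, a). ((-1) ^ j, a)) (gap_state (\<lambda>k. g k \<omega>) n) :: real \<times> nat) \<in> M \<rightarrow>\<^sub>M count_space UNIV"
    by (rule measurable_compose[OF measurable_gap_state[OF assms]]) simp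
  then have 1: "(\<lambda>\<omega>. gap_chain (\<lambda>k. g k \<omega>) n) \<in> M \<rightarrow>\<^sub>M count_space UNIV"
    by (simp add: gap_chain_def)
  show ?thesis
  proof (rule measurableI)
    show "gap_chain (\<lambda>k. g k \<omega>) n \<in> space (count_space prw_states)" for \<omega>
      using gap_chain_in_states by simp
    show "(\<lambda>\<omega>. gap_chain (\<lambda>k. g k \<omega>) n) -` A \<inter> space M \<in> events" for A
      using 1 by (rule measurable_sets) simp
  qed
qed

text \<open>By \<open>gap_chain_history\<close> and independence a history at age \<open>a\<close>
  has probability \<open>Q * discrete_survival (\<alpha> i) (a - 1)\<close>. Letting the running
  sojourn last beyond \<open>a\<close> replaces the second factor by
  \<open>discrete_survival (\<alpha> i) a\<close>, and the quotient is
  \<open>1 - \<alpha> i a\<close>.\<close>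

lemma markov_chain_gap_chain:
  fixes g :: "nat \<Rightarrow> 'a \<Rightarrow> enat" and \<alpha> :: "nat \<Rightarrow> nat \<Rightarrow> real"
  assumes ind: "indep_vars (\<lambda>_. count_space UNIV) g UNIV"
    and \<alpha>: "\<forall>i\<in>{1,2}. \<forall>n\<ge>1. 0 < \<alpha> i n \<and> \<alpha> i n < 1"
    and ge1: "\<And>k \<omega>. 1 \<le> g k \<omega>"
    and tail: "\<And>k n. prob {\<omega>\<in>space M. enat n < g k \<omega>} = discrete_survival (\<alpha> (if even k then 2 else 1)) n"
  shows "markov_chain M prw_states (prw_kernel \<alpha>) (\<lambda>n \<omega>. gap_chain (\<lambda>k. g k \<omega>) n)"
  unfolding markov_chain_def
proof (intro conjI allI impI)
  have g[measurable]: "g k \<in> M \<rightarrow>\<^sub>M count_space UNIV" for k using ind by (auto simp: indep_vars_def)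
  let ?Y = "\<lambda>n \<omega>. gap_chain (\<lambda>k. g k \<omega>) n"
  show "?Y n \<in> M \<rightarrow>\<^sub>M count_space prw_states" for n
    by (rule measurable_gap_chain[OF g])
  fix n y
  assume "y \<in> {..Suc n} \<rightarrow> prw_states \<and> prob {\<omega>\<in>space M. \<forall>k\<le>n. ?Y k \<omega> = y k} > 0"
  then have y: "y n \<in> prw_states" "y (Suc n) \<in> prw_states"
    and pos: "prob {\<omega>\<in>space M. \<forall>k\<le>n. ?Y k \<omega> = y k} > 0" by auto
  \<comment> \<open>A history of positive probability is realized by some outcome, which excludes
    the first alternative of \<open>gap_chain_history\<close>.\<close>
  have "{\<omega>\<in>space M. \<forall>k\<le>n. ?Y k \<omega> = y k} \<noteq> {}"
  proof
    assume "{\<omega>\<in>space M. \<forall>k\<le>n. ?Y k \<omega> = y k} = {}"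
    then show False using pos by (simp only: measure_empty)
  qed
  then obtain \<omega>0 where \<omega>0: "\<forall>k\<le>n. ?Y k \<omega>0 = y k" by blast
  then have "\<not> (\<forall>g. (\<forall>k. 1 \<le> g k) \<longrightarrow> \<not> (\<forall>k\<le>n. gap_chain g k = y k))"
    using ge1 by (intro notI) (drule spec[of _ "\<lambda>k. g k \<omega>0"], simp)
  then obtain j D where
    H0: "\<forall>g. (\<forall>k. 1 \<le> g k) \<longrightarrow>
      ((\<forall>k\<le>n. gap_chain g k = y k) \<longleftrightarrow> (\<forall>i<j. g i = enat (D i)) \<and> enat (snd (y n)) \<le> g j) \<and>
      ((\<forall>k\<le>n. gap_chain g k = y k) \<longrightarrow> gap_state g n = (j, snd (y n)))"
    using gap_chain_history[of n y] by - (elim disjE exE, erule (1) notE, erule that)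
  define a where "a = snd (y n)"
  have H: "(\<forall>k\<le>n. ?Y k \<omega> = y k) \<longleftrightarrow> (\<forall>i<j. g i \<omega> = enat (D i)) \<and> g j \<omega> \<in> {enat a..}"
    "(\<forall>k\<le>n. ?Y k \<omega> = y k) \<Longrightarrow> gap_state (\<lambda>k. g k \<omega>) n = (j, a)" for \<omega>
    using H0[THEN spec, THEN mp, of "\<lambda>k. g k \<omega>"] ge1 unfolding a_def by simp_all
  have yn: "y n = ((-1) ^ j, a)"
    using \<omega>0 H(2)[OF \<omega>0] by (auto simp: gap_chain_def)
  have a1: "1 \<le> a" using y(1) yn by (auto simp: prw_states_def)
  define i where "i = (if even j then 2 else 1 :: nat)"
  define Q where "Q = prob {\<omega>\<in>space M. \<forall>i<j. g i \<omega> = enat (D i)}"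
  have i: "i = 1 \<and> (-1::real) ^ j = -1 \<or> i = 2 \<and> (-1::real) ^ j = 1" by (auto simp: i_def)
  \<comment> \<open>Reaching age \<open>a\<close> means lasting longer than \<open>a - 1\<close>
    steps; hence the shift in the index.\<close>
  have "prob {\<omega>\<in>space M. g j \<omega> \<in> {enat a..}} = prob {\<omega>\<in>space M. enat (a - 1) < g j \<omega>}"
    using a1 by (intro arg_cong[where f = prob]) (auto simp flip: Suc_ile_eq)
  then have ge: "prob {\<omega>\<in>space M. g j \<omega> \<in> {enat a..}} = discrete_survival (\<alpha> i) (a - 1)"
    by (simp add: tail i_def)
  have gt: "prob {\<omega>\<in>space M. g j \<omega> \<in> {enat a<..}} = discrete_survival (\<alpha> i) a"
    using tail[of a j] by (simp add: i_def)
  have "prob {\<omega>\<in>space M. g j \<omega> \<in> {enat a..}} =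
      prob ({\<omega>\<in>space M. g j \<omega> \<in> {enat a}} \<union> {\<omega>\<in>space M. g j \<omega> \<in> {enat a<..}})"
    by (intro arg_cong[where f = prob]) auto
  also have "\<dots> = prob {\<omega>\<in>space M. g j \<omega> \<in> {enat a}} + prob {\<omega>\<in>space M. g j \<omega> \<in> {enat a<..}}"
    by (rule finite_measure_Union) auto
  finally have eq: "prob {\<omega>\<in>space M. g j \<omega> \<in> {enat a}} =
      discrete_survival (\<alpha> i) (a - 1) - discrete_survival (\<alpha> i) a"
    using ge gt by simp
  have S: "discrete_survival (\<alpha> i) a = discrete_survival (\<alpha> i) (a - 1) * (1 - \<alpha> i a)"
    using a1 discrete_survival_Suc[of "\<alpha> i" "a - 1"] by simp
  have \<alpha>i: "\<forall>n\<ge>1. 0 < \<alpha> i n \<and> \<alpha> i n < 1" using \<alpha> by (auto simp: i_def)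
  have pn: "prob {\<omega>\<in>space M. \<forall>k\<le>n. ?Y k \<omega> = y k} = Q * discrete_survival (\<alpha> i) (a - 1)"
    unfolding H(1) indep_vars_prefix_prob[OF ind] Q_def ge ..
  have step: "?Y (Suc n) \<omega> = (if g j \<omega> = enat a then (- ((-1) ^ j), 1) else ((-1) ^ j, Suc a))"
    if "\<forall>k\<le>n. ?Y k \<omega> = y k" for \<omega>
    using H(2)[OF that] by (auto simp: gap_chain_def)
  have sgn: "- ((-1::real) ^ j) \<noteq> (-1) ^ j" by simp
  have joint: "prob {\<omega>\<in>space M. ?Y (Suc n) \<omega> = y (Suc n) \<and> (\<forall>k\<le>n. ?Y k \<omega> = y k)} =
     Q * discrete_survival (\<alpha> i) (a - 1) * pmf (prw_kernel \<alpha> (y n)) (y (Suc n))"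
  proof -
    consider "y (Suc n) = (- ((-1) ^ j), 1)" | "y (Suc n) = ((-1) ^ j, Suc a)"
      | "y (Suc n) \<notin> {(- ((-1) ^ j), 1), ((-1) ^ j, Suc a)}" by blast
    then show ?thesis
    proof cases
      case 1
      have "?Y (Suc n) \<omega> = y (Suc n) \<and> (\<forall>k\<le>n. ?Y k \<omega> = y k) \<longleftrightarrow>
          (\<forall>i<j. g i \<omega> = enat (D i)) \<and> g j \<omega> \<in> {enat a}" for \<omega>
      proof (cases "\<forall>k\<le>n. ?Y k \<omega> = y k")
        case True
        then show ?thesis
          using H(1)[of \<omega>] step[OF True] sgn by (cases "g j \<omega> = enat a") (auto simp: 1)
      next
        case False
        then show ?thesis using H(1)[of \<omega>] by auto
      qed
      then have "{\<omega>\<in>space M. ?Y (Suc n) \<omega> = y (Suc n) \<and> (\<forall>k\<le>n. ?Y k \<omega> = y k)} =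
         {\<omega>\<in>space M. (\<forall>i<j. g i \<omega> = enat (D i)) \<and> g j \<omega> \<in> {enat a}}" by blast
      also have "prob \<dots> = Q * (discrete_survival (\<alpha> i) (a - 1) * \<alpha> i a)"
        unfolding indep_vars_prefix_prob[OF ind] Q_def eq S by (simp add: algebra_simps)
      finally show ?thesis
        unfolding yn 1 using pmf_prw_kernel(2)[of \<alpha> i a "(-1) ^ j"] \<alpha>i a1 i by (auto simp: less_imp_le)
    next
      case 2
      have "?Y (Suc n) \<omega> = y (Suc n) \<and> (\<forall>k\<le>n. ?Y k \<omega> = y k) \<longleftrightarrow>
          (\<forall>i<j. g i \<omega> = enat (D i)) \<and> g j \<omega> \<in> {enat a<..}" for \<omega>
      proof (cases "\<forall>k\<le>n. ?Y k \<omega> = y k")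
        case True
        then show ?thesis
          using H(1)[of \<omega>] step[OF True] sgn by (cases "g j \<omega> = enat a") (auto simp: 2)
      next
        case False
        then show ?thesis using H(1)[of \<omega>] by auto
      qed
      then have "{\<omega>\<in>space M. ?Y (Suc n) \<omega> = y (Suc n) \<and> (\<forall>k\<le>n. ?Y k \<omega> = y k)} =
         {\<omega>\<in>space M. (\<forall>i<j. g i \<omega> = enat (D i)) \<and> g j \<omega> \<in> {enat a<..}}" by blast
      also have "prob \<dots> = Q * (discrete_survival (\<alpha> i) (a - 1) * (1 - \<alpha> i a))"
        unfolding indep_vars_prefix_prob[OF ind] Q_def gt S ..
      finally show ?thesis
        unfolding yn 2 using pmf_prw_kernel(1)[of \<alpha> i a "(-1) ^ j"] \<alpha>i a1 i by (auto simp: less_imp_le)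
    next
      case 3
      have "?Y (Suc n) \<omega> \<noteq> y (Suc n)" if "\<forall>k\<le>n. ?Y k \<omega> = y k" for \<omega>
        using step[OF that] 3 by (auto split: if_splits)
      then have "{\<omega>\<in>space M. ?Y (Suc n) \<omega> = y (Suc n) \<and> (\<forall>k\<le>n. ?Y k \<omega> = y k)} = {}" by blast
      moreover have "y (Suc n) \<notin> set_pmf (prw_kernel \<alpha> (y n))"
        unfolding yn prw_kernel_def using 3 by (auto split: if_splits)
      ultimately show ?thesis by (simp only: set_pmf_iff not_not measure_empty mult_zero_right)
    qed
  qed
  show "cond_prob M (\<lambda>\<omega>. ?Y (Suc n) \<omega> = y (Suc n)) (\<lambda>\<omega>. \<forall>k\<le>n. ?Y k \<omega> = y k) = pmf (prw_kernel \<alpha> (y n)) (y (Suc n))"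
    unfolding cond_prob_def joint pn using pos[unfolded pn] by (metis less_irrefl nonzero_mult_div_cancel_left)
qed

end

text \<open>Induction on the length of the path. The kernel prescribes conditional probabilities
  only after histories of positive probability; an extension of a null history is null for both
  chains.\<close>

lemma markov_chain_fdd:
  fixes Y :: "nat \<Rightarrow> 'b \<Rightarrow> 's" and Y' :: "nat \<Rightarrow> 'c \<Rightarrow> 's"
  assumes P: "prob_space P" and M: "prob_space M"
    and Y: "markov_chain P E K Y" "AE \<omega> in P. Y 0 \<omega> = s"
    and Y': "markov_chain M E K Y'" "AE \<omega> in M. Y' 0 \<omega> = s"
  shows "y \<in> {..n} \<rightarrow> E \<Longrightarrow> \<P>(\<omega> in P. \<forall>k\<le>n. Y k \<omega> = y k) = \<P>(\<omega> in M. \<forall>k\<le>n. Y' k \<omega> = y k)"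
proof (induction n)
  case 0
  have base: "\<P>(\<omega> in N. Z \<omega> = y 0) = (if y 0 = s then 1 else 0)"
    if N: "prob_space N" and Z: "Z \<in> N \<rightarrow>\<^sub>M count_space E" "AE \<omega> in N. Z \<omega> = s"
    for N :: "'x measure" and Z :: "'x \<Rightarrow> 's"
  proof -
    interpret prob_space N by (rule N)
    have "Z -` {y 0} \<inter> space N \<in> sets N" using Z(1) 0 by (intro measurable_sets[OF Z(1)]) auto
    moreover have "Z -` {y 0} \<inter> space N = {\<omega>\<in>space N. Z \<omega> = y 0}" by auto
    ultimately have ev: "{\<omega>\<in>space N. Z \<omega> = y 0} \<in> sets N" by simp
    show ?thesis
    proof (cases "y 0 = s")
      case True
      then show ?thesis using prob_Collect_eq_1[OF ev] Z(2) by simp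
    next
      case False
      then have "AE \<omega> in N. Z \<omega> \<noteq> y 0" using Z(2) by auto
      then show ?thesis using False prob_Collect_eq_0[OF ev] by simp
    qed
  qed
  have "Y 0 \<in> P \<rightarrow>\<^sub>M count_space E" "Y' 0 \<in> M \<rightarrow>\<^sub>M count_space E"
    using Y(1) Y'(1) by (auto simp: markov_chain_def)
  from base[OF P this(1) Y(2)] base[OF M this(2) Y'(2)] show ?case by simp
next
  case (Suc n)
  have step: "\<P>(\<omega> in N. \<forall>k\<le>Suc n. Z k \<omega> = y k) = \<P>(\<omega> in N. \<forall>k\<le>n. Z k \<omega> = y k) * pmf (K (y n)) (y (Suc n))"
    if N: "prob_space N" and Z: "markov_chain N E K Z" for N :: "'x measure" and Z :: "nat \<Rightarrow> 'x \<Rightarrow> 's"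
  proof -
    interpret prob_space N by (rule N)
    have "Z k -` {y k} \<inter> space N \<in> sets N" if "k \<le> Suc n" for k
      using Z Suc.prems that by (intro measurable_sets[of "Z k" N "count_space E"]) (auto simp: markov_chain_def)
    moreover have "Z k -` {y k} \<inter> space N = {\<omega>\<in>space N. Z k \<omega> = y k}" for k by auto
    ultimately have ev1: "{\<omega>\<in>space N. Z k \<omega> = y k} \<in> sets N" if "k \<le> Suc n" for k using that by simp
    have ev: "{\<omega>\<in>space N. \<forall>k\<in>{..n}. Z k \<omega> = y k} \<in> sets N"
      by (rule sets.sets_Collect_finite_All) (auto intro: ev1)
    have eq: "{\<omega>\<in>space N. \<forall>k\<le>Suc n. Z k \<omega> = y k} = {\<omega>\<in>space N. Z (Suc n) \<omega> = y (Suc n) \<and> (\<forall>k\<le>n. Z k \<omega> = y k)}"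
      using le_Suc_eq by auto
    show ?thesis
    proof (cases "\<P>(\<omega> in N. \<forall>k\<le>n. Z k \<omega> = y k) > 0")
      case True
      then have "\<P>(\<omega> in N. Z (Suc n) \<omega> = y (Suc n) \<bar> \<forall>k\<le>n. Z k \<omega> = y k) = pmf (K (y n)) (y (Suc n))"
        using Z Suc.prems unfolding markov_chain_def by blast
      then show ?thesis using True unfolding eq cond_prob_def by (simp add: field_simps)
    next
      case False
      then have 0: "\<P>(\<omega> in N. \<forall>k\<le>n. Z k \<omega> = y k) = 0" by (simp add: zero_less_measure_iff)
      have "\<P>(\<omega> in N. \<forall>k\<le>Suc n. Z k \<omega> = y k) \<le> \<P>(\<omega> in N. \<forall>k\<le>n. Z k \<omega> = y k)"
      proof (rule finite_measure_mono)
        have "{\<omega>\<in>space N. \<forall>k\<le>n. Z k \<omega> = y k} = {\<omega>\<in>space N. \<forall>k\<in>{..n}. Z k \<omega> = y k}" by auto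
        then show "{\<omega>\<in>space N. \<forall>k\<le>n. Z k \<omega> = y k} \<in> sets N" using ev by (simp only:)
      qed auto
      then have "\<P>(\<omega> in N. \<forall>k\<le>Suc n. Z k \<omega> = y k) = 0"
        unfolding 0 using measure_nonneg[of N "{\<omega>\<in>space N. \<forall>k\<le>Suc n. Z k \<omega> = y k}"] by linarith
      then show ?thesis by (simp only: 0 mult_zero_left)
    qed
  qed
  have "y \<in> {..n} \<rightarrow> E" using Suc.prems by auto
  then show ?case using step[OF P Y(1)] step[OF M Y'(1)] Suc.IH by simp
qed

text \<open>Cylinder sets determine a measure on the product. A cylinder depends on a prefix of the
  sequence; coded as a list, the prefix lives in the countable space \<open>lists E\<close>, where
  the point masses of \<open>markov_chain_fdd\<close> fix the law.\<close>

lemma markov_chain_law_unique: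
  fixes Y :: "nat \<Rightarrow> 'b \<Rightarrow> 's" and Y' :: "nat \<Rightarrow> 'c \<Rightarrow> 's"
  assumes P: "prob_space P" and M: "prob_space M" and E: "countable E"
    and Y: "markov_chain P E K Y" "AE \<omega> in P. Y 0 \<omega> = s"
    and Y': "markov_chain M E K Y'" "AE \<omega> in M. Y' 0 \<omega> = s"
  shows "distr P (PiM UNIV (\<lambda>_. count_space E)) (\<lambda>\<omega> n. Y n \<omega>) =
    distr M (PiM UNIV (\<lambda>_. count_space E)) (\<lambda>\<omega> n. Y' n \<omega>)"
proof -
  let ?S = "PiM UNIV (\<lambda>_::nat. count_space E)"
  have rv: "Y n \<in> P \<rightarrow>\<^sub>M count_space E" "Y' n \<in> M \<rightarrow>\<^sub>M count_space E" for n
    using Y Y' by (auto simp: markov_chain_def)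
  have seq: "(\<lambda>\<omega> n. Y n \<omega>) \<in> P \<rightarrow>\<^sub>M ?S" "(\<lambda>\<omega> n. Y' n \<omega>) \<in> M \<rightarrow>\<^sub>M ?S"
    using rv by (auto intro!: measurable_PiM_single' simp: PiE_iff measurable_space[OF rv(1), simplified]
        measurable_space[OF rv(2), simplified])
  define pre where "pre n y = map y [0..<Suc n]" for n and y :: "nat \<Rightarrow> 's"
  have pre_iff: "pre n y = l \<longleftrightarrow> length l = Suc n \<and> (\<forall>k\<le>n. y k = l ! k)" for n y l
    unfolding pre_def by (auto simp: list_eq_iff_nth_eq less_Suc_eq_le simp del: upt_Suc)
  have pre_len: "length (pre n y) = Suc n" for n y by (simp add: pre_def del: upt_Suc)
  have pre_lists: "pre n (\<lambda>k. Z k \<omega>) \<in> lists E" if "\<And>k. Z k \<in> N \<rightarrow>\<^sub>M count_space E" "\<omega> \<in> space N"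
    for n \<omega> and N :: "'x measure" and Z :: "nat \<Rightarrow> 'x \<Rightarrow> 's"
    using measurable_space[OF that(1) that(2)] by (auto simp: pre_def simp del: upt_Suc)
  have pre_meas: "(\<lambda>\<omega>. pre n (\<lambda>k. Z k \<omega>)) \<in> N \<rightarrow>\<^sub>M count_space (lists E)"
    if Z: "\<And>k. Z k \<in> N \<rightarrow>\<^sub>M count_space E" for n and N :: "'x measure" and Z :: "nat \<Rightarrow> 'x \<Rightarrow> 's"
  proof (subst measurable_count_space_eq_countable)
    show "countable (lists E)" using E by (rule countable_lists)
    show "(\<lambda>\<omega>. pre n (\<lambda>k. Z k \<omega>)) \<in> space N \<rightarrow> lists E \<and>
      (\<forall>l\<in>lists E. (\<lambda>\<omega>. pre n (\<lambda>k. Z k \<omega>)) -` {l} \<inter> space N \<in> sets N)"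
    proof (intro conjI ballI)
      show "(\<lambda>\<omega>. pre n (\<lambda>k. Z k \<omega>)) \<in> space N \<rightarrow> lists E" using pre_lists[OF Z] by auto
      fix l assume l: "l \<in> lists E"
      show "(\<lambda>\<omega>. pre n (\<lambda>k. Z k \<omega>)) -` {l} \<inter> space N \<in> sets N"
      proof (cases "length l = Suc n")
        case True
        have "Z k -` {l ! k} \<inter> space N \<in> sets N" if "k \<le> n" for k
          using l True that by (intro measurable_sets[OF Z]) auto
        then have "(\<Inter>k\<in>{..n}. Z k -` {l ! k} \<inter> space N) \<in> sets N" by (intro sets.finite_INT) auto
        moreover have "(\<lambda>\<omega>. pre n (\<lambda>k. Z k \<omega>)) -` {l} \<inter> space N = (\<Inter>k\<in>{..n}. Z k -` {l ! k} \<inter> space N)"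
          using True by (intro set_eqI) (simp only: pre_iff vimage_singleton_eq INT_iff Int_iff, fastforce)
        ultimately show ?thesis by simp
      next
        case False
        then have "(\<lambda>\<omega>. pre n (\<lambda>k. Z k \<omega>)) -` {l} \<inter> space N = {}" using pre_len by auto
        then show ?thesis by simp
      qed
    qed
  qed
  have pre_law: "distr P (count_space (lists E)) (\<lambda>\<omega>. pre n (\<lambda>k. Y k \<omega>)) =
      distr M (count_space (lists E)) (\<lambda>\<omega>. pre n (\<lambda>k. Y' k \<omega>))" for n
  proof (rule measure_eqI_countable[where A = "lists E"])
    show "countable (lists E)" using E by (rule countable_lists)
    fix l assume l: "l \<in> lists E"
    have "measure P ((\<lambda>\<omega>. pre n (\<lambda>k. Y k \<omega>)) -` {l} \<inter> space P) =
        measure M ((\<lambda>\<omega>. pre n (\<lambda>k. Y' k \<omega>)) -` {l} \<inter> space M)"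
    proof (cases "length l = Suc n")
      case True
      have "(\<lambda>\<omega>. pre n (\<lambda>k. Y k \<omega>)) -` {l} \<inter> space P = {\<omega>\<in>space P. \<forall>k\<le>n. Y k \<omega> = l ! k}"
        "(\<lambda>\<omega>. pre n (\<lambda>k. Y' k \<omega>)) -` {l} \<inter> space M = {\<omega>\<in>space M. \<forall>k\<le>n. Y' k \<omega> = l ! k}"
        using True by (intro set_eqI; simp add: pre_iff vimage_def conj_commute)+
      moreover have "(!) l \<in> {..n} \<rightarrow> E" using l True by auto
      ultimately show ?thesis using markov_chain_fdd[OF P M Y Y', of "(!) l" n] by (simp only:)
    next
      case False
      then have "(\<lambda>\<omega>. pre n (\<lambda>k. Y k \<omega>)) -` {l} \<inter> space P = {}"
        "(\<lambda>\<omega>. pre n (\<lambda>k. Y' k \<omega>)) -` {l} \<inter> space M = {}" using pre_len by auto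
      then show ?thesis by simp
    qed
    then show "emeasure (distr P (count_space (lists E)) (\<lambda>\<omega>. pre n (\<lambda>k. Y k \<omega>))) {l} =
        emeasure (distr M (count_space (lists E)) (\<lambda>\<omega>. pre n (\<lambda>k. Y' k \<omega>))) {l}"
      using l pre_meas[OF rv(1)] pre_meas[OF rv(2)] P M
      by (simp add: emeasure_distr finite_measure.emeasure_eq_measure prob_space_def)
  qed simp_all
  show ?thesis
  proof (rule measure_eqI_PiM_infinite[where I = UNIV and M = "\<lambda>_. count_space E"])
    show "finite_measure (distr P ?S (\<lambda>\<omega> n. Y n \<omega>))"
      using prob_space.prob_space_distr[OF P seq(1)] by (simp add: prob_space_def)
    fix A and J :: "nat set"
    assume J: "finite J" and A: "\<And>i. i \<in> J \<Longrightarrow> A i \<in> sets (count_space E)"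
    obtain n where n: "J \<subseteq> {..n}" using J by (meson finite_nat_iff_bounded_le)
    \<comment> \<open>The prefixes of length \<open>n + 1\<close> that are compatible with the
      cylinder.\<close>
    define L where "L = {l \<in> lists E. length l = Suc n \<and> (\<forall>k\<in>J. l ! k \<in> A k)}"
    let ?C = "prod_emb UNIV (\<lambda>_. count_space E) J (Pi\<^sub>E J A)"
    have C: "?C \<in> sets ?S" using J A by (intro sets_PiM_I) auto
    have vim: "(\<lambda>\<omega> k. Z k \<omega>) -` ?C \<inter> space N = (\<lambda>\<omega>. pre n (\<lambda>k. Z k \<omega>)) -` L \<inter> space N"
      if Z: "\<And>k. Z k \<in> N \<rightarrow>\<^sub>M count_space E" for N :: "'x measure" and Z :: "nat \<Rightarrow> 'x \<Rightarrow> 's"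
    proof (intro set_eqI iffI; elim IntE; intro IntI)
      fix \<omega> assume \<omega>: "\<omega> \<in> space N"
      have len: "length (pre n (\<lambda>k. Z k \<omega>)) = Suc n" "\<forall>k\<le>n. pre n (\<lambda>k. Z k \<omega>) ! k = Z k \<omega>"
        using pre_iff[of n "\<lambda>k. Z k \<omega>" "pre n (\<lambda>k. Z k \<omega>)"] by auto
      have E: "Z k \<omega> \<in> E" for k using measurable_space[OF Z \<omega>] by simp
      { assume "\<omega> \<in> (\<lambda>\<omega> k. Z k \<omega>) -` ?C"
        then show "\<omega> \<in> (\<lambda>\<omega>. pre n (\<lambda>k. Z k \<omega>)) -` L"
          using len pre_lists[OF Z \<omega>] n by (auto simp: L_def prod_emb_def PiE_iff subset_iff) }
      { assume "\<omega> \<in> (\<lambda>\<omega>. pre n (\<lambda>k. Z k \<omega>)) -` L"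
        then show "\<omega> \<in> (\<lambda>\<omega> k. Z k \<omega>) -` ?C"
          using len n E by (auto simp: L_def prod_emb_def PiE_iff subset_iff) }
    qed auto
    have L: "L \<in> sets (count_space (lists E))" by (auto simp: L_def)
    have "emeasure (distr P ?S (\<lambda>\<omega> n. Y n \<omega>)) ?C =
        emeasure (distr P (count_space (lists E)) (\<lambda>\<omega>. pre n (\<lambda>k. Y k \<omega>))) L"
      unfolding emeasure_distr[OF seq(1) C] emeasure_distr[OF pre_meas[OF rv(1)] L] vim[OF rv(1)] ..
    also have "\<dots> = emeasure (distr M (count_space (lists E)) (\<lambda>\<omega>. pre n (\<lambda>k. Y' k \<omega>))) L"
      unfolding pre_law ..
    also have "\<dots> = emeasure (distr M ?S (\<lambda>\<omega> n. Y' n \<omega>)) ?C"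
      unfolding emeasure_distr[OF seq(2) C] emeasure_distr[OF pre_meas[OF rv(2)] L] vim[OF rv(2)] ..
    finally show "emeasure (distr P ?S (\<lambda>\<omega> n. Y n \<omega>)) ?C = emeasure (distr M ?S (\<lambda>\<omega> n. Y' n \<omega>)) ?C" .
  qed simp_all
qed

section \<open>Skorohod distance of telegraph paths\<close>

text \<open>For \<open>s\<close> in the \<open>k\<close>-th interval this is the integral over
  \<open>[b 0, s]\<close> of the function equal to \<open>(-1) ^ i\<close> between
  \<open>b i\<close> and \<open>b (Suc i)\<close>.\<close>

definition telegraph_position :: "(nat \<Rightarrow> real) \<Rightarrow> nat \<Rightarrow> real \<Rightarrow> real" where
  "telegraph_position b k s = (\<Sum>i<k. (-1) ^ i * (b (Suc i) - b i)) + (-1) ^ k * (s - b k)"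

text \<open>The limit path has this property with \<open>\<eta> = 0\<close>, the rescaled walk with \<open>\<eta> = \<epsilon>\<close>.\<close>

definition near_telegraph :: "real \<Rightarrow> (nat \<Rightarrow> real) \<Rightarrow> nat \<Rightarrow> (real \<Rightarrow> real \<times> real \<times> real) \<Rightarrow> bool" where
  "near_telegraph \<eta> b K z \<longleftrightarrow> (\<forall>k<K. \<forall>s. b k \<le> s \<and> s < b (Suc k) \<longrightarrow>
     \<bar>fst (z s) - telegraph_position b k s\<bar> \<le> \<eta> \<and> fst (snd (z s)) = (-1) ^ k \<and>
     \<bar>snd (snd (z s)) - (s - b k)\<bar> \<le> \<eta>)"

lemma breakpoint_interval:
  fixes b :: "nat \<Rightarrow> 'a::linorder"
  assumes "b 0 \<le> s" "s < b K" shows "\<exists>k<K. b k \<le> s \<and> s < b (Suc k)"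
  using assms(2)
proof (induction K)
  case (Suc K)
  then show ?case by (cases "s < b K") (auto simp: not_less intro: less_SucI)
qed (use assms(1) in simp)

lemma breakpoint_interval_left:
  fixes b :: "nat \<Rightarrow> 'a::linorder"
  assumes "b 0 < s" "s \<le> b K" shows "\<exists>k<K. b k < s \<and> s \<le> b (Suc k)"
  using assms(2)
proof (induction K)
  case (Suc K)
  then show ?case by (cases "s \<le> b K") (auto simp: not_le intro: less_SucI)
qed (use assms(1) in simp)

text \<open>Two different pieces may be involved at \<open>t\<close>: the one beginning at or before
  \<open>t\<close> gives right-continuity, the one beginning strictly before \<open>t\<close> gives
  the left limit.\<close>

lemma cadlag_piecewise:
  fixes z :: "real \<Rightarrow> 'a::topological_space"
  assumes b: "b 0 = 0" "\<And>T. \<exists>k. T < b k"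
    and c: "\<And>k. continuous_on UNIV (c k)" "\<And>k s. b k \<le> s \<Longrightarrow> s < b (Suc k) \<Longrightarrow> z s = c k s"
  shows "cadlag z"
  unfolding cadlag_def
proof (intro conjI allI impI)
  fix t :: real assume "0 \<le> t"
  moreover obtain K where "t < b K" using b(2) by blast
  ultimately obtain k where k: "b k \<le> t" "t < b (Suc k)" using breakpoint_interval[of b t K] b(1) by auto
  have "(c k \<longlongrightarrow> c k t) (at_right t)"
    using c(1)[of k] by (auto simp: continuous_on_eq_continuous_at isCont_def intro: tendsto_within_subset)
  moreover have "\<forall>\<^sub>F s in at_right t. c k s = z s"
    unfolding eventually_at_right_field using k c(2)[of k] by (intro exI[of _ "b (Suc k)"]) auto
  ultimately have "(z \<longlongrightarrow> c k t) (at_right t)" by (rule Lim_transform_eventually)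
  then show "(z \<longlongrightarrow> z t) (at_right t)" using c(2)[OF k] by simp
next
  fix t :: real assume "0 < t"
  moreover obtain K where "t < b K" using b(2) by blast
  ultimately obtain k where k: "b k < t" "t \<le> b (Suc k)" using breakpoint_interval_left[of b t K] b(1) by auto
  have "(c k \<longlongrightarrow> c k t) (at_left t)"
    using c(1)[of k] by (auto simp: continuous_on_eq_continuous_at isCont_def intro: tendsto_within_subset)
  moreover have "\<forall>\<^sub>F s in at_left t. c k s = z s"
    unfolding eventually_at_left_field using k c(2)[of k] by (intro exI[of _ "b k"]) auto
  ultimately have "(z \<longlongrightarrow> c k t) (at_left t)" by (rule Lim_transform_eventually)
  then show "\<exists>l. (z \<longlongrightarrow> l) (at_left t)" ..
qed

text \<open>The equation between \<open>p\<close>, \<open>c\<close>, \<open>q\<close> and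
  \<open>d\<close> is continuity at \<open>c\<close>; with slope \<open>q > 0\<close> the three
  affine pieces then glue to an increasing bijection.\<close>

lemma time_change_stretch:
  fixes p c q d :: real
  assumes p: "0 \<le> p" "p < c" "0 < q" "p + (c - p) * q = c + d"
  shows "time_change (\<lambda>u. if u \<le> p then u else if u \<le> c then p + (u - p) * q else u + d)"
    (is "time_change ?m")
  unfolding time_change_def
proof
  have pos: "0 < (w - p) * q" if "p < w" for w using that p(3) by simp
  have cd: "p < c + d" using pos[OF p(2)] p(4) by linarith
  have lin: "p + (u - p) * q \<le> c + d" if "u \<le> c" for u
    using that p(3) unfolding p(4)[symmetric] by simp
  show "strict_mono_on {0..} ?m"
  proof (rule strict_mono_onI)
    fix u v :: real assume "u \<in> {0..}" "v \<in> {0..}" "u < v"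
    then consider "v \<le> p" | "u \<le> p" "p < v" "v \<le> c" | "u \<le> p" "c < v" | "p < u" "v \<le> c" | "p <
        u" "u \<le> c" "c < v" | "c < u"
      by linarith
    then show "?m u < ?m v"
    proof cases
      case 2
      then show ?thesis using pos[of v] by simp
    next
      case 3
      then show ?thesis using cd p by simp
    next
      case 4
      then show ?thesis using \<open>u < v\<close> p(3) by simp
    next
      case 5
      then show ?thesis using lin[of u] p by simp
    qed (use \<open>u < v\<close> p in auto)
  qed
  show "?m ` {0..} = {0..}"
  proof (intro set_eqI iffI)
    fix y assume "y \<in> ?m ` {0..}"
    then obtain u where "0 \<le> u" "y = ?m u" by auto
    then show "y \<in> {0..}"
      using p cd pos[of u] by (cases "u \<le> p"; cases "u \<le> c") auto
  next
    fix y :: real assume y: "y \<in> {0..}"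
    consider "y \<le> p" | "p < y" "y \<le> c + d" | "c + d < y" by linarith
    then show "y \<in> ?m ` {0..}"
    proof cases
      case 1
      then show ?thesis using y by (intro image_eqI[of _ _ y]) auto
    next
      case 2
      let ?u = "p + (y - p) / q"
      have "(y - p) / q \<le> c - p" using 2 p(3,4) by (simp add: pos_divide_le_eq)
      moreover have "0 < (y - p) / q" using 2 p by simp
      ultimately show ?thesis using p by (intro image_eqI[of _ _ ?u]) auto
    next
      case 3
      then show ?thesis using p by (intro image_eqI[of _ _ "y - d"]) auto
    qed
  qed
qed

text \<open>Induction on \<open>K\<close>. Beyond \<open>a K\<close> the previous time change is a
  translation, so it suffices to follow it by a map that fixes \<open>[0, b K]\<close> and rescales
  the next interval. On that interval the displacement is a convex combination of its values at the
  two ends and stays below \<open>\<delta>\<close>.\<close>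

lemma time_change_breakpoints:
  fixes a b :: "nat \<Rightarrow> real"
  assumes ab: "a 0 = 0" "b 0 = 0"
  shows "(\<forall>k<K. a k < a (Suc k) \<and> b k < b (Suc k)) \<Longrightarrow> (\<forall>k\<le>K. \<bar>b k - a k\<bar> \<le> \<delta>) \<Longrightarrow>
    \<exists>\<tau>. time_change \<tau> \<and> (\<forall>k\<le>K. \<tau> (a k) = b k) \<and> (\<forall>s\<ge>0. \<bar>\<tau> s - s\<bar> \<le> \<delta>) \<and> (\<forall>s\<ge>a K. \<tau> s = s + (b K - a K))"
proof (induction K)
  case 0
  then show ?case using ab by (intro exI[of _ "\<lambda>s. s"]) (simp add: time_change_id)
next
  case (Suc K)
  then obtain \<tau> where \<tau>: "time_change \<tau>" "\<And>k. k \<le> K \<Longrightarrow> \<tau> (a k) = b k" "\<And>s. s \<ge> 0 \<Longrightarrow> \<bar>\<tau> s - s\<bar> \<le> \<delta>"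
    "\<And>s. s \<ge> a K \<Longrightarrow> \<tau> s = s + (b K - a K)" by auto
  have mono: "\<tau> s < \<tau> t" if "0 \<le> s" "s < t" for s t
    using \<tau>(1) that by (auto simp: time_change_def strict_mono_on_def)
  have nn: "0 \<le> a k \<and> 0 \<le> b k" if "k \<le> Suc K" for k
    using that
  proof (induction k)
    case (Suc k)
    then show ?case using Suc.prems \<open>\<forall>k<Suc K. a k < a (Suc k) \<and> b k < b (Suc k)\<close>
      by (auto dest!: spec[of _ k])
  qed (use ab in auto)
  have inc: "a K < a (Suc K)" "b K < b (Suc K)" using Suc.prems(1) by auto
  have le: "a k \<le> a K" if "k \<le> K" for k
    using that
  proof (induction k rule: inc_induct)
    case (step k)
    then show ?case using Suc.prems(1) by (auto dest!: spec[of _ k])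
  qed simp
  \<comment> \<open>\<open>c\<close> is where the previous time change sends
    \<open>a (Suc K)\<close>, \<open>q\<close> is the ratio of the interval lengths, and
    \<open>d\<close> moves \<open>c\<close> to \<open>b (Suc K)\<close>.\<close>
  define c q d where "c = b K + (a (Suc K) - a K)" and "q = (b (Suc K) - b K) / (a (Suc K) - a K)"
    and "d = b (Suc K) - c"
  define m where "m u = (if u \<le> b K then u else if u \<le> c then b K + (u - b K) * q else u + d)" for u
  have "time_change m"
    unfolding m_def
    by (rule time_change_stretch) (use inc nn[of K] in \<open>auto simp: c_def q_def d_def\<close>)
  then have tc: "time_change (\<lambda>s. m (\<tau> s))" by (rule time_change_compose[OF \<tau>(1)])
  have low: "m (\<tau> s) = \<tau> s" if "0 \<le> s" "s \<le> a K" for s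
    using mono[of s "a K"] \<tau>(2)[of K] that by (cases "s = a K") (auto simp: m_def)
  have mid: "m (\<tau> s) = b K + (s - a K) * q" if "a K \<le> s" "s \<le> a (Suc K)" for s
    using \<tau>(4)[of s] that by (auto simp: m_def c_def)
  have high: "m (\<tau> s) = s + (b (Suc K) - a (Suc K))" if "a (Suc K) \<le> s" for s
  proof (cases "s = a (Suc K)")
    case True
    then show ?thesis using mid[of s] inc by (simp add: q_def)
  next
    case False
    then show ?thesis using \<tau>(4)[of s] that inc by (auto simp: m_def c_def d_def)
  qed
  have bnd: "\<bar>m (\<tau> s) - s\<bar> \<le> \<delta>" if s: "0 \<le> s" for s
  proof -
    consider "s \<le> a K" | "a K < s" "s < a (Suc K)" | "a (Suc K) \<le> s" by linarith
    then show ?thesis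
    proof cases
      case 1
      then show ?thesis using low[OF s] \<tau>(3)[OF s] by simp
    next
      case 2
      define l where "l = (s - a K) / (a (Suc K) - a K)"
      have l: "0 \<le> l" "l \<le> 1" using 2 by (auto simp: l_def)
      have "(s - a K) * q = l * (b (Suc K) - b K)" by (simp add: l_def q_def)
      moreover have "s - a K = l * (a (Suc K) - a K)" using inc by (simp add: l_def)
      ultimately have "m (\<tau> s) - s = (b K + l * (b (Suc K) - b K)) - (a K + l * (a (Suc K) - a K))"
        using mid[of s] 2 by linarith
      also have "\<dots> = (1 - l) * (b K - a K) + l * (b (Suc K) - a (Suc K))" by (simp add: algebra_simps)
      also have "\<bar>\<dots>\<bar> \<le> \<bar>(1 - l) * (b K - a K)\<bar> + \<bar>l * (b (Suc K) - a (Suc K))\<bar>" by (rule abs_triangle_ineq)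
      also have "\<dots> = (1 - l) * \<bar>b K - a K\<bar> + l * \<bar>b (Suc K) - a (Suc K)\<bar>" using l by (simp add: abs_mult)
      also have "\<dots> \<le> (1 - l) * \<delta> + l * \<delta>"
        using l Suc.prems(2) by (intro add_mono mult_left_mono) auto
      finally show ?thesis by (simp add: algebra_simps)
    next
      case 3
      then show ?thesis using high[of s] Suc.prems(2) by simp
    qed
  qed
  have pts: "m (\<tau> (a k)) = b k" if "k \<le> Suc K" for k
  proof (cases "k = Suc K")
    case True then show ?thesis using high[of "a (Suc K)"] by simp
  next
    case False
    then have "k \<le> K" using that by simp
    then show ?thesis using low[of "a k"] le[of k] nn[of k] \<tau>(2)[of k] by simp
  qed
  show ?case
    using tc pts bnd high by (intro exI[of _ "\<lambda>s. m (\<tau> s)"]) auto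
qed

text \<open>Each completed interval changes its length by at most \<open>2 * \<delta>\<close>, and
  so does the elapsed part of the current one; there are at most \<open>K + 1\<close> such
  terms.\<close>

lemma telegraph_position_close:
  assumes "\<forall>k\<le>K. \<bar>b k - a k\<bar> \<le> \<delta>" "k < K" "\<bar>t - s\<bar> \<le> \<delta>"
  shows "\<bar>telegraph_position b k t - telegraph_position a k s\<bar> \<le> 2 * (real K + 1) * \<delta>"
proof -
  have \<delta>: "0 \<le> \<delta>" using assms(3) by linarith
  have term1: "\<bar>(-1) ^ i * (b (Suc i) - b i) - (-1) ^ i * (a (Suc i) - a i)\<bar> \<le> 2 * \<delta>" if "i < k" for i
  proof -
    have "\<bar>b (Suc i) - a (Suc i)\<bar> \<le> \<delta>" "\<bar>b i - a i\<bar> \<le> \<delta>" using assms that by auto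
    then have "\<bar>(b (Suc i) - b i) - (a (Suc i) - a i)\<bar> \<le> 2 * \<delta>" by linarith
    then show ?thesis by (simp add: right_diff_distrib[symmetric] abs_mult power_abs)
  qed
  have "\<bar>(\<Sum>i<k. (-1) ^ i * (b (Suc i) - b i)) - (\<Sum>i<k. (-1) ^ i * (a (Suc i) - a i))\<bar> \<le>
     (\<Sum>i<k. \<bar>(-1) ^ i * (b (Suc i) - b i) - (-1) ^ i * (a (Suc i) - a i)\<bar>)"
    unfolding sum_subtractf[symmetric] by (rule sum_abs)
  also have "\<dots> \<le> (\<Sum>i<k. 2 * \<delta>)" by (rule sum_mono) (use term1 in auto)
  also have "\<dots> \<le> 2 * real K * \<delta>" using assms(2) \<delta> by (simp add: mult_right_mono)
  finally have 1: "\<bar>(\<Sum>i<k. (-1) ^ i * (b (Suc i) - b i)) - (\<Sum>i<k. (-1) ^ i * (a (Suc i) - a i))\<bar> \<le> 2 * real K * \<delta>" .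
  have "\<bar>b k - a k\<bar> \<le> \<delta>" using assms by auto
  then have "\<bar>(t - b k) - (s - a k)\<bar> \<le> 2 * \<delta>" using assms(3) by linarith
  then have 2: "\<bar>(-1) ^ k * (t - b k) - (-1) ^ k * (s - a k)\<bar> \<le> 2 * \<delta>"
    by (simp add: right_diff_distrib[symmetric] abs_mult power_abs)
  have "2 * (real K + 1) * \<delta> = 2 * real K * \<delta> + 2 * \<delta>" by (simp add: algebra_simps)
  then show ?thesis using 1 2 unfolding telegraph_position_def by linarith
qed

lemma dist_triple_le:
  fixes x y :: "real \<times> real \<times> real"
  shows "dist x y \<le> \<bar>fst x - fst y\<bar> + \<bar>fst (snd x) - fst (snd y)\<bar> + \<bar>snd (snd x) - snd (snd y)\<bar>"
proof -
  have "dist x y \<le> dist (fst x) (fst y) + dist (snd x) (snd y)"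
    unfolding dist_prod_def by (rule sqrt_sum_squares_le_sum) auto
  also have "dist (snd x) (snd y) \<le> dist (fst (snd x)) (fst (snd y)) + dist (snd (snd x)) (snd (snd y))"
    unfolding dist_prod_def[of "snd x"] by (rule sqrt_sum_squares_le_sum) auto
  finally show ?thesis by (simp add: dist_real_def)
qed

text \<open>After the time change both paths are in the same sojourn, so their signs agree exactly.
  The position costs \<open>\<eta> + 2 * (K + 1) * \<delta>\<close> and the age
  \<open>\<eta> + 2 * \<delta>\<close>, which adds up to the budget in the hypothesis. Only times up
  to \<open>1 / r\<close> are inspected, hence the condition on \<open>a K\<close>.\<close>

lemma near_telegraph_skorohod_close:
  assumes x: "near_telegraph 0 a K x" and z: "near_telegraph \<eta> b K z"
    and ab: "a 0 = 0" "b 0 = 0" "\<forall>k<K. a k < a (Suc k) \<and> b k < b (Suc k)"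
    and close: "\<forall>k\<le>K. \<bar>b k - a k\<bar> \<le> \<delta>"
    and r: "0 < r" "1 / r < a K" "\<delta> \<le> r" "2 * \<eta> + 2 * (real K + 2) * \<delta> \<le> r"
  shows "skorohod_close r x z"
proof -
  obtain \<tau> where \<tau>: "time_change \<tau>" "\<forall>k\<le>K. \<tau> (a k) = b k" "\<forall>s\<ge>0. \<bar>\<tau> s - s\<bar> \<le> \<delta>"
    using time_change_breakpoints[OF ab close] by blast
  have mono: "\<tau> s < \<tau> t" if "0 \<le> s" "s < t" for s t
    using \<tau>(1) that by (auto simp: time_change_def strict_mono_on_def)
  have nn: "0 \<le> a k" if "k \<le> K" for k
    using that
  proof (induction k)
    case (Suc k)
    then show ?case using ab(3) by (auto dest!: spec[of _ k])
  qed (use ab in auto)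
  have "dist (z (\<tau> s)) (x s) \<le> r" if s: "s \<in> {0..1/r}" for s
  proof -
    have "s < a K" "a 0 \<le> s" using s r ab by auto
    then obtain k where k: "k < K" "a k \<le> s" "s < a (Suc k)" using breakpoint_interval[of a s K] by auto
    have "b k \<le> \<tau> s" using mono[of "a k" s] nn[of k] k \<tau>(2) by (cases "a k = s") auto
    moreover have "\<tau> s < b (Suc k)" using mono[of s "a (Suc k)"] s k \<tau>(2) by auto
    ultimately have 1: "\<bar>fst (z (\<tau> s)) - telegraph_position b k (\<tau> s)\<bar> \<le> \<eta>" "fst (snd (z (\<tau> s))) = (-1) ^ k"
      "\<bar>snd (snd (z (\<tau> s))) - (\<tau> s - b k)\<bar> \<le> \<eta>"
      using z k(1) by (auto simp: near_telegraph_def)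
    have 2: "\<bar>fst (x s) - telegraph_position a k s\<bar> \<le> 0" "fst (snd (x s)) = (-1) ^ k"
      "\<bar>snd (snd (x s)) - (s - a k)\<bar> \<le> 0"
      using x k by (auto simp: near_telegraph_def)
    have \<tau>s: "\<bar>\<tau> s - s\<bar> \<le> \<delta>" using \<tau>(3) s by auto
    have 3: "\<bar>telegraph_position b k (\<tau> s) - telegraph_position a k s\<bar> \<le> 2 * (real K + 1) * \<delta>"
      by (rule telegraph_position_close[OF close k(1) \<tau>s])
    have "\<bar>b k - a k\<bar> \<le> \<delta>" using close k by auto
    then have "\<bar>fst (z (\<tau> s)) - fst (x s)\<bar> + \<bar>fst (snd (z (\<tau> s))) -
        fst (snd (x s))\<bar> + \<bar>snd (snd (z (\<tau> s))) - snd (snd (x s))\<bar>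
       \<le> 2 * \<eta> + (2 * (real K + 1) * \<delta> + 2 * \<delta>)"
      using 1 2 3 \<tau>s by linarith
    also have "\<dots> = 2 * \<eta> + 2 * (real K + 2) * \<delta>" by (simp add: algebra_simps)
    finally show ?thesis using dist_triple_le[of "z (\<tau> s)" "x s"] r(4) by linarith
  qed
  moreover have "\<forall>s\<ge>0. \<bar>\<tau> s - s\<bar> \<le> r" using \<tau>(3) r(3) by fastforce
  ultimately show ?thesis unfolding skorohod_close_def using \<tau>(1) by blast
qed

section \<open>Paths of the chain with given sojourns\<close>

definition chain_path :: "real \<Rightarrow> (nat \<Rightarrow> real \<times> nat) \<Rightarrow> real \<Rightarrow> real \<times> real \<times> real" where
  "chain_path \<epsilon> y t = (scaled_walk \<epsilon> (\<lambda>j. fst (y j)) t, scaled_step \<epsilon> (\<lambda>j. fst (y j)) t, scaled_age \<epsilon>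
      (\<lambda>j. snd (y j)) t)"

lemma cadlag_chain_path:
  assumes e: "\<epsilon> > 0" shows "cadlag (chain_path \<epsilon> y)"
proof (rule cadlag_piecewise[where b = "\<lambda>k. real k * \<epsilon>"])
  let ?x = "\<lambda>j. fst (y j)"
  let ?c = "\<lambda>k s. (\<epsilon> * ((1 - (s / \<epsilon> - real k)) * walk ?x k + (s / \<epsilon> - real k) *
      walk ?x (k + 1)), ?x k, \<epsilon> * real (snd (y k)))"
  show "\<exists>k. T < real k * \<epsilon>" for T
  proof -
    obtain k where "T / \<epsilon> < real k" using reals_Archimedean2 by blast
    then show ?thesis using e by (auto simp: field_simps)
  qed
  show "continuous_on UNIV (?c k)" for k using e by (intro continuous_intros) auto
  fix k s assume s: "real k * \<epsilon> \<le> s" "s < real (Suc k) * \<epsilon>"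
  have fl: "\<lfloor>s / \<epsilon>\<rfloor> = int k" using s e by (intro floor_unique) (auto simp: field_simps)
  then have "frac (s / \<epsilon>) = s / \<epsilon> - real k" by (simp add: frac_def)
  then show "chain_path \<epsilon> y s = ?c k s"
    using fl by (simp add: chain_path_def scaled_walk_def scaled_step_def scaled_age_def lin_interp_def)
qed simp

text \<open>Ages start at 1, so the age after \<open>m\<close> steps into a sojourn is
  \<open>Suc m\<close>; sojourn \<open>k\<close> occupies the steps \<open>m < g k\<close>.\<close>

lemma gap_state_at:
  assumes "\<forall>i<k. g i = enat (d i) \<and> 1 \<le> d i" "enat m < g k"
  shows "gap_state g ((\<Sum>i<k. d i) + m) = (k, Suc m)"
  using assms
proof (induction k arbitrary: m)
  case (0 m)
  then show ?case
  proof (induction m)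
    case (Suc m)
    then have "enat m < g 0" using order.strict_trans[of "enat m" "enat (Suc m)"] by simp
    then show ?case using Suc by auto
  qed simp
next
  case (Suc k m)
  have base: "gap_state g (\<Sum>i<Suc k. d i) = (Suc k, 1)"
  proof -
    obtain c where dk: "g k = enat (d k)" "d k = Suc c" using Suc.prems(1) by (metis One_nat_def Suc_le_D lessI)
    then have "gap_state g ((\<Sum>i<k. d i) + (d k - 1)) = (k, Suc (d k - 1))"
      using Suc.IH[of "d k - 1"] Suc.prems(1) by simp
    moreover have "(\<Sum>i<Suc k. d i) = Suc ((\<Sum>i<k. d i) + (d k - 1))" using dk by simp
    ultimately show ?thesis using dk by simp
  qed
  show ?case
    using Suc.prems(2)
  proof (induction m)
    case 0 then show ?case using base by simp
  next
    case (Suc m)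
    then have "enat m < g (Suc k)" using order.strict_trans[of "enat m" "enat (Suc m)"] by simp
    then show ?case using Suc by auto
  qed
qed

text \<open>The walk counts the step at its current time as well, which gives \<open>m + 1\<close>
  terms of the running sojourn.\<close>

lemma walk_gap_chain_at:
  assumes "\<forall>i<k. g i = enat (d i) \<and> 1 \<le> d i" "enat m < g k"
  shows "walk (\<lambda>n. fst (gap_chain g n)) ((\<Sum>i<k. d i) + m) =
    (\<Sum>i<k. (-1) ^ i * real (d i)) + (-1) ^ k * (real m + 1)"
  using assms
proof (induction k arbitrary: m)
  case (0 m)
  then show ?case
  proof (induction m)
    case 0 then show ?case by (simp add: walk_def gap_chain_def)
  next
    case (Suc m)
    then have "enat m < g 0" using order.strict_trans[of "enat m" "enat (Suc m)"] by simp
    moreover have "gap_state g (Suc m) = (0, Suc (Suc m))" using gap_state_at[of 0 g d "Suc m"] Suc.prems by simp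
    ultimately show ?case using Suc by (simp add: walk_def gap_chain_def del: gap_state.simps)
  qed
next
  case (Suc k m)
  have g0: "enat 0 < g (Suc k)" using Suc.prems(2) by (metis gr_zeroI not_less_zero zero_enat_def)
  have base: "walk (\<lambda>n. fst (gap_chain g n)) (\<Sum>i<Suc k. d i) =
    (\<Sum>i<Suc k. (-1) ^ i * real (d i)) + (-1) ^ Suc k"
  proof -
    obtain c where dk: "g k = enat (d k)" "d k = Suc c" using Suc.prems(1) by (metis One_nat_def Suc_le_D lessI)
    then have "walk (\<lambda>n. fst (gap_chain g n)) ((\<Sum>i<k. d i) + (d k - 1)) =
      (\<Sum>i<k. (-1) ^ i * real (d i)) + (-1) ^ k * real (d k)"
      using Suc.IH[of "d k - 1"] Suc.prems(1) by (simp add: of_nat_diff)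
    moreover have "(\<Sum>i<Suc k. d i) = Suc ((\<Sum>i<k. d i) + (d k - 1))" using dk by simp
    moreover have "gap_state g (\<Sum>i<Suc k. d i) = (Suc k, 1)"
      using gap_state_at[OF Suc.prems(1) g0] by simp
    ultimately show ?thesis by (simp add: walk_def gap_chain_def del: gap_state.simps sum.lessThan_Suc) simp
  qed
  note d = Suc.prems(1)
  show ?case
    using Suc.prems(2)
  proof (induction m)
    case 0 then show ?case using base by simp
  next
    case (Suc m)
    then have "enat m < g (Suc k)" using order.strict_trans[of "enat m" "enat (Suc m)"] by simp
    moreover have "gap_state g (Suc ((\<Sum>i<Suc k. d i) + m)) = (Suc k, Suc (Suc m))"
      using gap_state_at[OF d Suc.prems] by simp
    ultimately have "walk (\<lambda>n. fst (gap_chain g n)) (Suc ((\<Sum>i<Suc k. d i) + m)) =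
        (\<Sum>i<Suc k. (-1) ^ i * real (d i)) + (-1) ^ Suc k * (real m + 1) + (-1) ^ Suc k"
      using Suc.IH by (simp add: walk_def gap_chain_def del: gap_state.simps sum.lessThan_Suc power_Suc)
    also have "\<dots> = (\<Sum>i<Suc k. (-1) ^ i * real (d i)) + (-1) ^ Suc k * (real (Suc m) + 1)"
      by (simp add: distrib_left del: sum.lessThan_Suc power_Suc)
    finally show ?case by (simp only: add_Suc_right)
  qed
qed

text \<open>The sign is constant during sojourn \<open>k\<close> and flips at the first step of the
  next one. That step exists because every sojourn has length at least 1.\<close>

lemma change_time_gap_chain:
  assumes "\<forall>i<k. g i = enat (d i) \<and> 1 \<le> d i" "\<forall>j. 1 \<le> g j"
  shows "change_time (\<lambda>n. fst (gap_chain g n)) k = enat (\<Sum>i<k. d i)"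
  using assms(1)
proof (induction k)
  case 0
  then show ?case by (simp add: zero_enat_def)
next
  case (Suc k)
  define T where "T k = (\<Sum>i<k. d i)" for k
  let ?x = "\<lambda>n. fst (gap_chain g n)"
  have IH: "change_time ?x k = enat (T k)" using Suc by (simp add: T_def)
  have dk: "g k = enat (d k)" "1 \<le> d k" "\<forall>i<k. g i = enat (d i) \<and> 1 \<le> d i" using Suc.prems by auto
  have in_gap: "?x (T k + m) = (-1) ^ k" if "m < d k" for m
    using gap_state_at[OF dk(3), of m] that dk(1) by (simp add: gap_chain_def T_def)
  have "enat 0 < g (Suc k)" using assms(2) by (metis not_one_le_zero zero_enat_def not_gr_zero)
  then have next_gap: "?x (T (Suc k)) = (-1) ^ Suc k"
    using gap_state_at[OF Suc.prems, of 0] by (simp add: gap_chain_def T_def)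
  have T_Suc: "T (Suc k) = T k + d k" by (simp add: T_def)
  have xT: "?x (T k) = (-1) ^ k" using in_gap[of 0] dk(2) by simp
  have "change_time ?x (Suc k) = Inf {enat i |i. T k \<le> i \<and> ?x i \<noteq> (-1) ^ k}"
    unfolding change_time.simps IH the_enat.simps xT by simp
  also have "\<dots> = enat (T (Suc k))"
  proof (rule antisym)
    have "(-1::real) ^ Suc k \<noteq> (-1) ^ k" by (cases "even k") auto
    then show "Inf {enat i |i. T k \<le> i \<and> ?x i \<noteq> (-1) ^ k} \<le> enat (T (Suc k))"
      using next_gap T_Suc by (intro Inf_lower) auto
    show "enat (T (Suc k)) \<le> Inf {enat i |i. T k \<le> i \<and> ?x i \<noteq> (-1) ^ k}"
    proof (rule Inf_greatest, safe)
      fix i assume i: "T k \<le> i" "?x i \<noteq> (-1) ^ k"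
      then have "\<not> i - T k < d k" using in_gap[of "i - T k"] by auto
      then show "enat (T (Suc k)) \<le> enat i" using i T_Suc by simp
    qed
  qed
  finally show ?case by (simp only: T_def)
qed

lemma scaled_gap_gap_chain:
  assumes "\<forall>i<K. g i = enat (d i) \<and> 1 \<le> d i" "\<forall>j. 1 \<le> g j" "k < K"
  shows "scaled_gap \<epsilon> (\<lambda>n. fst (gap_chain g n)) (Suc k) = ereal (\<epsilon> * real (d k))"
proof -
  have "change_time (\<lambda>n. fst (gap_chain g n)) (Suc k) = enat (\<Sum>i<Suc k. d i)"
    "change_time (\<lambda>n. fst (gap_chain g n)) k = enat (\<Sum>i<k. d i)"
    using assms by (intro change_time_gap_chain; simp)+
  then have "change_time (\<lambda>n. fst (gap_chain g n)) (Suc k) -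
      change_time (\<lambda>n. fst (gap_chain g n)) (Suc k - 1) = enat (d k)"
    by (simp only: diff_Suc_1) simp
  then show ?thesis unfolding scaled_gap_def by (simp only:) simp
qed

text \<open>Write \<open>s / \<epsilon> = T k + m + h\<close> with fractional part \<open>h\<close>.
  The walk has already counted its step at time 0, so it deviates from the continuous position by at
  most one step of size \<open>\<epsilon>\<close>; the age, which starts at 1, is ahead by
  \<open>\<epsilon> * (1 - h)\<close>.\<close>

lemma near_telegraph_chain_path:
  assumes e: "\<epsilon> > 0" and d: "\<forall>i<K. g i = enat (d i) \<and> 1 \<le> d i"
  shows "near_telegraph \<epsilon> (\<lambda>k. \<epsilon> * real (\<Sum>i<k. d i)) K (chain_path \<epsilon> (gap_chain g))"
  unfolding near_telegraph_def
proof (intro allI impI, elim conjE)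
  fix k s
  define T where "T k = (\<Sum>i<k. d i)" for k
  assume k: "k < K" and "\<epsilon> * real (\<Sum>i<k. d i) \<le> s" "s < \<epsilon> * real (\<Sum>i<Suc k. d i)"
  then have s: "\<epsilon> * real (T k) \<le> s" "s < \<epsilon> * (real (T k) + real (d k))" by (simp_all add: T_def)
  define u where "u = s / \<epsilon>"
  have su: "s = \<epsilon> * u" using e by (simp add: u_def)
  have u: "real (T k) \<le> u" "u < real (T k) + real (d k)" using s e by (simp_all add: su)
  define n where "n = nat \<lfloor>u\<rfloor>"
  define m where "m = n - T k"
  have n_eq: "real n = of_int \<lfloor>u\<rfloor>" using u by (simp add: n_def)
  have Tn: "T k \<le> n" using u(1) by (simp add: n_def le_nat_floor)
  then have nm: "n = T k + m" by (simp add: m_def)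
  define h where "h = frac u"
  have h: "0 \<le> h" "h \<le> 1" "u = real (T k) + real m + h"
    using n_eq nm frac_lt_1[of u] by (auto simp: h_def frac_def)
  have m: "m < d k" using u(2) h by linarith
  have dk: "\<forall>i<k. g i = enat (d i) \<and> 1 \<le> d i" "g k = enat (d k)" using d k by auto
  have gk: "enat m < g k" using m dk by simp
  have st: "gap_state g n = (k, Suc m)" using gap_state_at[OF dk(1) gk] by (simp add: nm T_def)
  have W: "walk (\<lambda>n. fst (gap_chain g n)) n = (\<Sum>i<k. (-1) ^ i * real (d i)) + (-1) ^ k * (real m + 1)"
    using walk_gap_chain_at[OF dk(1) gk] by (simp add: nm T_def)
  \<comment> \<open>The interpolation looks one step ahead, possibly into the next sojourn with the
    opposite sign; only the modulus of this step enters the estimate.\<close>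
  let ?x = "fst (gap_chain g (Suc n))"
  have x1: "\<bar>?x\<bar> = 1" by (auto simp: gap_chain_def split: prod.split)
  have "scaled_walk \<epsilon> (\<lambda>n. fst (gap_chain g n)) s = \<epsilon> * (walk (\<lambda>n. fst (gap_chain g n)) n + h * ?x)"
    unfolding scaled_walk_def lin_interp_def u_def[symmetric] n_def[symmetric] h_def[symmetric]
    by (simp add: walk_def algebra_simps)
  moreover have "telegraph_position (\<lambda>k. \<epsilon> * real (\<Sum>i<k. d i)) k s =
      \<epsilon> * ((\<Sum>i<k. (-1) ^ i * real (d i)) + (-1) ^ k * (real m + h))"
    unfolding telegraph_position_def su h(3) T_def
    by (simp add: algebra_simps sum_distrib_left)
  ultimately have "scaled_walk \<epsilon> (\<lambda>n. fst (gap_chain g n)) s - telegraph_position (\<lambda>k. \<epsilon> * real (\<Sum>i<k. d i)) k s =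
      \<epsilon> * ((-1) ^ k * (1 - h) + h * ?x)"
    unfolding W by (simp add: algebra_simps)
  moreover have "\<bar>(-1) ^ k * (1 - h) + h * ?x\<bar> \<le> \<bar>(-1) ^ k * (1 - h)\<bar> + \<bar>h * ?x\<bar>" by (rule abs_triangle_ineq)
  then have "\<bar>(-1) ^ k * (1 - h) + h * ?x\<bar> \<le> 1" using h x1 by (simp add: abs_mult power_abs)
  ultimately have c1: "\<bar>scaled_walk \<epsilon> (\<lambda>n. fst (gap_chain g n)) s - telegraph_position (\<lambda>k. \<epsilon> *
      real (\<Sum>i<k. d i)) k s\<bar> \<le> \<epsilon>"
    using e by (simp add: abs_mult)
  have c2: "scaled_step \<epsilon> (\<lambda>n. fst (gap_chain g n)) s = (-1) ^ k"
    unfolding scaled_step_def u_def[symmetric] n_def[symmetric] using st by (simp add: gap_chain_def)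
  have "scaled_age \<epsilon> (\<lambda>n. snd (gap_chain g n)) s = \<epsilon> * (real m + 1)"
    unfolding scaled_age_def u_def[symmetric] n_def[symmetric] using st by (simp add: gap_chain_def)
  then have "scaled_age \<epsilon> (\<lambda>n. snd (gap_chain g n)) s - (s - \<epsilon> * real (T k)) = \<epsilon> * (1 - h)"
    unfolding su h(3) by (simp add: algebra_simps)
  then have c3: "\<bar>scaled_age \<epsilon> (\<lambda>n. snd (gap_chain g n)) s - (s - \<epsilon> * real (T k))\<bar> \<le> \<epsilon>"
    using h e by (simp add: abs_mult)
  show "\<bar>fst (chain_path \<epsilon> (gap_chain g) s) - telegraph_position (\<lambda>k. \<epsilon> * real (sum d {..<k})) k s\<bar> \<le> \<epsilon> \<and>
     fst (snd (chain_path \<epsilon> (gap_chain g) s)) = (- 1) ^ k \<and>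
     \<bar>snd (snd (chain_path \<epsilon> (gap_chain g) s)) - (s - \<epsilon> * real (sum d {..<k}))\<bar> \<le> \<epsilon>"
    using c1 c2 c3 by (simp add: chain_path_def T_def)
qed

section \<open>Paths of the limit process\<close>

definition renewal_time :: "(nat \<Rightarrow> real) \<Rightarrow> nat \<Rightarrow> real" where
  "renewal_time e k = (\<Sum>j=1..k. e j)"

text \<open>The event on which the limit path is well behaved: positive waiting times whose partial
  sums do not accumulate. Integer thresholds express the latter by countably many
  conditions.\<close>

definition renewal_sequence :: "(nat \<Rightarrow> real) \<Rightarrow> bool" where
  "renewal_sequence e \<longleftrightarrow> (\<forall>j\<ge>1. e j > 0) \<and> (\<forall>n::nat. \<exists>k. real n < renewal_time e k)"

definition limit_path :: "(nat \<Rightarrow> real) \<Rightarrow> real \<Rightarrow> real \<times> real \<times> real" where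
  "limit_path e t = (integrated_telegraph e t, telegraph e t, renewal_age e t)"

lemma renewal_time_0 [simp]: "renewal_time e 0 = 0" by (simp add: renewal_time_def)

lemma renewal_time_Suc: "renewal_time e (Suc k) = renewal_time e k + e (Suc k)"
  by (simp add: renewal_time_def)

lemma renewal_time_less_Suc: "renewal_sequence e \<Longrightarrow> renewal_time e k < renewal_time e (Suc k)"
  by (simp add: renewal_time_Suc renewal_sequence_def)

lemma renewal_time_strict_mono: "renewal_sequence e \<Longrightarrow> strict_mono (renewal_time e)"
  by (simp add: strict_mono_Suc_iff renewal_time_less_Suc)

lemma renewal_time_le_iff: "renewal_sequence e \<Longrightarrow> renewal_time e j \<le> renewal_time e k \<longleftrightarrow> j \<le> k"
  by (simp add: renewal_time_strict_mono strict_mono_less_eq)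

lemma renewal_time_unbounded: "renewal_sequence e \<Longrightarrow> \<exists>k. T < renewal_time e k"
  unfolding renewal_sequence_def by (meson reals_Archimedean2 order.strict_trans)

lemma renewal_time_le_iff_le:
  assumes e: "renewal_sequence e" and t: "renewal_time e k \<le> t" "t < renewal_time e (Suc k)"
  shows "renewal_time e j \<le> t \<longleftrightarrow> j \<le> k"
proof
  assume "renewal_time e j \<le> t"
  then have "\<not> renewal_time e (Suc k) \<le> renewal_time e j" using t by linarith
  then show "j \<le> k" using renewal_time_le_iff[OF e] by simp
next
  assume "j \<le> k"
  then have "renewal_time e j \<le> renewal_time e k" using renewal_time_le_iff[OF e] by simp
  then show "renewal_time e j \<le> t" using t by simp
qed

lemma renewal_count_eq:
  assumes e: "renewal_sequence e" and t: "renewal_time e k \<le> t" "t < renewal_time e (Suc k)"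
  shows "renewal_count e t = k"
proof -
  have "renewal_count e t = (\<Sum>n. if n \<in> {..<k} then 1 else 0)"
    unfolding renewal_count_def renewal_time_def[symmetric]
    using renewal_time_le_iff_le[OF assms] by (intro suminf_cong) auto
  also have "\<dots> = (\<Sum>n\<in>{..<k}. if n \<in> {..<k} then 1 else 0)"
    by (rule suminf_finite) auto
  finally show ?thesis by simp
qed

lemma renewal_age_eq:
  assumes e: "renewal_sequence e" and t: "renewal_time e k \<le> t" "t < renewal_time e (Suc k)"
  shows "renewal_age e t = t - renewal_time e k"
proof -
  have "Sup {renewal_time e j |j. renewal_time e j \<le> t} = renewal_time e k"
    using t renewal_time_le_iff_le[OF assms] renewal_time_le_iff[OF e]
    by (intro cSup_eq_maximum) auto
  then show ?thesis by (simp add: renewal_age_def renewal_time_def)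
qed

text \<open>The value at the right end, where the telegraph path jumps, is left open; a single point
  does not affect the integral.\<close>

lemma set_integral_const_Ioc:
  fixes z :: "real \<Rightarrow> real"
  assumes pq: "p \<le> q" and z: "\<And>s. p < s \<Longrightarrow> s < q \<Longrightarrow> z s = c"
  shows "set_integrable lborel {p<..q} z \<and> (LBINT s:{p<..q}. z s) = c * (q - p)"
proof (cases "p = q")
  case True
  then show ?thesis by (simp add: set_integrable_def set_lebesgue_integral_def)
next
  case False
  have eq: "(\<lambda>s. indicator {p<..q} s *\<^sub>R z s) = (\<lambda>s. indicator {p<..<q} s * c + indicator {q} s * z q)"
    using z pq False by (auto simp: fun_eq_iff indicator_def)
  have i1: "integrable lborel (\<lambda>s. indicator {p<..<q} s * c)"
    using pq by (intro integrable_mult_left integrable_real_indicator) auto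
  have i2: "integrable lborel (\<lambda>s. indicator {q} s * z q)"
    by (intro integrable_mult_left integrable_real_indicator) auto
  have "set_integrable lborel {p<..q} z" unfolding set_integrable_def eq using i1 i2 by simp
  moreover have "(LBINT s:{p<..q}. z s) = c * (q - p)"
    unfolding set_lebesgue_integral_def eq using i1 i2 pq by simp
  ultimately show ?thesis ..
qed

lemma telegraph_eq:
  assumes "renewal_sequence e" "renewal_time e k \<le> t" "t < renewal_time e (Suc k)"
  shows "telegraph e t = (-1) ^ k"
  using renewal_count_eq[OF assms] by (simp add: telegraph_def)

lemma renewal_time_nonneg: "renewal_sequence e \<Longrightarrow> 0 \<le> renewal_time e k"
  using renewal_time_le_iff[of e 0 k] by simp

lemma set_integral_Icc_join:
  fixes z :: "real \<Rightarrow> real"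
  assumes "0 \<le> p" "p \<le> q" and "set_integrable lborel {0..p} z" "set_integrable lborel {p<..q} z"
  shows "set_integrable lborel {0..q} z \<and> (LBINT s:{0..q}. z s) = (LBINT s:{0..p}. z s) + (LBINT s:{p<..q}. z s)"
proof -
  have "{0..q} = {0..p} \<union> {p<..q}" using assms by auto
  then show ?thesis using assms(3,4)
    by (simp only:) (intro conjI set_integral_Un set_integrable_Un; auto)
qed

lemma integrated_telegraph_eq:
  assumes e: "renewal_sequence e" and t: "renewal_time e k \<le> t" "t < renewal_time e (Suc k)"
  shows "integrated_telegraph e t = telegraph_position (renewal_time e) k t"
proof -
  have piece: "set_integrable lborel {renewal_time e k<..s} (telegraph e) \<and>
      (LBINT s:{renewal_time e k<..s}. telegraph e s) = (-1) ^ k * (s - renewal_time e k)"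
    if "renewal_time e k \<le> s" "s \<le> renewal_time e (Suc k)" for k s
    using that by (intro set_integral_const_Ioc) (auto intro!: telegraph_eq[OF e])
  have start: "set_integrable lborel {0..renewal_time e k} (telegraph e) \<and>
      (LBINT s:{0..renewal_time e k}. telegraph e s) =
        (\<Sum>i<k. (-1) ^ i * (renewal_time e (Suc i) - renewal_time e i))" for k
  proof (induction k)
    case 0
    have "(\<lambda>x. indicator {0} x *\<^sub>R telegraph e x) = (\<lambda>x::real. indicator {0} x * telegraph e 0)"
      by (auto simp: indicator_def)
    then show ?case by (simp add: set_integrable_def set_lebesgue_integral_def)
  next
    case (Suc k)
    have le: "renewal_time e k \<le> renewal_time e (Suc k)" using renewal_time_less_Suc[OF e, of k] by simp
    show ?case
      using set_integral_Icc_join[OF renewal_time_nonneg[OF e] le, of "telegraph e"] Suc piece[OF le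
          order_refl] by simp
  qed
  show ?thesis
    using set_integral_Icc_join[OF renewal_time_nonneg[OF e] t(1), of "telegraph e"] start[of k] piece[OF t(1)] t(2)
    by (simp add: integrated_telegraph_def telegraph_position_def)
qed

lemma limit_path_eq:
  assumes e: "renewal_sequence e" and t: "renewal_time e k \<le> t" "t < renewal_time e (Suc k)"
  shows "limit_path e t = (telegraph_position (renewal_time e) k t, (-1) ^ k, t - renewal_time e k)"
  using integrated_telegraph_eq[OF assms] telegraph_eq[OF assms] renewal_age_eq[OF assms]
  by (simp add: limit_path_def)

lemma near_telegraph_limit_path:
  "renewal_sequence e \<Longrightarrow> near_telegraph 0 (renewal_time e) K (limit_path e)"
  unfolding near_telegraph_def by (auto simp: limit_path_eq)

lemma cadlag_limit_path:
  assumes e: "renewal_sequence e" shows "cadlag (limit_path e)"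
proof (rule cadlag_piecewise[where b = "renewal_time e"])
  show "\<exists>k. T < renewal_time e k" for T by (rule renewal_time_unbounded[OF e])
  show "continuous_on UNIV (\<lambda>t. (telegraph_position (renewal_time e) k t, (-1) ^ k :: real, t -
      renewal_time e k))" for k
    unfolding telegraph_position_def by (intro continuous_intros)
qed (simp_all add: limit_path_eq[OF e])

lemma renewal_time_dist:
  assumes "\<forall>j\<in>{1..K}. \<bar>e' j - e j\<bar> \<le> \<delta>" "k \<le> K" "0 \<le> \<delta>"
  shows "\<bar>renewal_time e' k - renewal_time e k\<bar> \<le> real K * \<delta>"
proof -
  have "\<bar>renewal_time e' k - renewal_time e k\<bar> \<le> (\<Sum>j=1..k. \<bar>e' j - e j\<bar>)"
    unfolding renewal_time_def sum_subtractf[symmetric] by (rule sum_abs)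
  also have "\<dots> \<le> (\<Sum>j=1..k. \<delta>)" using assms by (intro sum_mono) auto
  also have "\<dots> \<le> real K * \<delta>" using assms by (simp add: mult_right_mono)
  finally show ?thesis .
qed

text \<open>Continuity of \<open>limit_path\<close> at renewal sequences, with a neighbourhood that
  restricts finitely many coordinates; it is what makes the limit path a random element.\<close>

lemma limit_path_locally_close:
  assumes e: "renewal_sequence e" and r: "0 < r"
  obtains K \<delta> where "0 < \<delta>" "\<And>e'. renewal_sequence e' \<Longrightarrow> \<forall>j\<in>{1..K}. \<bar>e' j - e j\<bar> \<le> \<delta> \<Longrightarrow>
      skorohod_close r (limit_path e) (limit_path e')"
proof -
  obtain K where K: "1 / r < renewal_time e K" using renewal_time_unbounded[OF e] by blast
  \<comment> \<open>This uses up the error budget of \<open>near_telegraph_skorohod_close\<close>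
    with \<open>\<eta> = 0\<close>. A renewal time adds up to \<open>K\<close> deviations of waiting
    times, hence the further division below.\<close>
  define \<delta>0 where "\<delta>0 = r / (2 * (real K + 2))"
  define \<delta> where "\<delta> = \<delta>0 / (real K + 1)"
  have d0: "0 < \<delta>0" "\<delta>0 \<le> r" "2 * (real K + 2) * \<delta>0 = r"
    using r by (auto simp: \<delta>0_def field_simps)
  have d: "0 < \<delta>" "real K * \<delta> \<le> \<delta>0" using d0 by (auto simp: \<delta>_def field_simps)
  show ?thesis
  proof (rule that[OF d(1)])
    fix e' assume e': "renewal_sequence e'" and "\<forall>j\<in>{1..K}. \<bar>e' j - e j\<bar> \<le> \<delta>"
    then have "\<bar>renewal_time e' k - renewal_time e k\<bar> \<le> \<delta>0" if "k \<le> K" for k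
      using renewal_time_dist[of K e' e \<delta> k] that d by linarith
    then show "skorohod_close r (limit_path e) (limit_path e')"
      using r d0 K
      by (intro near_telegraph_skorohod_close[OF near_telegraph_limit_path[OF e, of K]
          near_telegraph_limit_path[OF e'], of \<delta>0])
         (auto simp: renewal_time_less_Suc[OF e] renewal_time_less_Suc[OF e'])
  qed
qed

text \<open>The deterministic core of the coupling: closeness of finitely many rescaled sojourns
  forces closeness of whole paths.\<close>

lemma limit_path_chain_path_close:
  assumes e: "renewal_sequence e" and r: "0 < r"
  obtains K \<delta> where "0 < \<delta>" "\<And>\<epsilon> g d. 0 < \<epsilon> \<Longrightarrow> \<epsilon> \<le> r / 4 \<Longrightarrow> \<forall>i<K. g i = enat (d i) \<and> 1 \<le> d i \<and>
      \<bar>\<epsilon> * real (d i) - e (Suc i)\<bar> \<le> \<delta> \<Longrightarrow>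
    skorohod_close r (limit_path e) (chain_path \<epsilon> (gap_chain g))"
proof -
  obtain K where K: "1 / r < renewal_time e K" using renewal_time_unbounded[OF e] by blast
  \<comment> \<open>Half of \<open>r\<close> pays for the displaced breakpoints; the other half
    absorbs \<open>2 * \<eta> = 2 * \<epsilon> \<le> r / 2\<close>.\<close>
  define \<delta>0 where "\<delta>0 = r / (4 * (real K + 2))"
  define \<delta> where "\<delta> = \<delta>0 / (real K + 1)"
  have d0: "0 < \<delta>0" "\<delta>0 \<le> r" "2 * (real K + 2) * \<delta>0 = r / 2"
    using r by (auto simp: \<delta>0_def field_simps)
  have d: "0 < \<delta>" "real K * \<delta> \<le> \<delta>0" using d0 by (auto simp: \<delta>_def field_simps)
  show ?thesis
  proof (rule that[OF d(1)])
    fix \<epsilon> g d assume eps: "0 < \<epsilon>" "\<epsilon> \<le> r / 4"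
      and g: "\<forall>i<K. g i = enat (d i) \<and> 1 \<le> d i \<and> \<bar>\<epsilon> * real (d i) - e (Suc i)\<bar> \<le> \<delta>"
    let ?b = "\<lambda>k. \<epsilon> * real (\<Sum>i<k. d i)"
    \<comment> \<open>Sojourns are numbered from 0 and waiting times from 1; after the shift
      \<open>renewal_time_dist\<close> compares both sets of breakpoints.\<close>
    have b: "?b k = renewal_time (\<lambda>j. \<epsilon> * real (d (j - 1))) k" for k
      by (induction k) (simp_all add: renewal_time_Suc distrib_left)
    have "\<forall>j\<in>{1..K}. \<bar>\<epsilon> * real (d (j - 1)) - e j\<bar> \<le> \<delta>"
    proof
      fix j assume "j \<in> {1..K}"
      then show "\<bar>\<epsilon> * real (d (j - 1)) - e j\<bar> \<le> \<delta>" using g by (cases j) auto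
    qed
    then have cl: "\<bar>?b k - renewal_time e k\<bar> \<le> \<delta>0" if "k \<le> K" for k
      unfolding b using renewal_time_dist[of K "\<lambda>j. \<epsilon> * real (d (j - 1))" e \<delta> k] that d by linarith
    have "\<forall>i<K. g i = enat (d i) \<and> 1 \<le> d i" using g by auto
    from near_telegraph_chain_path[OF eps(1) this]
    show "skorohod_close r (limit_path e) (chain_path \<epsilon> (gap_chain g))"
    proof (rule near_telegraph_skorohod_close[OF near_telegraph_limit_path[OF e]])
      show "\<forall>k<K. renewal_time e k < renewal_time e (Suc k) \<and> ?b k < ?b (Suc k)"
        using renewal_time_less_Suc[OF e] g eps by (auto simp: distrib_left)
      show "\<forall>k\<le>K. \<bar>?b k - renewal_time e k\<bar> \<le> \<delta>0" using cl by blast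
      show "2 * \<epsilon> + 2 * (real K + 2) * \<delta>0 \<le> r" using d0 eps by linarith
    qed (use r K d0 in auto)
  qed
qed

section \<open>Convergence in distribution through a coupling\<close>

lemma (in prob_space) indep_vars_reindex:
  assumes f: "inj_on f I" and ind: "indep_vars M' X (f ` I)"
  shows "indep_vars (\<lambda>i. M' (f i)) (\<lambda>i. X (f i)) I"
  unfolding indep_vars_def2
proof (intro conjI ballI)
  fix i assume "i \<in> I" then show "random_variable (M' (f i)) (X (f i))" using ind by (auto simp: indep_vars_def2)
next
  let ?F = "\<lambda>i. {X i -` A \<inter> space M |A. A \<in> sets (M' i)}"
  have F: "indep_sets ?F (f ` I)" using ind by (simp add: indep_vars_def2)
  show "indep_sets (\<lambda>i. ?F (f i)) I"
  proof (rule indep_setsI)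
    fix i assume "i \<in> I" then show "?F (f i) \<subseteq> events" using F by (auto simp: indep_sets_def)
  next
    fix A J assume J: "J \<noteq> {}" "J \<subseteq> I" "finite J" "\<forall>j\<in>J. A j \<in> ?F (f j)"
    have inj: "inj_on f J" using f J by (meson inj_on_subset)
    have inv: "inv_into J f (f j) = j" if "j \<in> J" for j using inj that by (rule inv_into_f_f)
    have "prob (\<Inter>k\<in>f ` J. A (inv_into J f k)) = (\<Prod>k\<in>f ` J. prob (A (inv_into J f k)))"
      using J by (intro indep_setsD[OF F]) (auto simp: inv)
    moreover have "(\<Inter>k\<in>f ` J. A (inv_into J f k)) = (\<Inter>j\<in>J. A j)" using inv by auto
    moreover have "(\<Prod>k\<in>f ` J. prob (A (inv_into J f k))) = (\<Prod>j\<in>J. prob (A j))"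
      using inv by (simp add: prod.reindex[OF inj])
    ultimately show "prob (\<Inter>j\<in>J. A j) = (\<Prod>j\<in>J. prob (A j))" by simp
  qed
qed

lemma sets_completion_AE:
  assumes "AE \<omega> in M. P \<omega> \<longleftrightarrow> Q \<omega>" "{\<omega>\<in>space M. Q \<omega>} \<in> sets M"
  shows "{\<omega>\<in>space M. P \<omega>} \<in> sets (completion M)"
proof (rule complete_measure.in_sets_AE)
  show "complete_measure (completion M)" by (rule completion.complete_measure_axioms)
  show "AE \<omega> in completion M. \<omega> \<in> {\<omega>\<in>space M. Q \<omega>} \<longleftrightarrow> \<omega> \<in> {\<omega>\<in>space M. P \<omega>}"
    using assms(1) by (intro AE_completion) auto
  show "{\<omega>\<in>space M. Q \<omega>} \<in> sets (completion M)" using assms(2) by (rule sets_completionI_sets)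
qed auto

text \<open>Continuity controls \<open>\<phi>\<close> only on the space itself, which
  \<open>Z\<close> may leave on a null set; completeness repairs the preimages.\<close>

lemma random_element_continuous_compose:
  assumes Z: "random_element T M Z" and \<phi>: "continuous_map T euclideanreal \<phi>"
  shows "(\<lambda>\<omega>. \<phi> (Z \<omega>)) \<in> borel_measurable (completion M)"
proof (rule borel_measurableI)
  fix S :: "real set" assume "open S"
  then have "openin T {x \<in> topspace T. \<phi> x \<in> S}"
    using \<phi> by (auto simp: continuous_map)
  then have "{\<omega>\<in>space M. Z \<omega> \<in> {x \<in> topspace T. \<phi> x \<in> S}} \<in> sets (completion M)"
    using Z unfolding random_element_def by blast
  then have 1: "{\<omega>\<in>space (completion M). Z \<omega> \<in> {x \<in> topspace T. \<phi> x \<in> S}} \<in> sets (completion M)" by simp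
  have "{\<omega>\<in>space (completion M). \<phi> (Z \<omega>) \<in> S} \<in> sets (completion M)"
  proof (rule completion.in_sets_AE[OF _ 1])
    have "AE \<omega> in completion M. Z \<omega> \<in> topspace T"
      using Z by (intro AE_completion) (simp add: random_element_def)
    then show "AE \<omega> in completion M. \<omega> \<in> {\<omega>\<in>space (completion M). Z \<omega> \<in> {x \<in> topspace T. \<phi> x \<in> S}} \<longleftrightarrow>
        \<omega> \<in> {\<omega>\<in>space (completion M). \<phi> (Z \<omega>) \<in> S}"
      by eventually_elim auto
  qed auto
  then show "(\<lambda>\<omega>. \<phi> (Z \<omega>)) -` S \<inter> space (completion M) \<in> sets (completion M)"
    by (simp add: vimage_def Int_def conj_commute)
qed

text \<open>All paths are images of sequences in \<open>S\<close>, and \<open>Y\<close>,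
  \<open>Y'\<close> have the same law there, so the expectations can be computed on
  \<open>M\<close>. On \<open>M\<close> the images converge almost surely, and bounded convergence
  finishes. As that theorem is sequential, the limit at \<open>0+\<close> is first reduced to
  sequences.\<close>

lemma conv_in_distribution_coupling:
  assumes M: "prob_space M" and e0: "\<epsilon>0 > (0::real)"
    and rv: "\<And>\<epsilon>. \<epsilon> \<in> {0<..<\<epsilon>0} \<Longrightarrow> Y \<epsilon> \<in> P \<epsilon> \<rightarrow>\<^sub>M S" "\<And>\<epsilon>. \<epsilon> \<in> {0<..<\<epsilon>0} \<Longrightarrow> Y' \<epsilon> \<in> M \<rightarrow>\<^sub>M S"
    and law: "\<And>\<epsilon>. \<epsilon> \<in> {0<..<\<epsilon>0} \<Longrightarrow> distr (P \<epsilon>) S (Y \<epsilon>) = distr M S (Y' \<epsilon>)"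
    and \<Psi>: "\<And>\<epsilon> y. \<epsilon> \<in> {0<..<\<epsilon>0} \<Longrightarrow> y \<in> space S \<Longrightarrow> \<Psi> \<epsilon> y \<in> topspace T"
      "\<And>\<epsilon> U. \<epsilon> \<in> {0<..<\<epsilon>0} \<Longrightarrow> openin T U \<Longrightarrow> {y\<in>space S. \<Psi> \<epsilon> y \<in> U} \<in> sets S"
    and Z0: "random_element T M Z0"
    and lim: "AE \<omega> in M. limitin T (\<lambda>\<epsilon>. \<Psi> \<epsilon> (Y' \<epsilon> \<omega>)) (Z0 \<omega>) (at_right 0)"
  shows "conv_in_distribution T P (\<lambda>\<epsilon> \<omega>. \<Psi> \<epsilon> (Y \<epsilon> \<omega>)) M Z0 (at_right 0)"
  unfolding conv_in_distribution_def
proof (intro conjI allI impI)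
  interpret M: prob_space M by (rule M)
  have ev: "\<forall>\<^sub>F \<epsilon> in at_right 0. \<epsilon> \<in> {0<..<\<epsilon>0}" using e0 by (rule eventually_at_right_real)
  have re: "random_element T N (\<lambda>\<omega>. \<Psi> \<epsilon> (V \<omega>))" if "\<epsilon> \<in> {0<..<\<epsilon>0}" "V \<in> N \<rightarrow>\<^sub>M S"
    for \<epsilon> V and N :: "'x measure"
    unfolding random_element_def
  proof (intro conjI allI impI)
    show "AE \<omega> in N. \<Psi> \<epsilon> (V \<omega>) \<in> topspace T"
      using \<Psi>(1)[OF that(1)] measurable_space[OF that(2)] by (intro AE_I2) auto
    fix U assume "openin T U"
    then have "V -` {y\<in>space S. \<Psi> \<epsilon> y \<in> U} \<inter> space N \<in> sets N"
      using that by (intro measurable_sets[OF that(2)] \<Psi>(2))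
    moreover have "V -` {y\<in>space S. \<Psi> \<epsilon> y \<in> U} \<inter> space N = {\<omega>\<in>space N. \<Psi> \<epsilon> (V \<omega>) \<in> U}"
      using measurable_space[OF that(2)] by auto
    ultimately show "{\<omega>\<in>space N. \<Psi> \<epsilon> (V \<omega>) \<in> U} \<in> sets (completion N)"
      by (intro sets_completionI_sets) simp
  qed
  show "\<forall>\<^sub>F \<epsilon> in at_right 0. random_element T (P \<epsilon>) (\<lambda>\<omega>. \<Psi> \<epsilon> (Y \<epsilon> \<omega>))"
    using ev by eventually_elim (rule re[OF _ rv(1)])
  show "random_element T M Z0" by (rule Z0)
  fix \<phi> assume \<phi>: "continuous_map T euclideanreal \<phi> \<and> bounded (\<phi> ` topspace T)"
  then obtain B where B: "\<And>x. x \<in> topspace T \<Longrightarrow> \<bar>\<phi> x\<bar> \<le> B" by (auto simp: bounded_iff)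
  have meas: "(\<lambda>y. \<phi> (\<Psi> \<epsilon> y)) \<in> borel_measurable S" if e: "\<epsilon> \<in> {0<..<\<epsilon>0}" for \<epsilon>
  proof (rule borel_measurableI)
    fix U :: "real set" assume "open U"
    then have "openin T {x \<in> topspace T. \<phi> x \<in> U}" using \<phi> by (auto simp: continuous_map)
    then have "{y\<in>space S. \<Psi> \<epsilon> y \<in> {x \<in> topspace T. \<phi> x \<in> U}} \<in> sets S" by (rule \<Psi>(2)[OF e])
    moreover have "{y\<in>space S. \<Psi> \<epsilon> y \<in> {x \<in> topspace T. \<phi> x \<in> U}} = (\<lambda>y. \<phi> (\<Psi> \<epsilon> y)) -` U \<inter> space S"
      using \<Psi>(1)[OF e] by auto
    ultimately show "(\<lambda>y. \<phi> (\<Psi> \<epsilon> y)) -` U \<inter> space S \<in> sets S" by simp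
  qed
  have eq: "(\<integral>\<omega>. \<phi> (\<Psi> \<epsilon> (Y \<epsilon> \<omega>)) \<partial>completion (P \<epsilon>)) = (\<integral>\<omega>. \<phi> (\<Psi> \<epsilon> (Y' \<epsilon> \<omega>)) \<partial>completion M)"
    if e: "\<epsilon> \<in> {0<..<\<epsilon>0}" for \<epsilon>
  proof -
    have "(\<integral>\<omega>. \<phi> (\<Psi> \<epsilon> (Y \<epsilon> \<omega>)) \<partial>completion (P \<epsilon>)) = (\<integral>\<omega>. \<phi> (\<Psi> \<epsilon> (Y \<epsilon> \<omega>)) \<partial>P \<epsilon>)"
      by (rule integral_completion) (rule measurable_compose[OF rv(1)[OF e] meas[OF e]])
    also have "\<dots> = (\<integral>y. \<phi> (\<Psi> \<epsilon> y) \<partial>distr (P \<epsilon>) S (Y \<epsilon>))"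
      by (rule integral_distr[OF rv(1)[OF e] meas[OF e], symmetric])
    also have "\<dots> = (\<integral>y. \<phi> (\<Psi> \<epsilon> y) \<partial>distr M S (Y' \<epsilon>))" unfolding law[OF e] ..
    also have "\<dots> = (\<integral>\<omega>. \<phi> (\<Psi> \<epsilon> (Y' \<epsilon> \<omega>)) \<partial>M)"
      by (rule integral_distr[OF rv(2)[OF e] meas[OF e]])
    also have "\<dots> = (\<integral>\<omega>. \<phi> (\<Psi> \<epsilon> (Y' \<epsilon> \<omega>)) \<partial>completion M)"
      by (rule integral_completion[symmetric]) (rule measurable_compose[OF rv(2)[OF e] meas[OF e]])
    finally show ?thesis .
  qed
  show "((\<lambda>\<epsilon>. \<integral>\<omega>. \<phi> (\<Psi> \<epsilon> (Y \<epsilon> \<omega>)) \<partial>completion (P \<epsilon>)) \<longlongrightarrow> (\<integral>\<omega>. \<phi> (Z0 \<omega>) \<partial>completion M)) (at_right 0)"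
  proof (rule tendsto_at_right_sequentially[OF e0])
    fix s :: "nat \<Rightarrow> real" assume s: "\<And>n. 0 < s n" "\<And>n. s n < \<epsilon>0" "decseq s" "s \<longlonglongrightarrow> 0"
    then have sr: "s n \<in> {0<..<\<epsilon>0}" for n by simp
    have right: "filterlim s (at_right 0) sequentially"
      by (rule filterlim_at_right_0[OF s(1,4)])
    have "(\<lambda>n. \<integral>\<omega>. \<phi> (\<Psi> (s n) (Y' (s n) \<omega>)) \<partial>completion M) \<longlonglongrightarrow> (\<integral>\<omega>. \<phi> (Z0 \<omega>) \<partial>completion M)"
    proof (rule integral_dominated_convergence[where w = "\<lambda>_. B"])
      show "(\<lambda>\<omega>. \<phi> (Z0 \<omega>)) \<in> borel_measurable (completion M)"
        using random_element_continuous_compose[OF Z0] \<phi> by blast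
      show "(\<lambda>\<omega>. \<phi> (\<Psi> (s n) (Y' (s n) \<omega>))) \<in> borel_measurable (completion M)" for n
        using random_element_continuous_compose[OF re[OF sr[of n] rv(2)[OF sr[of n]]]] \<phi> by blast
      show "integrable (completion M) (\<lambda>_. B)"
        using M.prob_space_completion by (simp add: prob_space_def finite_measure.integrable_const)
      show "AE \<omega> in completion M. norm (\<phi> (\<Psi> (s n) (Y' (s n) \<omega>))) \<le> B" for n
        using B \<Psi>(1)[OF sr[of n]] measurable_space[OF rv(2)[OF sr[of n]]] by (intro AE_I2) auto
      show "AE \<omega> in completion M. (\<lambda>n. \<phi> (\<Psi> (s n) (Y' (s n) \<omega>))) \<longlonglongrightarrow> \<phi> (Z0 \<omega>)"
        using AE_completion[OF lim]
      proof eventually_elim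
        case (elim \<omega>)
        have "limitin euclideanreal (\<phi> \<circ> (\<lambda>\<epsilon>. \<Psi> \<epsilon> (Y' \<epsilon> \<omega>))) (\<phi> (Z0 \<omega>)) (at_right 0)"
          using \<phi> elim by (intro continuous_map_limit) auto
        then have "((\<lambda>\<epsilon>. \<phi> (\<Psi> \<epsilon> (Y' \<epsilon> \<omega>))) \<longlongrightarrow> \<phi> (Z0 \<omega>)) (at_right 0)" by (simp add: o_def)
        from filterlim_compose[OF this right] show ?case .
      qed
    qed
    then show "(\<lambda>n. \<integral>\<omega>. \<phi> (\<Psi> (s n) (Y (s n) \<omega>)) \<partial>completion (P (s n))) \<longlonglongrightarrow> (\<integral>\<omega>. \<phi> (Z0 \<omega>) \<partial>completion M)"
      unfolding eq[OF sr] .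
  qed
qed

text \<open>Such a set is open for the product of discrete topologies, hence a union of cylinders;
  cylinders are indexed by finite lists over a countable set, so the union is countable.\<close>

lemma sets_PiM_locally_determined:
  assumes E: "countable E" and W: "W \<subseteq> space (PiM UNIV (\<lambda>_::nat. count_space E))"
    and loc: "\<And>y. y \<in> W \<Longrightarrow> \<exists>n. \<forall>y'\<in>space (PiM UNIV (\<lambda>_. count_space E)). (\<forall>k\<le>n. y' k = y k) \<longrightarrow> y' \<in> W"
  shows "W \<in> sets (PiM UNIV (\<lambda>_::nat. count_space E))"
proof -
  let ?S = "PiM UNIV (\<lambda>_::nat. count_space E)"
  define C where "C l = {y\<in>space ?S. \<forall>k<length l. y k = l ! k}" for l
  have C: "C l \<in> sets ?S" if "l \<in> lists E" for l
  proof -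
    have "C l = {y\<in>space ?S. \<forall>k\<in>{..<length l}. y k = l ! k}" by (auto simp: C_def)
    also have "\<dots> \<in> sets ?S"
    proof (rule sets.sets_Collect_finite_All)
      fix k assume "k \<in> {..<length l}"
      then have "l ! k \<in> E" using that by auto
      have "(\<lambda>y. y k) -` {l ! k} \<inter> space ?S \<in> sets ?S"
        using \<open>l ! k \<in> E\<close> by (intro measurable_sets[OF measurable_component_singleton]) auto
      moreover have "(\<lambda>y. y k) -` {l ! k} \<inter> space ?S = {y\<in>space ?S. y k = l ! k}" by auto
      ultimately show "{y\<in>space ?S. y k = l ! k} \<in> sets ?S" by simp
    qed simp
    finally show ?thesis .
  qed
  have "W = (\<Union>l\<in>{l\<in>lists E. C l \<subseteq> W}. C l)"
  proof (intro set_eqI iffI)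
    fix y assume y: "y \<in> W"
    then obtain n where n: "\<And>y'. y' \<in> space ?S \<Longrightarrow> (\<forall>k\<le>n. y' k = y k) \<Longrightarrow> y' \<in> W" using loc by blast
    let ?l = "map y [0..<Suc n]"
    have "y k \<in> E" for k using y W by (auto simp: space_PiM PiE_iff)
    then have "?l \<in> lists E" by (auto simp del: upt_Suc)
    moreover have "C ?l \<subseteq> W"
      unfolding C_def using n by (auto simp: less_Suc_eq_le simp del: upt_Suc)
    moreover have "y \<in> C ?l" using y W by (auto simp: C_def simp del: upt_Suc)
    ultimately show "y \<in> (\<Union>l\<in>{l\<in>lists E. C l \<subseteq> W}. C l)" by blast
  qed blast
  also have "\<dots> \<in> sets ?S"
    using C countable_lists[OF E] by (intro sets.countable_UN') (auto intro: countable_subset[of _ "lists E"])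
  finally show ?thesis .
qed

section \<open>Measurability of the functionals of the chain\<close>

lemma countable_prw_states: "countable prw_states"
  unfolding prw_states_def by auto

abbreviation prw_paths :: "(nat \<Rightarrow> real \<times> nat) measure" where
  "prw_paths \<equiv> PiM UNIV (\<lambda>_::nat. count_space prw_states)"

text \<open>Linear interpolation at \<open>s\<close> also reads index
  \<open>floor (s / \<epsilon>) + 1\<close>, which is still at most \<open>n\<close>.\<close>

lemma chain_path_cong:
  assumes e: "\<epsilon> > 0" and s: "0 \<le> s" "s < real n * \<epsilon>" and eq: "\<forall>k\<le>n. y' k = y k"
  shows "chain_path \<epsilon> y' s = chain_path \<epsilon> y s"
proof -
  have "nat \<lfloor>s / \<epsilon>\<rfloor> + 1 \<le> n" 
  proof -
    have "s / \<epsilon> < real n" using s e by (simp add: pos_divide_less_eq)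
    then have "\<lfloor>s / \<epsilon>\<rfloor> < int n" by (simp add: floor_less_iff)
    moreover have "0 \<le> \<lfloor>s / \<epsilon>\<rfloor>" using s e by simp
    ultimately show ?thesis by linarith
  qed
  moreover have "walk (\<lambda>j. fst (y' j)) m = walk (\<lambda>j. fst (y j)) m" if "m \<le> n" for m
    unfolding walk_def using eq that by (intro sum.cong) auto
  ultimately show ?thesis
    using eq by (simp add: chain_path_def scaled_walk_def scaled_step_def scaled_age_def lin_interp_def)
qed

text \<open>A neighbourhood of radius \<open>r\<close> inspects the path on \<open>[0, 1/r]\<close>
  only, and there the path depends on finitely many states. With the identity as time change,
  membership in an open set is therefore locally determined.\<close>

lemma sets_chain_path:
  assumes e: "\<epsilon> > 0" and U: "openin skorohod_topology U"
  shows "{y\<in>space prw_paths. chain_path \<epsilon> y \<in> U} \<in> sets prw_paths"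
proof (rule sets_PiM_locally_determined[OF countable_prw_states])
  fix y assume "y \<in> {y\<in>space prw_paths. chain_path \<epsilon> y \<in> U}"
  then obtain r where r: "r > 0" "\<And>z. cadlag z \<Longrightarrow> skorohod_close r (chain_path \<epsilon> y) z \<Longrightarrow> z \<in> U"
    using U by (auto simp: openin_skorohod)
  obtain n where n: "1 / r / \<epsilon> < real n" using reals_Archimedean2 by blast
  have "chain_path \<epsilon> y' \<in> U" if eq: "\<forall>k\<le>n. y' k = y k" for y'
  proof (rule r(2)[OF cadlag_chain_path[OF e]])
    have "chain_path \<epsilon> y' s = chain_path \<epsilon> y s" if "s \<in> {0..1/r}" for s
    proof (rule chain_path_cong[OF e _ _ eq])
      have "1 / r < real n * \<epsilon>" using n e by (simp only: pos_divide_less_eq)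
      then show "0 \<le> s" "s < real n * \<epsilon>" using that by auto
    qed
    then show "skorohod_close r (chain_path \<epsilon> y) (chain_path \<epsilon> y')"
      unfolding skorohod_close_def using r(1) time_change_id by (intro exI[of _ "\<lambda>s. s"]) auto
  qed
  then show "\<exists>n. \<forall>y'\<in>space prw_paths. (\<forall>k\<le>n. y' k = y k) \<longrightarrow> y' \<in> {y\<in>space prw_paths. chain_path \<epsilon> y \<in> U}"
    by blast
qed auto

lemma Inf_enat_eq_iff: "Inf {enat i |i. P i} = enat c \<longleftrightarrow> P c \<and> (\<forall>i. P i \<longrightarrow> c \<le> i)"
proof (cases "\<exists>i. P i")
  case True
  have "Inf {enat i |i. P i} = enat (LEAST i. P i)"
  proof (rule antisym)
    show "Inf {enat i |i. P i} \<le> enat (LEAST i. P i)"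
      using LeastI_ex[OF True] by (intro Inf_lower) auto
    show "enat (LEAST i. P i) \<le> Inf {enat i |i. P i}"
      by (intro Inf_greatest) (auto intro: Least_le)
  qed
  moreover have "(LEAST i. P i) = c \<longleftrightarrow> P c \<and> (\<forall>i. P i \<longrightarrow> c \<le> i)"
    using LeastI_ex[OF True] Least_le[of P] Least_equality[of P c] by (metis order_refl)
  ultimately show ?thesis by simp
qed (auto simp: Inf_enat_def)

text \<open>A finite change time is a stopping time: its value \<open>c\<close> can be read off from
  the states up to \<open>c\<close>.\<close>

lemma change_time_determined:
  "change_time x k = enat c \<Longrightarrow> (\<forall>j\<le>c. x' j = x j) \<Longrightarrow> change_time x' k = enat c"
proof (induction k arbitrary: c)
  case (Suc k)
  have c: "change_time x k \<le> enat c" "x c \<noteq> x (the_enat (change_time x k))"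
    "\<And>i. change_time x k \<le> enat i \<Longrightarrow> x i \<noteq> x (the_enat (change_time x k)) \<Longrightarrow> c \<le> i"
    using Suc.prems(1) unfolding change_time.simps Inf_enat_eq_iff by blast+
  then obtain b where b: "change_time x k = enat b" "b \<le> c" by (cases "change_time x k") auto
  then have b': "change_time x' k = enat b" using Suc by simp
  have "x' c \<noteq> x' b" using Suc.prems(2) b c(2) by simp
  moreover have "c \<le> i" if "b \<le> i" "x' i \<noteq> x' b" for i
    using Suc.prems(2) b c(3)[of i] that by (cases "i \<le> c") auto
  ultimately show ?case
    unfolding change_time.simps Inf_enat_eq_iff b' using b(2) by simp
qed simp

text \<open>Finite values are locally determined. The value infinity is not decided by any prefix
  and is treated as the complement.\<close>

lemma measurable_change_time:
  "(\<lambda>y. change_time (\<lambda>j. fst (y j)) k) \<in> prw_paths \<rightarrow>\<^sub>M count_space UNIV"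
proof -
  let ?T = "\<lambda>y. change_time (\<lambda>j. fst (y j)) k"
  have fin: "{y\<in>space prw_paths. ?T y = enat c} \<in> sets prw_paths" for c
  proof (rule sets_PiM_locally_determined[OF countable_prw_states])
    fix y assume y: "y \<in> {y\<in>space prw_paths. ?T y = enat c}"
    show "\<exists>n. \<forall>y'\<in>space prw_paths. (\<forall>k\<le>n. y' k = y k) \<longrightarrow> y' \<in> {y\<in>space prw_paths. ?T y = enat c}"
      using y by (intro exI[of _ c]) (auto intro: change_time_determined)
  qed auto
  have "?T -` {t} \<inter> space prw_paths \<in> sets prw_paths" for t
  proof (cases t)
    case (enat c)
    then have "?T -` {t} \<inter> space prw_paths = {y\<in>space prw_paths. ?T y = enat c}" by auto
    then show ?thesis using fin by simp
  next
    case infinity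
    then have "?T -` {t} \<inter> space prw_paths = space prw_paths - (\<Union>c. {y\<in>space prw_paths. ?T y = enat c})"
      by (auto simp: not_infinity_eq)
    then show ?thesis using fin by auto
  qed
  then show ?thesis by (subst measurable_count_space_eq_countable) auto
qed

lemma measurable_scaled_gap:
  "(\<lambda>y. scaled_gap \<epsilon> (\<lambda>j. fst (y j)) k) \<in> prw_paths \<rightarrow>\<^sub>M borel"
proof -
  have 1: "(\<lambda>y. (\<lambda>a. ereal \<epsilon> * ereal_of_enat (a - b)) (change_time (\<lambda>j. fst (y j)) k)) \<in> prw_paths \<rightarrow>\<^sub>M borel" for b
    by (rule measurable_compose[OF measurable_change_time]) simp
  show ?thesis
    unfolding scaled_gap_def
    by (rule measurable_compose_countable[OF 1 measurable_change_time])
qed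

text \<open>Elements of the product over \<open>I\<close> are \<open>undefined\<close> outside
  \<open>I\<close>. Restriction to \<open>I\<close> is continuous on the full function space, whose
  Borel sets can be tested coordinatewise thanks to second countability; \<open>z\<close> fills the
  remaining coordinates.\<close>

lemma sets_restrict_openin_product:
  fixes h :: "'a \<Rightarrow> nat \<Rightarrow> 'b::second_countable_topology"
  assumes h: "\<And>k. k \<in> I \<Longrightarrow> (\<lambda>x. h x k) \<in> borel_measurable N" and U: "openin (product_topology (\<lambda>_. euclidean) I) U"
  shows "{x\<in>space N. (\<lambda>k\<in>I. h x k) \<in> U} \<in> sets N"
proof -
  have "continuous_map euclidean (product_topology (\<lambda>_. euclidean) I) (\<lambda>x::nat \<Rightarrow> 'b. restrict x I)"
    unfolding continuous_map_componentwise
  proof (intro conjI ballI)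
    fix k assume "k \<in> I"
    have "continuous_map euclidean euclidean (\<lambda>x::nat \<Rightarrow> 'b. x k)"
      by (simp add: continuous_map_iff_continuous2)
    then show "continuous_map euclidean euclidean (\<lambda>x::nat \<Rightarrow> 'b. restrict x I k)" using \<open>k \<in> I\<close> by simp
  qed auto
  then have "openin euclidean {x::nat \<Rightarrow> 'b. restrict x I \<in> U}"
    using U by (auto simp: continuous_map)
  then have op: "{x::nat \<Rightarrow> 'b. restrict x I \<in> U} \<in> sets borel" by (simp add: open_openin[symmetric])
  define z where "z = (SOME z::'b. True)"
  have "(\<lambda>x k. if k \<in> I then h x k else z) \<in> borel_measurable N"
  proof (rule measurable_coordinatewise_then_product)
    show "(\<lambda>x. if k \<in> I then h x k else z) \<in> borel_measurable N" for k
      using h[of k] by (cases "k \<in> I") auto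
  qed
  from measurable_sets[OF this op]
  have "(\<lambda>x k. if k \<in> I then h x k else z) -` {x. restrict x I \<in> U} \<inter> space N \<in> sets N" .
  moreover have "restrict (\<lambda>k. if k \<in> I then h x k else z) I = (\<lambda>k\<in>I. h x k)" for x by auto
  ultimately show ?thesis by (simp add: vimage_def Int_def conj_commute)
qed

section \<open>Convergence of the persistent walk\<close>

text \<open>Sojourns are numbered from 0, so number \<open>k\<close> is distributed as \<open>e\<^bsub>k+1\<^esub>\<close>; the walk starts in state \<open>1\<close>,
  whose index is 2.\<close>

definition rate_index :: "nat \<Rightarrow> nat" where
  "rate_index k = (if even k then 2 else 1)"

lemma rate_index_in: "rate_index k \<in> {1, 2}" by (simp add: rate_index_def)

locale alternating_renewal = prob_space M for M :: "'c measure" +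
  fixes f :: "nat \<Rightarrow> real \<Rightarrow> real" and e :: "nat \<Rightarrow> 'c \<Rightarrow> real"
  assumes f_cadlag: "\<forall>i\<in>{1, 2}. cadlag (f i)"
    and f_pos: "\<forall>i\<in>{1, 2}. \<forall>t\<ge>0. f i t > 0"
    and f_int: "\<forall>i\<in>{1, 2}. (\<integral>\<^sup>+u\<in>{0..}. ennreal (f i u) \<partial>lborel) = \<infinity>"
    and e_indep: "indep_vars (\<lambda>_. borel) e {1..}"
    and e_tail: "\<forall>k. \<forall>t\<ge>0. prob {\<omega>\<in>space M. e (Suc k) \<omega> > t} = survival (f (rate_index k)) t"
begin

lemma rate_cadlag: "cadlag (f (rate_index k))"
  and rate_pos: "\<forall>t\<ge>0. f (rate_index k) t > 0"
  and rate_int: "(\<integral>\<^sup>+u\<in>{0..}. ennreal (f (rate_index k) u) \<partial>lborel) = \<infinity>"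
  using f_cadlag f_pos f_int rate_index_in[of k] by auto

lemma e_measurable [measurable]: "e (Suc k) \<in> borel_measurable M"
  using e_indep by (auto simp: indep_vars_def)

lemma e_measurable_ge_1: "1 \<le> j \<Longrightarrow> e j \<in> borel_measurable M"
  by (cases j) auto

lemma AE_e_pos: "AE \<omega> in M. \<forall>k. 0 < e (Suc k) \<omega>"
proof (subst AE_all_countable, rule allI)
  fix k
  have "prob {\<omega>\<in>space M. 0 < e (Suc k) \<omega>} = 1" using e_tail by (simp add: survival_nonpos)
  then show "AE \<omega> in M. 0 < e (Suc k) \<omega>" by (subst (asm) prob_Collect_eq_1) auto
qed

text \<open>Only two laws occur. Each has a positive median because its survival function attains
  1/2 and equals 1 at time 0; \<open>c\<close> is the smaller one.\<close>

lemma rate_median_bound: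
  obtains c where "c > 0" "\<And>k. prob {\<omega>\<in>space M. e (Suc k) \<omega> \<le> c} \<le> 1 / 2"
proof -
  obtain t0 where t0: "t0 \<ge> 0" "survival (f (rate_index 0)) t0 = 1 / 2"
    by (rule survival_attains[OF rate_cadlag rate_pos rate_int, of "1 / 2" 0]) auto
  obtain t1 where t1: "t1 \<ge> 0" "survival (f (rate_index 1)) t1 = 1 / 2"
    by (rule survival_attains[OF rate_cadlag rate_pos rate_int, of "1 / 2" 1]) auto
  have "t0 \<noteq> 0" "t1 \<noteq> 0" using t0 t1 by (auto simp: survival_nonpos)
  then have c: "min t0 t1 > 0" using t0 t1 by simp
  show ?thesis
  proof (rule that[OF c])
    fix k
    have "rate_index k = rate_index 0 \<or> rate_index k = rate_index 1" by (auto simp: rate_index_def)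
    then have "1 / 2 \<le> survival (f (rate_index k)) (min t0 t1)"
    proof
      assume k: "rate_index k = rate_index 0"
      have "\<not> survival (f (rate_index 0)) (min t0 t1) < survival (f (rate_index 0)) t0"
        using survival_less_iff[OF rate_cadlag[of 0] rate_pos[of 0] t0(1), of "min t0 t1"] by simp
      then show ?thesis using t0 k by simp
    next
      assume k: "rate_index k = rate_index 1"
      have "\<not> survival (f (rate_index 1)) (min t0 t1) < survival (f (rate_index 1)) t1"
        using survival_less_iff[OF rate_cadlag[of 1] rate_pos[of 1] t1(1), of "min t0 t1"] by simp
      then show ?thesis using t1 k by simp
    qed
    then have "1 / 2 \<le> prob {\<omega>\<in>space M. e (Suc k) \<omega> > min t0 t1}" using e_tail c by simp
    moreover have "prob {\<omega>\<in>space M. \<not> e (Suc k) \<omega> > min t0 t1} = 1 - prob {\<omega>\<in>space M. e (Suc k) \<omega> > min t0 t1}"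
      by (rule prob_neg) simp
    ultimately show "prob {\<omega>\<in>space M. e (Suc k) \<omega> \<le> min t0 t1} \<le> 1 / 2" by (simp add: not_less)
  qed
qed

text \<open>By independence \<open>n\<close> consecutive waiting times are all at most
  \<open>c\<close> with probability at most \<open>2^(-n)\<close>, so almost surely no tail of the
  sequence stays below \<open>c\<close>.\<close>

lemma AE_frequently_large:
  obtains c where "c > 0" "AE \<omega> in M. \<forall>m. \<exists>k\<ge>m. c < e (Suc k) \<omega>"
proof -
  obtain c where c: "c > 0" "\<And>k. prob {\<omega>\<in>space M. e (Suc k) \<omega> \<le> c} \<le> 1 / 2"
    using rate_median_bound by blast
  have "AE \<omega> in M. \<exists>k\<ge>m. c < e (Suc k) \<omega>" for m
  proof -
    define A where "A = {\<omega>\<in>space M. \<forall>k\<ge>m. e (Suc k) \<omega> \<le> c}"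
    have A_meas: "A \<in> events"
    proof -
      have "A = {\<omega>\<in>space M. \<forall>k. m \<le> k \<longrightarrow> e (Suc k) \<omega> \<le> c}" by (simp add: A_def)
      also have "\<dots> \<in> events" by measurable
      finally show ?thesis .
    qed
    have bound: "prob A \<le> (1 / 2) ^ n" for n
    proof (cases "n = 0")
      case False
      let ?J = "{Suc m..m + n}"
      have "prob A \<le> prob (\<Inter>j\<in>?J. e j -` {..c} \<inter> space M)"
      proof (rule finite_measure_mono)
        show "A \<subseteq> (\<Inter>j\<in>?J. e j -` {..c} \<inter> space M)"
        proof (intro subsetI INT_I)
          fix \<omega> j assume \<omega>: "\<omega> \<in> A" and "j \<in> ?J"
          then obtain k where "j = Suc k" "m \<le> k" by (cases j) auto
          then show "\<omega> \<in> e j -` {..c} \<inter> space M" using \<omega> by (auto simp: A_def)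
        qed
        have "e j -` {..c} \<inter> space M \<in> events" if "j \<in> ?J" for j
          using that by (intro measurable_sets[OF e_measurable_ge_1]) auto
        then show "(\<Inter>j\<in>?J. e j -` {..c} \<inter> space M) \<in> events"
          using False by (intro sets.finite_INT) auto
      qed
      also have "\<dots> = (\<Prod>j\<in>?J. prob (e j -` {..c} \<inter> space M))"
        using False by (intro indep_varsD[OF e_indep]) auto
      also have "\<dots> \<le> (\<Prod>j\<in>?J. 1 / 2)"
      proof (rule prod_mono)
        fix j assume "j \<in> ?J"
        then obtain k where j: "j = Suc k" by (cases j) auto
        have "e j -` {..c} \<inter> space M = {\<omega>\<in>space M. e (Suc k) \<omega> \<le> c}" using j by auto
        then show "0 \<le> prob (e j -` {..c} \<inter> space M) \<and> prob (e j -` {..c} \<inter> space M) \<le> 1 / 2"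
          using c(2)[of k] by simp
      qed
      also have "\<dots> = (1 / 2) ^ n" by simp
      finally show ?thesis .
    qed simp
    have "prob A \<le> 0"
    proof (rule LIMSEQ_le_const)
      show "(\<lambda>n. (1 / 2 :: real) ^ n) \<longlonglongrightarrow> 0" by (rule LIMSEQ_realpow_zero) auto
      show "\<exists>N. \<forall>n\<ge>N. prob A \<le> (1 / 2) ^ n" using bound by blast
    qed
    then have "prob A = 0" using measure_nonneg[of M A] by linarith
    then have "A \<in> null_sets M" using A_meas by (simp add: null_sets_def emeasure_eq_measure)
    then have "AE \<omega> in M. \<omega> \<notin> A" by (rule AE_not_in)
    then show ?thesis
    proof (rule AE_mp, intro AE_I2 impI)
      fix \<omega> assume "\<omega> \<in> space M" "\<omega> \<notin> A"
      then show "\<exists>k\<ge>m. c < e (Suc k) \<omega>" by (auto simp: A_def not_le)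
    qed
  qed
  then have "AE \<omega> in M. \<forall>m. \<exists>k\<ge>m. c < e (Suc k) \<omega>" by (subst AE_all_countable) blast
  then show ?thesis using that c(1) by blast
qed

end

lemma renewal_sequenceI_frequently:
  assumes pos: "\<forall>k. 0 < e (Suc k)" and c: "c > 0" and large: "\<forall>m. \<exists>k\<ge>m. c < e (Suc k)"
  shows "renewal_sequence e"
proof -
  have mono: "renewal_time e j \<le> renewal_time e k" if "j \<le> k" for j k
    using that
  proof (induction k rule: dec_induct)
    case (step n)
    then show ?case using pos[rule_format, of n] by (simp add: renewal_time_Suc)
  qed simp
  have grow: "\<exists>k. real n * c \<le> renewal_time e k" for n
  proof (induction n)
    case 0 then show ?case by (intro exI[of _ 0]) simp
  next
    case (Suc n)
    then obtain k where k: "real n * c \<le> renewal_time e k" by blast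
    obtain j where j: "j \<ge> k" "c < e (Suc j)" using large by blast
    have "real (Suc n) * c \<le> renewal_time e (Suc j)"
      using k j mono[OF j(1)] by (simp add: renewal_time_Suc distrib_right)
    then show ?case by blast
  qed
  have "\<exists>k. real n < renewal_time e k" for n
  proof -
    obtain N where "real n / c < real N" using reals_Archimedean2 by blast
    then have "real n < real N * c" using c by (simp only: pos_divide_less_eq)
    then show ?thesis using grow[of N] by (meson less_le_trans)
  qed
  moreover have "0 < e j" if "j \<ge> 1" for j using pos that by (cases j) auto
  ultimately show ?thesis by (simp add: renewal_sequence_def)
qed

text \<open>Nothing is known about the measurability of \<open>e 0\<close>; this allows its
  replacement by a constant.\<close>

lemma limit_path_cong:
  assumes "\<forall>k. e (Suc k) = e' (Suc k)" shows "limit_path e = limit_path e'"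
proof -
  have eq: "(\<Sum>j=1..k. e j) = (\<Sum>j=1..k. e' j)" for k
  proof (rule sum.cong)
    fix j assume "j \<in> {1..k}"
    then show "e j = e' j" using assms by (cases j) auto
  qed simp
  have "renewal_count e = renewal_count e'" "renewal_age e = renewal_age e'"
    by (simp_all only: fun_eq_iff renewal_count_def renewal_age_def eq simp_thms)
  then show ?thesis by (simp add: fun_eq_iff limit_path_def integrated_telegraph_def telegraph_def)
qed

lemma measurable_renewal_time:
  assumes "\<forall>k. h (Suc k) \<in> borel_measurable N"
  shows "(\<lambda>x. renewal_time (\<lambda>k. h k x) n) \<in> borel_measurable N"
  by (induction n) (auto simp: renewal_time_Suc intro!: borel_measurable_add assms[rule_format])

lemma sets_renewal_sequence:
  fixes h :: "nat \<Rightarrow> 'a \<Rightarrow> real"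
  assumes h: "\<forall>k. h (Suc k) \<in> borel_measurable N"
  shows "{x\<in>space N. renewal_sequence (\<lambda>k. h k x)} \<in> sets N"
proof -
  have [measurable]: "h (Suc k) \<in> borel_measurable N" for k using h by blast
  note [measurable] = measurable_renewal_time[OF h]
  have "renewal_sequence (\<lambda>k. h k x) \<longleftrightarrow> (\<forall>k. 0 < h (Suc k) x) \<and>
      (\<forall>n::nat. \<exists>k. real n < renewal_time (\<lambda>k. h k x) k)" for x
    unfolding renewal_sequence_def by (metis One_nat_def Suc_le_D Suc_le_mono le0)
  then show ?thesis by simp
qed

context alternating_renewal begin

lemma AE_renewal_sequence: "AE \<omega> in M. renewal_sequence (\<lambda>k. e k \<omega>)"
proof -
  obtain c where c: "c > 0" "AE \<omega> in M. \<forall>m. \<exists>k\<ge>m. c < e (Suc k) \<omega>" using AE_frequently_large by blast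
  from c(2) AE_e_pos show ?thesis
    by eventually_elim (rule renewal_sequenceI_frequently[OF _ c(1)])
qed

text \<open>By \<open>limit_path_locally_close\<close> the preimage of a Skorohod-open set agrees,
  within the renewal sequences, with an open set \<open>W\<close> of real sequences. Other sequences
  form a null event, which the completion takes care of.\<close>

lemma random_element_limit_path:
  "random_element skorohod_topology M (\<lambda>\<omega>. limit_path (\<lambda>k. e k \<omega>))"
  unfolding random_element_def
proof (intro conjI allI impI)
  show "AE \<omega> in M. limit_path (\<lambda>k. e k \<omega>) \<in> topspace skorohod_topology"
    using AE_renewal_sequence by eventually_elim (simp add: cadlag_limit_path)
  fix U :: "(real \<Rightarrow> real \<times> real \<times> real) set" assume U: "openin skorohod_topology U"
  have "\<forall>x\<in>{x. renewal_sequence x \<and> limit_path x \<in> U}. \<exists>V. open V \<and> x \<in> V \<and>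
      (\<forall>y\<in>V. renewal_sequence y \<longrightarrow> limit_path y \<in> U)"
  proof
    fix x assume x: "x \<in> {x. renewal_sequence x \<and> limit_path x \<in> U}"
    then obtain r where r: "r > 0" "\<And>z. cadlag z \<Longrightarrow> skorohod_close r (limit_path x) z \<Longrightarrow> z \<in> U"
      using U by (auto simp: openin_skorohod)
    obtain K \<delta> where K: "0 < \<delta>" "\<And>y. renewal_sequence y \<Longrightarrow> \<forall>j\<in>{1..K}. \<bar>y j - x j\<bar> \<le> \<delta> \<Longrightarrow>
        skorohod_close r (limit_path x) (limit_path y)"
      using limit_path_locally_close[of x r] x r(1) by blast
    let ?V = "Pi\<^sub>E UNIV (\<lambda>j. if j \<in> {1..K} then ball (x j) \<delta> else UNIV)"
    have "open ?V" by (rule open_PiE) (auto intro: finite_subset[of _ "{1..K}"])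
    moreover have "x \<in> ?V" using K(1) by (auto simp: PiE_iff)
    moreover have "limit_path y \<in> U" if y: "y \<in> ?V" "renewal_sequence y" for y
    proof (rule r(2)[OF cadlag_limit_path[OF y(2)]], rule K(2)[OF y(2)], rule ballI)
      fix j assume "j \<in> {1..K}"
      then have "y j \<in> ball (x j) \<delta>" using y(1) by (auto simp: PiE_iff split: if_splits)
      then show "\<bar>y j - x j\<bar> \<le> \<delta>" by (simp add: dist_real_def abs_minus_commute)
    qed
    ultimately show "\<exists>V. open V \<and> x \<in> V \<and> (\<forall>y\<in>V. renewal_sequence y \<longrightarrow> limit_path y \<in> U)" by blast
  qed
  then obtain V where V: "\<And>x. renewal_sequence x \<Longrightarrow> limit_path x \<in> U \<Longrightarrow> open (V x) \<and> x \<in> V x \<and>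
      (\<forall>y\<in>V x. renewal_sequence y \<longrightarrow> limit_path y \<in> U)"
    using bchoice[of "{x. renewal_sequence x \<and> limit_path x \<in> U}"
      "\<lambda>x V. open V \<and> x \<in> V \<and> (\<forall>y\<in>V. renewal_sequence y \<longrightarrow> limit_path y \<in> U)"] by auto
  \<comment> \<open>This union is uncountable, but it is open and hence Borel.\<close>
  define W where "W = (\<Union>x\<in>{x. renewal_sequence x \<and> limit_path x \<in> U}. V x)"
  have "open W" unfolding W_def using V by (intro open_UN) blast
  have W: "renewal_sequence x \<Longrightarrow> limit_path x \<in> U \<longleftrightarrow> x \<in> W" for x
    using V unfolding W_def by blast
  \<comment> \<open>Setting coordinate 0 to a constant makes the whole sequence measurable without
    changing the path.\<close>
  define e' where "e' \<omega> k = (if k = 0 then 0 else e k \<omega>)" for \<omega> k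
  have e': "e' \<in> borel_measurable M"
  proof (rule measurable_coordinatewise_then_product)
    show "(\<lambda>\<omega>. e' \<omega> k) \<in> borel_measurable M" for k by (cases k) (auto simp: e'_def)
  qed
  have lim': "limit_path (\<lambda>k. e k \<omega>) = limit_path (e' \<omega>)" for \<omega> by (rule limit_path_cong) (simp add: e'_def)
  have "{\<omega>\<in>space M. e' \<omega> \<in> W} = e' -` W \<inter> space M" by auto
  then have "{\<omega>\<in>space M. e' \<omega> \<in> W} \<in> sets M" using measurable_sets[OF e', of W] \<open>open W\<close> by simp
  moreover have "renewal_sequence (e' \<omega>)" if "renewal_sequence (\<lambda>k. e k \<omega>)" for \<omega>
  proof -
    have "renewal_time (e' \<omega>) k = renewal_time (\<lambda>k. e k \<omega>) k" for k
      by (induction k) (simp_all add: renewal_time_Suc e'_def)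
    then show ?thesis using that by (auto simp: renewal_sequence_def e'_def)
  qed
  then have "AE \<omega> in M. limit_path (\<lambda>k. e k \<omega>) \<in> U \<longleftrightarrow> e' \<omega> \<in> W"
    using AE_renewal_sequence unfolding lim' by (auto elim!: eventually_mono simp: W)
  ultimately show "{\<omega>\<in>space M. limit_path (\<lambda>k. e k \<omega>) \<in> U} \<in> sets (completion M)"
    by (intro sets_completion_AE)
qed

end

locale persistent_walk_coupling = alternating_renewal M f e for M :: "'c measure" and f e +
  fixes \<epsilon>0 :: real and \<alpha> :: "real \<Rightarrow> nat \<Rightarrow> nat \<Rightarrow> real"
  assumes e0: "\<epsilon>0 > 0"
    and \<alpha>_range: "\<And>\<epsilon>. \<epsilon> \<in> {0<..<\<epsilon>0} \<Longrightarrow> \<forall>i\<in>{1, 2}. \<forall>n\<ge>1. 0 < \<alpha> \<epsilon> i n \<and> \<alpha> \<epsilon> i n < 1"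
    and \<alpha>_lim: "\<And>i t. i \<in> {1, 2} \<Longrightarrow> t \<ge> 0 \<Longrightarrow>
      ((\<lambda>\<epsilon>. discrete_survival (\<alpha> \<epsilon> i) (nat \<lfloor>t / \<epsilon>\<rfloor>)) \<longlongrightarrow> survival (f i) t) (at_right 0)"
begin

definition coupled_gap :: "real \<Rightarrow> nat \<Rightarrow> 'c \<Rightarrow> enat" where
  "coupled_gap \<epsilon> k \<omega> = quantile_gap (\<alpha> \<epsilon> (rate_index k)) (survival (f (rate_index k)) (e (Suc k) \<omega>))"

lemma rate_range: "\<epsilon> \<in> {0<..<\<epsilon>0} \<Longrightarrow> \<forall>n\<ge>1. 0 < \<alpha> \<epsilon> (rate_index k) n \<and> \<alpha> \<epsilon> (rate_index k) n < 1"
  using \<alpha>_range rate_index_in by blast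

lemma coupled_gap_ge_1: "1 \<le> coupled_gap \<epsilon> k \<omega>"
  unfolding coupled_gap_def by (rule quantile_gap_ge_1)

lemma indep_vars_coupled_gap:
  assumes \<epsilon>: "\<epsilon> \<in> {0<..<\<epsilon>0}" shows "indep_vars (\<lambda>_. count_space UNIV) (coupled_gap \<epsilon>) UNIV"
proof -
  have "indep_vars (\<lambda>_. borel) e (range Suc)"
    using e_indep by (rule indep_vars_subset) auto
  then have "indep_vars (\<lambda>_. borel) (\<lambda>k. e (Suc k)) UNIV"
    using indep_vars_reindex[of Suc UNIV "\<lambda>_. borel" e] by simp
  moreover have "(\<lambda>x. quantile_gap (\<alpha> \<epsilon> (rate_index k)) (survival (f (rate_index k)) x)) \<in>
      borel \<rightarrow>\<^sub>M count_space UNIV" for k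
    by (rule measurable_compose[OF survival_borel_measurable[OF rate_cadlag rate_pos]
        measurable_quantile_gap[OF rate_range[OF \<epsilon>]]])
  ultimately show ?thesis
    unfolding coupled_gap_def by (rule indep_vars_compose2)
qed

text \<open>The product on the right lies in (0,1] and hence equals the survival function at some
  \<open>t\<close>; both survival values then compare as \<open>t\<close> and
  \<open>e (Suc k)\<close>, and the tail of the waiting time gives the exact probability.\<close>

lemma coupled_gap_tail:
  assumes \<epsilon>: "\<epsilon> \<in> {0<..<\<epsilon>0}"
  shows "prob {\<omega>\<in>space M. enat n < coupled_gap \<epsilon> k \<omega>} = discrete_survival (\<alpha> \<epsilon> (rate_index k)) n"
proof (cases "n = 0")
  case True
  then have "enat n < coupled_gap \<epsilon> k \<omega>" for \<omega>
    unfolding coupled_gap_def less_quantile_gap_iff[OF rate_range[OF \<epsilon>]] by simp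
  then show ?thesis using True by (simp add: prob_space discrete_survival_def)
next
  case False
  let ?D = "discrete_survival (\<alpha> \<epsilon> (rate_index k)) n"
  have "0 < ?D" "?D \<le> 1"
    using discrete_survival_pos[OF rate_range[OF \<epsilon>]] discrete_survival_less_1[OF rate_range[OF \<epsilon>], of n k] False
    by (auto simp: less_imp_le)
  then obtain t where t: "t \<ge> 0" "survival (f (rate_index k)) t = ?D"
    using survival_attains[OF rate_cadlag rate_pos rate_int] by blast
  have "enat n < coupled_gap \<epsilon> k \<omega> \<longleftrightarrow> t < e (Suc k) \<omega>" for \<omega>
    unfolding coupled_gap_def less_quantile_gap_iff[OF rate_range[OF \<epsilon>]] t(2)[symmetric]
    using survival_less_iff[OF rate_cadlag rate_pos t(1)] False by simp
  then show ?thesis using e_tail t by simp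
qed

definition coupled_chain :: "real \<Rightarrow> 'c \<Rightarrow> nat \<Rightarrow> real \<times> nat" where
  "coupled_chain \<epsilon> \<omega> n = gap_chain (\<lambda>k. coupled_gap \<epsilon> k \<omega>) n"

lemma markov_chain_coupled:
  "\<epsilon> \<in> {0<..<\<epsilon>0} \<Longrightarrow> markov_chain M prw_states (prw_kernel (\<alpha> \<epsilon>)) (\<lambda>n \<omega>. coupled_chain \<epsilon> \<omega> n)"
  unfolding coupled_chain_def
  using \<alpha>_range coupled_gap_tail
  by (intro markov_chain_gap_chain indep_vars_coupled_gap coupled_gap_ge_1) (auto simp: rate_index_def)

lemma coupled_gap_converges:
  assumes \<omega>: "renewal_sequence (\<lambda>k. e k \<omega>)" and \<delta>: "\<delta> > 0"
  shows "\<forall>\<^sub>F \<epsilon> in at_right 0. \<exists>d. \<forall>i<K. coupled_gap \<epsilon> i \<omega> = enat (d i) \<and> 1 \<le> d i \<and>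
      \<bar>\<epsilon> * real (d i) - e (Suc i) \<omega>\<bar> \<le> \<delta>"
proof -
  have "\<forall>\<^sub>F \<epsilon> in at_right 0. \<forall>i\<in>{..<K}. \<exists>n. coupled_gap \<epsilon> i \<omega> = enat n \<and> \<bar>\<epsilon> * real n - e (Suc i) \<omega>\<bar> \<le> \<delta>"
  proof (intro eventually_ball_finite ballI)
    fix i assume "i \<in> {..<K}"
    have "0 < e (Suc i) \<omega>" using \<omega> by (simp add: renewal_sequence_def)
    then show "\<forall>\<^sub>F \<epsilon> in at_right 0. \<exists>n. coupled_gap \<epsilon> i \<omega> = enat n \<and> \<bar>\<epsilon> * real n - e (Suc i) \<omega>\<bar> \<le> \<delta>"
      unfolding coupled_gap_def using rate_range \<alpha>_lim[OF rate_index_in]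
      by (intro scaled_quantile_gap_tendsto[OF rate_cadlag rate_pos e0, of "\<lambda>\<epsilon>. \<alpha> \<epsilon> (rate_index i)"] \<delta>) auto
  qed simp
  then show ?thesis
  proof eventually_elim
    case (elim \<epsilon>)
    then obtain d where "\<forall>i\<in>{..<K}. coupled_gap \<epsilon> i \<omega> = enat (d i) \<and> \<bar>\<epsilon> * real (d i) - e (Suc i) \<omega>\<bar> \<le> \<delta>"
      by (metis (no_types, lifting))
    moreover have "1 \<le> d i" if "coupled_gap \<epsilon> i \<omega> = enat (d i)" for i
      using coupled_gap_ge_1[of \<epsilon> i \<omega>] that by (simp add: one_enat_def)
    ultimately show ?case by auto
  qed
qed

lemma coupled_chain_path_converges:
  assumes \<omega>: "renewal_sequence (\<lambda>k. e k \<omega>)"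
  shows "limitin skorohod_topology (\<lambda>\<epsilon>. chain_path \<epsilon> (coupled_chain \<epsilon> \<omega>)) (limit_path (\<lambda>k. e k \<omega>)) (at_right 0)"
  unfolding limitin_skorohod
proof (intro conjI allI impI)
  show "cadlag (limit_path (\<lambda>k. e k \<omega>))" by (rule cadlag_limit_path[OF \<omega>])
  fix r :: real assume r: "r > 0"
  obtain K \<delta> where K: "0 < \<delta>" "\<And>\<epsilon> g d. 0 < \<epsilon> \<Longrightarrow> \<epsilon> \<le> r / 4 \<Longrightarrow> \<forall>i<K. g i = enat (d i) \<and> 1 \<le> d i \<and>
      \<bar>\<epsilon> * real (d i) - e (Suc i) \<omega>\<bar> \<le> \<delta> \<Longrightarrow>
    skorohod_close r (limit_path (\<lambda>k. e k \<omega>)) (chain_path \<epsilon> (gap_chain g))"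
    by (rule limit_path_chain_path_close[OF \<omega> r]) (rule that)
  have small: "\<forall>\<^sub>F \<epsilon> in at_right 0. \<epsilon> \<in> {0<..<r / 4}" using r by (intro eventually_at_right_real) simp
  show "\<forall>\<^sub>F \<epsilon> in at_right 0. cadlag (chain_path \<epsilon> (coupled_chain \<epsilon> \<omega>)) \<and>
     skorohod_close r (limit_path (\<lambda>k. e k \<omega>)) (chain_path \<epsilon> (coupled_chain \<epsilon> \<omega>))"
    using coupled_gap_converges[OF \<omega> K(1), of K] small
  proof eventually_elim
    case (elim \<epsilon>)
    then obtain d where d: "\<forall>i<K. coupled_gap \<epsilon> i \<omega> = enat (d i) \<and> 1 \<le> d i \<and>
        \<bar>\<epsilon> * real (d i) - e (Suc i) \<omega>\<bar> \<le> \<delta>" by blast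
    have "coupled_chain \<epsilon> \<omega> = gap_chain (\<lambda>k. coupled_gap \<epsilon> k \<omega>)" by (simp add: fun_eq_iff coupled_chain_def)
    then show ?case using K(2)[OF _ _ d] cadlag_chain_path elim(2) by simp
  qed
qed

lemma coupled_scaled_gap_converges:
  assumes \<omega>: "renewal_sequence (\<lambda>k. e k \<omega>)"
  shows "((\<lambda>\<epsilon>. scaled_gap \<epsilon> (\<lambda>j. fst (coupled_chain \<epsilon> \<omega> j)) (Suc k)) \<longlongrightarrow> ereal (e (Suc k) \<omega>)) (at_right 0)"
proof -
  define h where "h \<epsilon> = \<epsilon> * real (the_enat (coupled_gap \<epsilon> k \<omega>))" for \<epsilon>
  have "(h \<longlongrightarrow> e (Suc k) \<omega>) (at_right 0)"
  proof (rule tendstoI)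
    fix \<delta> :: real assume "\<delta> > 0"
    then have "\<forall>\<^sub>F \<epsilon> in at_right 0. \<exists>d. \<forall>i<Suc k. coupled_gap \<epsilon> i \<omega> = enat (d i) \<and> 1 \<le> d i \<and>
        \<bar>\<epsilon> * real (d i) - e (Suc i) \<omega>\<bar> \<le> \<delta> / 2"
      by (intro coupled_gap_converges[OF \<omega>]) simp
    then show "\<forall>\<^sub>F \<epsilon> in at_right 0. dist (h \<epsilon>) (e (Suc k) \<omega>) < \<delta>"
    proof eventually_elim
      case (elim \<epsilon>)
      then obtain d where "coupled_gap \<epsilon> k \<omega> = enat (d k)" "\<bar>\<epsilon> * real (d k) - e (Suc k) \<omega>\<bar> \<le> \<delta> / 2" by blast
      then show ?case using \<open>\<delta> > 0\<close> by (simp add: h_def dist_real_def)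
    qed
  qed
  then have "((\<lambda>\<epsilon>. ereal (h \<epsilon>)) \<longlongrightarrow> ereal (e (Suc k) \<omega>)) (at_right 0)" by simp
  \<comment> \<open>The precision 1 is arbitrary: it only serves to make the first
    \<open>k + 1\<close> sojourns finite, where \<open>scaled_gap\<close> is given by their
    lengths.\<close>
  moreover have "\<forall>\<^sub>F \<epsilon> in at_right 0. ereal (h \<epsilon>) = scaled_gap \<epsilon> (\<lambda>j. fst (coupled_chain \<epsilon> \<omega> j)) (Suc k)"
    using coupled_gap_converges[OF \<omega> zero_less_one, of "Suc k"]
  proof eventually_elim
    case (elim \<epsilon>)
    then obtain d where d: "\<forall>i<Suc k. coupled_gap \<epsilon> i \<omega> = enat (d i) \<and> 1 \<le> d i" by blast
    then have "coupled_gap \<epsilon> k \<omega> = enat (d k)" by simp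
    then show ?case
      unfolding coupled_chain_def h_def
      using scaled_gap_gap_chain[OF d, of k \<epsilon>] coupled_gap_ge_1 by simp
  qed
  ultimately show ?thesis by (rule Lim_transform_eventually)
qed

lemma coupled_chain_measurable:
  "\<epsilon> \<in> {0<..<\<epsilon>0} \<Longrightarrow> coupled_chain \<epsilon> \<in> M \<rightarrow>\<^sub>M prw_paths"
  using markov_chain_coupled[of \<epsilon>] gap_chain_in_states
  by (intro measurable_PiM_single') (auto simp: markov_chain_def coupled_chain_def PiE_iff)

context
  fixes P :: "real \<Rightarrow> 'b measure" and X :: "real \<Rightarrow> nat \<Rightarrow> 'b \<Rightarrow> real" and A :: "real \<Rightarrow> nat \<Rightarrow> 'b \<Rightarrow> nat"
  assumes P: "\<And>\<epsilon>. \<epsilon> \<in> {0<..<\<epsilon>0} \<Longrightarrow> prob_space (P \<epsilon>)"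
    and chain: "\<And>\<epsilon>. \<epsilon> \<in> {0<..<\<epsilon>0} \<Longrightarrow>
      markov_chain (P \<epsilon>) prw_states (prw_kernel (\<alpha> \<epsilon>)) (\<lambda>n \<omega>. (X \<epsilon> n \<omega>, A \<epsilon> n \<omega>))"
    and start: "\<And>\<epsilon>. \<epsilon> \<in> {0<..<\<epsilon>0} \<Longrightarrow> AE \<omega> in P \<epsilon>. X \<epsilon> 0 \<omega> = 1 \<and> A \<epsilon> 0 \<omega> = 1"
begin

lemma chain_measurable: "\<epsilon> \<in> {0<..<\<epsilon>0} \<Longrightarrow> (\<lambda>\<omega> n. (X \<epsilon> n \<omega>, A \<epsilon> n \<omega>)) \<in> P \<epsilon> \<rightarrow>\<^sub>M prw_paths"
proof -
  assume \<epsilon>: "\<epsilon> \<in> {0<..<\<epsilon>0}"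
  have m: "(\<lambda>\<omega>. (X \<epsilon> n \<omega>, A \<epsilon> n \<omega>)) \<in> P \<epsilon> \<rightarrow>\<^sub>M count_space prw_states" for n
    using chain[OF \<epsilon>] by (simp add: markov_chain_def)
  then show ?thesis
    using measurable_space[OF m] by (intro measurable_PiM_single') (auto simp: PiE_iff)
qed

lemma chain_law:
  assumes \<epsilon>: "\<epsilon> \<in> {0<..<\<epsilon>0}"
  shows "distr (P \<epsilon>) prw_paths (\<lambda>\<omega> n. (X \<epsilon> n \<omega>, A \<epsilon> n \<omega>)) = distr M prw_paths (coupled_chain \<epsilon>)"
proof -
  have "AE \<omega> in M. coupled_chain \<epsilon> \<omega> 0 = (1, 1)" by (simp add: coupled_chain_def gap_chain_def)
  moreover have "AE \<omega> in P \<epsilon>. (X \<epsilon> 0 \<omega>, A \<epsilon> 0 \<omega>) = (1, 1)" using start[OF \<epsilon>] by simp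
  ultimately have "distr (P \<epsilon>) prw_paths (\<lambda>\<omega> n. (X \<epsilon> n \<omega>, A \<epsilon> n \<omega>)) = distr M prw_paths (\<lambda>\<omega> n. coupled_chain \<epsilon> \<omega> n)"
    by (intro markov_chain_law_unique[OF P[OF \<epsilon>] prob_space_axioms countable_prw_states chain[OF \<epsilon>] _
        markov_chain_coupled[OF \<epsilon>]])
  then show ?thesis by simp
qed

text \<open>For fixed \<open>\<epsilon>\<close> a change time can be infinite, so the convergence
  takes place in the extended reals.\<close>

lemma gaps_converge_in_distribution:
  "conv_in_distribution (product_topology (\<lambda>_. euclidean) {1..n})
     P (\<lambda>\<epsilon> \<omega>. \<lambda>k\<in>{1..n}. scaled_gap \<epsilon> (\<lambda>j. X \<epsilon> j \<omega>) k) M (\<lambda>\<omega>. \<lambda>k\<in>{1..n}. ereal (e k \<omega>)) (at_right 0)"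
proof -
  let ?T = "product_topology (\<lambda>_. euclidean :: ereal topology) {1..n}"
  let ?\<Psi> = "\<lambda>\<epsilon> y. \<lambda>k\<in>{1..n}. scaled_gap \<epsilon> (\<lambda>j. fst (y j :: real \<times> nat)) k"
  have "conv_in_distribution ?T P (\<lambda>\<epsilon> \<omega>. ?\<Psi> \<epsilon> (\<lambda>j. (X \<epsilon> j \<omega>, A \<epsilon> j \<omega>))) M (\<lambda>\<omega>. \<lambda>k\<in>{1..n}. ereal (e k \<omega>))
      (at_right 0)"
  proof (rule conv_in_distribution_coupling[OF prob_space_axioms e0 chain_measurable
      coupled_chain_measurable chain_law])
    show "{y\<in>space prw_paths. ?\<Psi> \<epsilon> y \<in> U} \<in> sets prw_paths" if "openin ?T U" for \<epsilon> U
      by (rule sets_restrict_openin_product[OF measurable_scaled_gap that])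
    have meas: "(\<lambda>\<omega>. ereal (e k \<omega>)) \<in> borel_measurable M" if "k \<in> {1..n}" for k
      using that e_measurable[of "k - 1"] by simp
    show "random_element ?T M (\<lambda>\<omega>. \<lambda>k\<in>{1..n}. ereal (e k \<omega>))"
      unfolding random_element_def
      using sets_restrict_openin_product[OF meas] by (auto intro!: sets_completionI_sets)
    show "AE \<omega> in M. limitin ?T (\<lambda>\<epsilon>. ?\<Psi> \<epsilon> (coupled_chain \<epsilon> \<omega>)) (\<lambda>k\<in>{1..n}. ereal (e k \<omega>)) (at_right 0)"
      using AE_renewal_sequence
    proof eventually_elim
      case (elim \<omega>)
      have "((\<lambda>\<epsilon>. scaled_gap \<epsilon> (\<lambda>j. fst (coupled_chain \<epsilon> \<omega> j)) k) \<longlongrightarrow> ereal (e k \<omega>)) (at_right 0)"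
        if "k \<in> {1..n}" for k
        using coupled_scaled_gap_converges[OF elim, of "k - 1"] that by simp
      then show ?case by (auto simp: limitin_componentwise)
    qed
  qed (auto)
  then show ?thesis by simp
qed

lemma paths_converge_in_distribution:
  "conv_in_distribution skorohod_topology
     P (\<lambda>\<epsilon> \<omega>. chain_path \<epsilon> (\<lambda>j. (X \<epsilon> j \<omega>, A \<epsilon> j \<omega>))) M (\<lambda>\<omega>. limit_path (\<lambda>k. e k \<omega>)) (at_right 0)"
proof (rule conv_in_distribution_coupling[OF prob_space_axioms e0 chain_measurable
    coupled_chain_measurable chain_law])
  show "AE \<omega> in M. limitin skorohod_topology (\<lambda>\<epsilon>. chain_path \<epsilon> (coupled_chain \<epsilon> \<omega>)) (limit_path (\<lambda>k. e k
      \<omega>)) (at_right 0)"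
    using AE_renewal_sequence by eventually_elim (rule coupled_chain_path_converges)
qed (auto simp: cadlag_chain_path sets_chain_path random_element_limit_path)

end

end

section \<open>The Markov property\<close>

text \<open>Measurability is claimed for all sequences, also explosive ones. In the discrete space
  of naturals a series converges iff its partial sums are eventually constant, a countable
  condition; where it diverges, \<open>suminf\<close> has the fixed default value
  \<open>THE s. False\<close>.\<close>

lemma measurable_suminf_of_bool:
  assumes [measurable]: "\<And>n::nat. Measurable.pred N (P n)"
  shows "(\<lambda>x. \<Sum>n. if P n x then 1 else 0 :: nat) \<in> N \<rightarrow>\<^sub>M count_space UNIV"
proof -
  define c where "c x n = (if P n x then 1 else 0 :: nat)" for x n
  have sums_iff: "c x sums m \<longleftrightarrow> (\<exists>k. \<forall>n\<ge>k. (\<Sum>i<n. c x i) = m)" for x m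
    unfolding sums_def tendsto_discrete eventually_sequentially ..
  have [measurable]: "(\<lambda>x. c x n) \<in> N \<rightarrow>\<^sub>M count_space UNIV" for n
    unfolding c_def by measurable
  have [measurable]: "(\<lambda>x. \<Sum>i<n. c x i) \<in> N \<rightarrow>\<^sub>M count_space UNIV" for n by measurable
  have [measurable]: "Measurable.pred N (\<lambda>x. c x sums m)" for m
    unfolding sums_iff by measurable
  have "suminf (c x) = m \<longleftrightarrow> c x sums m \<or> (\<forall>k. \<not> c x sums k) \<and> (THE s::nat. False) = m" for x m
  proof (cases "\<exists>k. c x sums k")
    case True
    then obtain k where k: "c x sums k" by blast
    then have "c x sums m \<longleftrightarrow> k = m" using sums_unique2 by blast
    moreover have "suminf (c x) = k" using sums_unique[OF k] by (rule sym)
    ultimately show ?thesis using k by blast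
  next
    case False
    then have "suminf (c x) = (THE s. False)" by (simp add: suminf_def)
    then show ?thesis using False by auto
  qed
  then have vim: "(\<lambda>x. suminf (c x)) -` {m} \<inter> space N =
      {x\<in>space N. c x sums m \<or> (\<forall>k. \<not> c x sums k) \<and> (THE s::nat. False) = m}" for m by auto
  have "(\<lambda>x. suminf (c x)) -` {m} \<inter> space N \<in> sets N" for m
    unfolding vim by measurable
  then have "(\<lambda>x. suminf (c x)) \<in> N \<rightarrow>\<^sub>M count_space UNIV"
    by (subst measurable_count_space_eq_countable) auto
  then show ?thesis unfolding c_def[abs_def] .
qed

text \<open>The time is allowed to depend on \<open>x\<close>: with the second projection of a
  product space it yields the joint measurability behind
  \<open>measurable_integrated_telegraph\<close>.\<close>

lemma measurable_telegraph:
  assumes h: "\<forall>k. h (Suc k) \<in> borel_measurable N" and \<tau>: "\<tau> \<in> borel_measurable N"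
  shows "(\<lambda>x. telegraph (\<lambda>k. h k x) (\<tau> x)) \<in> borel_measurable N"
proof -
  note [measurable] = measurable_renewal_time[OF h] \<tau>
  have "(\<lambda>x. \<Sum>n. if renewal_time (\<lambda>k. h k x) (Suc n) \<le> \<tau> x then 1 else 0 :: nat) \<in> N \<rightarrow>\<^sub>M count_space UNIV"
    by (rule measurable_suminf_of_bool) measurable
  then have "(\<lambda>x. renewal_count (\<lambda>k. h k x) (\<tau> x)) \<in> N \<rightarrow>\<^sub>M count_space UNIV"
    by (simp only: renewal_count_def renewal_time_def)
  then show ?thesis unfolding telegraph_def by (rule measurable_compose) simp
qed

text \<open>The set under the supremum varies with the sequence; a supremum over all
  \<open>k\<close> has a fixed index set. The default 0 is \<open>renewal_time e 0\<close>, which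
  belongs to the set because \<open>0 \<le> t\<close>.\<close>

lemma renewal_age_SUP:
  assumes "0 \<le> t"
  shows "renewal_age e t = t - (SUP k. if renewal_time e k \<le> t then renewal_time e k else 0)"
proof -
  have "{renewal_time e k |k. renewal_time e k \<le> t} = range (\<lambda>k.
      if renewal_time e k \<le> t then renewal_time e k else 0)"
    (is "?L = range ?g")
  proof (intro subset_antisym subsetI)
    fix x assume "x \<in> ?L"
    then obtain k where "x = renewal_time e k" "renewal_time e k \<le> t" by blast
    then show "x \<in> range ?g" by (intro range_eqI[of _ _ k]) simp
  next
    fix x assume "x \<in> range ?g"
    then obtain k where k: "x = ?g k" by blast
    show "x \<in> ?L"
    proof (cases "renewal_time e k \<le> t")
      case False
      then have "x = renewal_time e 0 \<and> renewal_time e 0 \<le> t" using k assms by simp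
      then show ?thesis by blast
    qed (use k in auto)
  qed
  then show ?thesis unfolding renewal_age_def renewal_time_def[symmetric] by simp
qed

lemma measurable_renewal_age:
  assumes h: "\<forall>k. h (Suc k) \<in> borel_measurable N" and t: "0 \<le> t"
  shows "(\<lambda>x. renewal_age (\<lambda>k. h k x) t) \<in> borel_measurable N"
proof -
  note [measurable] = measurable_renewal_time[OF h]
  have "(\<lambda>x. SUP k. if renewal_time (\<lambda>k. h k x) k \<le> t then renewal_time (\<lambda>k. h k x) k else 0) \<in> borel_measurable N"
    by (rule borel_measurable_cSUP) (auto intro!: bdd_aboveI[of _ t] simp: t)
  then show ?thesis unfolding renewal_age_SUP[OF t] by measurable
qed

lemma measurable_integrated_telegraph:
  assumes h: "\<forall>k. h (Suc k) \<in> borel_measurable N"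
  shows "(\<lambda>x. integrated_telegraph (\<lambda>k. h k x) t) \<in> borel_measurable N"
proof -
  have "(\<lambda>p. telegraph (\<lambda>k. h k (fst p)) (snd p)) \<in> borel_measurable (N \<Otimes>\<^sub>M lborel)"
    by (rule measurable_telegraph) (auto intro!: measurable_compose[OF measurable_fst h[rule_format]])
  then have "(\<lambda>p. indicator {0..t} (snd p) *\<^sub>R telegraph (\<lambda>k. h k (fst p)) (snd p)) \<in>
      borel_measurable (N \<Otimes>\<^sub>M lborel)"
    by measurable
  then show ?thesis
    unfolding integrated_telegraph_def set_lebesgue_integral_def
    by (intro lborel.borel_measurable_lebesgue_integral) (simp add: case_prod_beta')
qed

lemma measurable_limit_path:
  assumes h: "\<forall>k. h (Suc k) \<in> borel_measurable N" and t: "0 \<le> t"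
  shows "(\<lambda>x. limit_path (\<lambda>k. h k x) t) \<in> borel_measurable N"
  unfolding limit_path_def
  by (intro borel_measurable_Pair measurable_integrated_telegraph measurable_telegraph measurable_renewal_age h t)
     simp

text \<open>The sequence of waiting times seen from an instant at which \<open>q 0\<close> (the waiting time in
  progress) has age \<open>a\<close>; \<open>q\<close> is indexed from 0, the result from 1.\<close>

definition residual :: "real \<Rightarrow> (nat \<Rightarrow> real) \<Rightarrow> nat \<Rightarrow> real" where
  "residual a q j = (if j = 1 then q 0 - a else q (j - 1))"

text \<open>Evolution over a time \<open>u\<close> from the state \<open>z\<close> of position, sign
  and age. The restarted path measures age from its own origin, which is wrong before its first
  renewal at \<open>q 0 - a\<close>; until then the old age is carried on.\<close>

definition resume :: "real \<Rightarrow> real \<times> real \<times> real \<Rightarrow> (nat \<Rightarrow> real) \<Rightarrow> real \<times> real \<times> real" where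
  "resume u z q = (case z of (w, x, a) \<Rightarrow> case limit_path (residual a q) u of (S, c, m) \<Rightarrow>
     (w + x * S, x * c, if u < q 0 - a then a + u else m))"

lemma renewal_time_residual:
  assumes "\<forall>n. q n = e (Suc (k + n))"
  shows "renewal_time (residual (s - renewal_time e k) q) (Suc j) = renewal_time e (k + Suc j) - s"
proof (induction j)
  case 0 then show ?case using assms by (simp add: renewal_time_Suc residual_def)
next
  case (Suc j)
  then show ?case
    using assms by (simp add: renewal_time_Suc[of _ "Suc j"] renewal_time_Suc[of e "Suc (k + j)"] residual_def)
qed

lemma renewal_sequence_residual:
  assumes e: "renewal_sequence e" and s: "renewal_time e k \<le> s" "s < renewal_time e (Suc k)"
    and q: "\<forall>n. q n = e (Suc (k + n))"
  shows "renewal_sequence (residual (s - renewal_time e k) q)"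
  unfolding renewal_sequence_def
proof (intro conjI allI impI)
  fix j :: nat assume "j \<ge> 1"
  then show "0 < residual (s - renewal_time e k) q j"
    using s e q by (auto simp: residual_def renewal_time_Suc renewal_sequence_def)
next
  fix n :: nat
  obtain j where j: "real n + s < renewal_time e j" using renewal_time_unbounded[OF e] by blast
  also have "\<dots> < renewal_time e (k + Suc j)"
    using renewal_time_strict_mono[OF e] by (auto simp: strict_mono_def)
  finally have "real n < renewal_time (residual (s - renewal_time e k) q) (Suc j)"
    unfolding renewal_time_residual[OF q] by simp
  then show "\<exists>j. real n < renewal_time (residual (s - renewal_time e k) q) j" by blast
qed

lemma telegraph_position_Suc:
  "telegraph_position b (Suc k) t = telegraph_position b k (b (Suc k)) + (-1) ^ Suc k * (t - b (Suc k))"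
  by (simp add: telegraph_position_def)

text \<open>The shift by \<open>s\<close> applies to breakpoints from index 1 on: the sojourn in
  progress began before \<open>s\<close> and is cut there, so \<open>b' 0\<close> is 0 instead of
  \<open>b k - s\<close>.\<close>

lemma telegraph_position_shift:
  assumes "b' 0 = 0" "\<And>j. b' (Suc j) = b (k + Suc j) - s"
  shows "telegraph_position b (k + j) (s + t) = telegraph_position b k s + (-1) ^ k * telegraph_position b' j t"
proof (induction j arbitrary: t)
  case 0
  then show ?case using assms(1) by (simp add: telegraph_position_def algebra_simps)
next
  case (Suc j)
  have b: "b (Suc (k + j)) = s + b' (Suc j)" using assms(2)[of j] by simp
  have "telegraph_position b (k + Suc j) (s + t) =
      telegraph_position b (k + j) (s + b' (Suc j)) + (-1) ^ Suc (k + j) * (t - b' (Suc j))"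
    using telegraph_position_Suc[of b "k + j" "s + t"] unfolding b by simp
  then show ?case
    unfolding Suc telegraph_position_Suc[of b' j t] by (simp add: power_add algebra_simps)
qed

text \<open>The renewal times after \<open>s\<close> are those of the residual sequence moved by
  \<open>s\<close>. If \<open>u\<close> falls into its interval \<open>j\<close>, then
  \<open>s + u\<close> falls into interval \<open>k + j\<close>, and the explicit formulas on both
  intervals agree.\<close>

lemma limit_path_add:
  assumes e: "renewal_sequence e" and s: "renewal_time e k \<le> s" "s < renewal_time e (Suc k)"
    and q: "\<forall>n. q n = e (Suc (k + n))" and u: "0 \<le> u"
  shows "limit_path e (s + u) = resume u (limit_path e s) q"
proof -
  define a where "a = s - renewal_time e k"
  let ?r = "renewal_time (residual a q)"
  have r: "renewal_sequence (residual a q)" unfolding a_def by (rule renewal_sequence_residual[OF e s q])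
  have r_Suc: "?r (Suc j) = renewal_time e (k + Suc j) - s" for j
    unfolding a_def by (rule renewal_time_residual[OF q])
  have zs: "limit_path e s = (telegraph_position (renewal_time e) k s, (-1) ^ k, a)"
    using limit_path_eq[OF e s] by (simp add: a_def)
  obtain K where "u < ?r K" using renewal_time_unbounded[OF r] by blast
  then obtain j where j: "?r j \<le> u" "u < ?r (Suc j)" using breakpoint_interval[of ?r u K] u by auto
  have zu: "limit_path (residual a q) u = (telegraph_position ?r j u, (-1) ^ j, u - ?r j)"
    by (rule limit_path_eq[OF r j])
  have pos: "telegraph_position (renewal_time e) (k + j) (s + u) =
      telegraph_position (renewal_time e) k s + (-1) ^ k * telegraph_position ?r j u"
    by (rule telegraph_position_shift) (simp_all add: r_Suc)
  have q0: "q 0 - a = ?r 1" by (simp add: renewal_time_Suc residual_def)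
  have up: "s + u < renewal_time e (Suc (k + j))" using j(2) r_Suc[of j] by simp
  show ?thesis
  proof (cases j)
    case 0
    have lp: "limit_path e (s + u) = (telegraph_position (renewal_time e) k (s + u), (-1) ^ k, s + u -
        renewal_time e k)"
      using 0 up s u by (intro limit_path_eq[OF e]) auto
    have "u < q 0 - a" using j(2) 0 q0 by simp
    then show ?thesis unfolding lp zs resume_def using pos 0 zu by (simp add: a_def)
  next
    case (Suc i)
    have "renewal_time e (k + j) \<le> s + u" using j(1) r_Suc[of i] Suc by simp
    then have lp: "limit_path e (s + u) = (telegraph_position (renewal_time e) (k + j) (s +
        u), (-1) ^ (k + j), s + u - renewal_time e (k + j))"
      using up by (intro limit_path_eq[OF e]) auto
    have "?r 1 \<le> ?r j" using renewal_time_le_iff[OF r] Suc by simp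
    then have "\<not> u < q 0 - a" using j(1) q0 by simp
    then show ?thesis unfolding lp zs resume_def using pos zu r_Suc[of i] Suc by (simp add: power_add)
  qed
qed

text \<open>The present position enters \<open>resume\<close> only as a summand of the new position;
  this is why sign and age alone form a Markov process.\<close>

lemma snd_resume_cong: "snd z = snd z' \<Longrightarrow> snd (resume u z q) = snd (resume u z' q)"
  by (cases z; cases z') (auto simp: resume_def split: prod.split)

lemma measurable_resume:
  assumes z: "z \<in> borel_measurable N" and q: "\<And>n. (\<lambda>x. q x n) \<in> borel_measurable N" and u: "0 \<le> u"
  shows "(\<lambda>x. resume u (z x) (q x)) \<in> borel_measurable N"
proof -
  have [measurable]: "(\<lambda>x. fst (z x)) \<in> borel_measurable N" "(\<lambda>x. fst (snd (z x))) \<in>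
      borel_measurable N" "(\<lambda>x. snd (snd (z x))) \<in> borel_measurable N"
    using z by (auto simp: borel_prod[symmetric])
  note [measurable] = q
  have lp: "(\<lambda>x. limit_path (\<lambda>k. residual (snd (snd (z x))) (q x) k) u) \<in> borel_measurable N"
    by (rule measurable_limit_path[OF _ u]) (simp add: residual_def)
  then have [measurable]: "(\<lambda>x. fst (limit_path (residual (snd (snd (z x))) (q x)) u)) \<in> borel_measurable N"
    "(\<lambda>x. fst (snd (limit_path (residual (snd (snd (z x))) (q x)) u))) \<in> borel_measurable N"
    "(\<lambda>x. snd (snd (limit_path (residual (snd (snd (z x))) (q x)) u))) \<in> borel_measurable N"
    by (auto simp: borel_prod[symmetric])
  have "resume u (z x) (q x) = (fst (z x) + fst (snd (z x)) * fst (limit_path (residual (snd (snd (z x))) (q x)) u),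
      fst (snd (z x)) * fst (snd (limit_path (residual (snd (snd (z x))) (q x)) u)),
      if u < q x 0 - snd (snd (z x)) then snd (snd (z x)) +
          u else snd (snd (limit_path (residual (snd (snd (z x))) (q x)) u)))" for x
    by (simp add: resume_def split: prod.split)
  then show ?thesis by (simp only:) measurable
qed

section \<open>Splitting the waiting times after the k-th renewal\<close>

abbreviation real_sequences :: "(nat \<Rightarrow> real) measure" where
  "real_sequences \<equiv> PiM UNIV (\<lambda>_. borel)"

text \<open>The state at \<open>s\<close> on the event of exactly \<open>k\<close> renewals up to
  \<open>s\<close>, expressed through the first \<open>k\<close> waiting times; elsewhere it is
  merely a measurable function of them.\<close>

definition prefix_state :: "nat \<Rightarrow> real \<Rightarrow> (nat \<Rightarrow> real) \<Rightarrow> real \<times> real \<times> real" where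
  "prefix_state k s p = (telegraph_position (renewal_time p) k s, (-1) ^ k, s - renewal_time p k)"

lemma measurable_renewal_time_prefix:
  assumes "j \<le> k"
  shows "(\<lambda>p. renewal_time p j) \<in> borel_measurable (PiM {1..k} (\<lambda>_. borel))"
  using assms unfolding renewal_time_def
  by (intro borel_measurable_sum measurable_component_singleton) auto

lemma measurable_prefix_state:
  "prefix_state k s \<in> borel_measurable (PiM {1..k} (\<lambda>_. borel))"
proof -
  have "(\<lambda>p. telegraph_position (renewal_time p) k s) \<in> borel_measurable (PiM {1..k} (\<lambda>_. borel))"
    unfolding telegraph_position_def
    by (intro borel_measurable_add borel_measurable_sum borel_measurable_times borel_measurable_diff
        borel_measurable_const
        measurable_renewal_time_prefix) auto
  then show ?thesis
    unfolding prefix_state_def[abs_def]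
    by (intro borel_measurable_Pair borel_measurable_diff borel_measurable_const
        measurable_renewal_time_prefix) auto
qed

lemma prefix_state_eq:
  assumes "\<forall>j\<le>k. renewal_time p j = renewal_time e j" "renewal_sequence e"
    "renewal_time e k \<le> s" "s < renewal_time e (Suc k)"
  shows "prefix_state k s p = limit_path e s"
proof -
  have "telegraph_position (renewal_time p) k s = telegraph_position (renewal_time e) k s"
    using assms(1) by (auto simp: telegraph_position_def intro!: sum.cong)
  then show ?thesis using assms(1) limit_path_eq[OF assms(2-4)] by (simp add: prefix_state_def)
qed

text \<open>The filler \<open>s + 1\<close> only has to push the next renewal beyond \<open>s\<close>.\<close>

lemma limit_path_prefix:
  assumes e: "renewal_sequence e" and s: "renewal_time e k \<le> s" "s < renewal_time e (Suc k)" and u: "0 \<le> u" "u \<le> s"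
  shows "limit_path (\<lambda>j. if j \<in> {1..k} then e j else s + 1) u = limit_path e u"
proof -
  define e' where "e' j = (if j \<in> {1..k} then e j else s + 1)" for j
  have s0: "0 \<le> s" using u by simp
  have eq: "renewal_time e' j = renewal_time e j" if "j \<le> k" for j
    using that unfolding renewal_time_def by (intro sum.cong) (auto simp: e'_def)
  have add: "renewal_time e' (k + j) = renewal_time e k + real j * (s + 1)" for j
  proof (induction j)
    case (Suc j)
    then show ?case by (simp add: renewal_time_Suc e'_def algebra_simps)
  qed (simp add: eq)
  have e': "renewal_sequence e'"
    unfolding renewal_sequence_def
  proof (intro conjI allI impI)
    fix j :: nat assume "1 \<le> j" then show "0 < e' j" using e s0 by (auto simp: e'_def renewal_sequence_def)
  next
    fix n :: nat
    have "real n < 0 + real (Suc n) * 1" by simp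
    also have "\<dots> \<le> renewal_time e k + real (Suc n) * (s + 1)"
      using renewal_time_nonneg[OF e] s0 by (intro add_mono mult_left_mono) auto
    finally show "\<exists>j. real n < renewal_time e' j" unfolding add[symmetric] by blast
  qed
  have last: "s < renewal_time e' (Suc k)" using add[of 1] renewal_time_nonneg[OF e, of k] by simp
  have "u < renewal_time e (Suc k)" using u s by simp
  then obtain j where j: "j < Suc k" "renewal_time e j \<le> u" "u < renewal_time e (Suc j)"
    using breakpoint_interval[of "renewal_time e" u "Suc k"] u by auto
  have j': "renewal_time e' j \<le> u" "u < renewal_time e' (Suc j)"
    using j eq last u by (auto simp: less_Suc_eq)
  have "telegraph_position (renewal_time e') j u = telegraph_position (renewal_time e) j u"
    unfolding telegraph_position_def using j(1) eq by (intro arg_cong2[where f = "(+)"] sum.cong) auto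
  then have "limit_path e' u = limit_path e u"
    using limit_path_eq[OF e j(2,3)] limit_path_eq[OF e' j'] eq j(1) by simp
  then show ?thesis by (simp add: e'_def[abs_def])
qed

context alternating_renewal begin

definition suffix :: "nat \<Rightarrow> 'c \<Rightarrow> nat \<Rightarrow> real" where
  "suffix k \<omega> n = e (Suc (k + n)) \<omega>"

definition prefix :: "nat \<Rightarrow> 'c \<Rightarrow> nat \<Rightarrow> real" where
  "prefix k \<omega> = restrict (\<lambda>j. e j \<omega>) {1..k}"

abbreviation suffix_law :: "nat \<Rightarrow> (nat \<Rightarrow> real) measure" where
  "suffix_law k \<equiv> distr M real_sequences (suffix k)"

lemma measurable_suffix [measurable]: "suffix k \<in> M \<rightarrow>\<^sub>M real_sequences"
  by (rule measurable_PiM_single') (auto simp: suffix_def)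

lemma measurable_prefix [measurable]: "prefix k \<in> M \<rightarrow>\<^sub>M PiM {1..k} (\<lambda>_. borel)"
  unfolding prefix_def by (intro measurable_restrict e_measurable_ge_1) auto

text \<open>The tails are prescribed at nonnegative times; on the negative half-line the
  distribution functions agree because waiting times are almost surely positive.\<close>

lemma distr_e_cong:
  assumes "rate_index j = rate_index k"
  shows "distr M borel (e (Suc j)) = distr M borel (e (Suc k))"
proof (rule cdf_unique)
  show "real_distribution (distr M borel (e (Suc j)))" "real_distribution (distr M borel (e (Suc k)))"
    by (rule real_distribution_distr; simp)+
  have cdf: "cdf (distr M borel (e (Suc j))) x = (if x < 0 then 0 else 1 - survival (f (rate_index j)) x)" for j x
  proof -
    have "cdf (distr M borel (e (Suc j))) x = prob {\<omega>\<in>space M. e (Suc j) \<omega> \<le> x}"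
      unfolding cdf_def by (subst measure_distr) (auto intro!: arg_cong[where f = prob])
    also have "\<dots> = (if x < 0 then 0 else 1 - survival (f (rate_index j)) x)"
    proof (cases "x < 0")
      case True
      have "AE \<omega> in M. \<not> e (Suc j) \<omega> \<le> x" using AE_e_pos
      proof eventually_elim
        case (elim \<omega>)
        then show ?case using True by (simp add: not_le) (meson order.strict_trans)
      qed
      then have "prob {\<omega>\<in>space M. e (Suc j) \<omega> \<le> x} = 0" by (subst prob_Collect_eq_0) auto
      then show ?thesis using True by simp
    next
      case False
      have "prob {\<omega>\<in>space M. \<not> e (Suc j) \<omega> > x} = 1 - prob {\<omega>\<in>space M. e (Suc j) \<omega> > x}"
        by (rule prob_neg) simp
      then show ?thesis using False e_tail by (simp add: not_less)
    qed
    finally show ?thesis .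
  qed
  show "cdf (distr M borel (e (Suc j))) = cdf (distr M borel (e (Suc k)))"
    unfolding fun_eq_iff cdf assms by simp
qed

text \<open>By independence a suffix has a product law, and its factors alternate with period
  two.\<close>

lemma suffix_law_cong:
  assumes "even j \<longleftrightarrow> even k" shows "suffix_law j = suffix_law k"
proof -
  have law: "suffix_law k = PiM UNIV (\<lambda>n. distr M borel (e (Suc (k + n))))" for k
  proof -
    have "indep_vars (\<lambda>_. borel) e ((\<lambda>n. Suc (k + n)) ` UNIV)"
      using e_indep by (rule indep_vars_subset) auto
    then have "indep_vars (\<lambda>_. borel) (\<lambda>n. e (Suc (k + n))) UNIV"
      using indep_vars_reindex[of "\<lambda>n. Suc (k + n)" UNIV "\<lambda>_. borel" e] by (simp add: inj_on_def)
    then have "distr M real_sequences (\<lambda>\<omega>. \<lambda>n\<in>UNIV. e (Suc (k + n)) \<omega>) =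
        PiM UNIV (\<lambda>n. distr M borel (e (Suc (k + n))))"
      by (subst (asm) indep_vars_iff_distr_eq_PiM') auto
    then show ?thesis by (simp add: suffix_def[abs_def] restrict_def)
  qed
  have "distr M borel (e (Suc (j + n))) = distr M borel (e (Suc (k + n)))" for n
    using assms by (intro distr_e_cong) (simp add: rate_index_def)
  then show ?thesis unfolding law by simp
qed

lemma prob_space_suffix_law: "prob_space (suffix_law k)"
  by (rule prob_space_distr) simp

text \<open>Disjoint blocks of independent variables are independent, so the joint law is a product
  and Fubini's theorem integrates the suffix out first.\<close>

lemma prefix_suffix_integral:
  assumes G: "G \<in> borel_measurable (PiM {1..k} (\<lambda>_. borel) \<Otimes>\<^sub>M real_sequences)" and bound: "\<And>p q. \<bar>G (p,
      q)\<bar> \<le> (1::real)"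
  shows "(\<integral>\<omega>. G (prefix k \<omega>, suffix k \<omega>) \<partial>M) = (\<integral>\<omega>. (\<integral>q. G (prefix k \<omega>, q) \<partial>suffix_law k) \<partial>M)"
proof -
  let ?P = "PiM {1..k} (\<lambda>_. borel :: real measure)" and ?Q = "PiM {Suc k..} (\<lambda>_. borel :: real measure)"
  have "indep_var ?P (\<lambda>\<omega>. restrict (\<lambda>i. e i \<omega>) {1..k}) ?Q (\<lambda>\<omega>. restrict (\<lambda>i. e i \<omega>) {Suc k..})"
    by (rule indep_var_restrict[OF e_indep]) auto
  then have "indep_var ?P ((\<lambda>x. x) \<circ> (\<lambda>\<omega>. restrict (\<lambda>i. e i \<omega>) {1..k}))
      real_sequences ((\<lambda>x n. x (Suc (k + n))) \<circ> (\<lambda>\<omega>. restrict (\<lambda>i. e i \<omega>) {Suc k..}))"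
    by (rule indep_var_compose)
       (auto intro!: measurable_PiM_single' measurable_component_singleton simp: space_PiM)
  moreover have "(\<lambda>x n. x (Suc (k + n))) \<circ> (\<lambda>\<omega>. restrict (\<lambda>i. e i \<omega>) {Suc k..}) = suffix k"
    by (auto simp: fun_eq_iff suffix_def)
  moreover have "(\<lambda>x. x) \<circ> (\<lambda>\<omega>. restrict (\<lambda>i. e i \<omega>) {1..k}) = prefix k"
    by (auto simp: fun_eq_iff prefix_def)
  ultimately have "indep_var ?P (prefix k) real_sequences (suffix k)" by simp
  then have joint: "distr M ?P (prefix k) \<Otimes>\<^sub>M suffix_law k =
      distr M (?P \<Otimes>\<^sub>M real_sequences) (\<lambda>\<omega>. (prefix k \<omega>, suffix k \<omega>))"
    by (simp add: indep_var_distribution_eq)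
  interpret S: prob_space "suffix_law k" by (rule prob_space_suffix_law)
  interpret R: prob_space "distr M ?P (prefix k)" by (rule prob_space_distr[OF measurable_prefix])
  interpret RS: pair_prob_space "distr M ?P (prefix k)" "suffix_law k" ..
  have G': "G \<in> borel_measurable (distr M ?P (prefix k) \<Otimes>\<^sub>M suffix_law k)"
    using G by (simp add: measurable_cong_sets[OF sets_pair_measure_cong[OF sets_distr sets_distr] refl])
  have int: "integrable (distr M ?P (prefix k) \<Otimes>\<^sub>M suffix_law k) G"
    using bound G' by (intro RS.integrable_const_bound[where B = 1]) auto
  have "(\<integral>\<omega>. G (prefix k \<omega>, suffix k \<omega>) \<partial>M) = integral\<^sup>L (distr M ?P (prefix k) \<Otimes>\<^sub>M suffix_law k) G"
    unfolding joint by (rule integral_distr[OF measurable_Pair[OF measurable_prefix measurable_suffix] G,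
        symmetric])
  also have "\<dots> = (\<integral>p. (\<integral>q. G (p, q) \<partial>suffix_law k) \<partial>distr M ?P (prefix k))"
    by (rule RS.integral_fst'[OF int, symmetric])
  also have "\<dots> = (\<integral>\<omega>. (\<integral>q. G (prefix k \<omega>, q) \<partial>suffix_law k) \<partial>M)"
  proof (rule integral_distr)
    have "case_prod (\<lambda>p q. G (p, q)) \<in> borel_measurable (?P \<Otimes>\<^sub>M suffix_law k)"
      using G by (simp add: measurable_cong_sets[OF sets_pair_measure_cong[OF refl sets_distr] refl])
    then show "(\<lambda>p. \<integral>q. G (p, q) \<partial>suffix_law k) \<in> borel_measurable ?P"
      by (rule S.borel_measurable_lebesgue_integral)
  qed (rule measurable_prefix)
  finally show ?thesis .
qed

text \<open>The law of the future waiting times depends on the number of past renewals only through its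
  parity, which the sign component of the state reveals: suffixes 0 and 1 represent the two cases.
  A running waiting time of age \<open>a\<close> is conditioned to exceed \<open>a\<close>.\<close>

definition survivor_integral :: "real \<Rightarrow> (real \<times> real \<times> real) set \<Rightarrow> nat \<Rightarrow> real \<times> real \<times> real \<Rightarrow> real" where
  "survivor_integral u A i z =
     (\<integral>q. indicator {q. snd (snd z) < q 0} q * indicator A (resume u z q) \<partial>suffix_law i)"

definition survivor_mass :: "nat \<Rightarrow> real \<Rightarrow> real" where
  "survivor_mass i a = (\<integral>q. indicator {q. a < q 0} q \<partial>suffix_law i)"

definition transition :: "real \<Rightarrow> (real \<times> real \<times> real) set \<Rightarrow> real \<times> real \<times> real \<Rightarrow> real" where
  "transition u A z = (let i = if fst (snd z) = 1 then 0 else 1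
     in survivor_integral u A i z / survivor_mass i (snd (snd z)))"

text \<open>The mass is the survival function at \<open>a\<close>, an exponential; so the quotient
  in \<open>transition\<close> is a genuine conditional probability.\<close>

lemma survivor_mass_pos:
  assumes "0 \<le> a" shows "0 < survivor_mass i a"
proof -
  have ev: "{q. a < q 0} \<inter> space real_sequences \<in> sets real_sequences"
  proof -
    have "(\<lambda>q::nat \<Rightarrow> real. q 0) -` {a<..} \<inter> space real_sequences \<in> sets real_sequences"
      by (intro measurable_sets[OF measurable_component_singleton]) auto
    then show ?thesis by (simp add: vimage_def)
  qed
  have "survivor_mass i a = (\<integral>q. indicator ({q. a < q 0} \<inter> space real_sequences) q \<partial>suffix_law i)"
    unfolding survivor_mass_def by (simp add: space_PiM)
  also have "\<dots> = measure (suffix_law i) ({q. a < q 0} \<inter> space real_sequences)"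
    using ev by (simp add: space_PiM)
  also have "\<dots> = prob (suffix i -` ({q. a < q 0} \<inter> space real_sequences) \<inter> space M)"
    by (rule measure_distr[OF measurable_suffix ev])
  also have "suffix i -` ({q. a < q 0} \<inter> space real_sequences) \<inter> space M = {\<omega>\<in>space M. e (Suc i) \<omega> > a}"
    by (auto simp: suffix_def space_PiM)
  also have "prob \<dots> = survival (f (rate_index i)) a" using e_tail assms by simp
  finally show ?thesis using survival_pos by simp
qed

lemma measurable_fst_snd_snd [measurable]:
  "(\<lambda>z::real \<times> real \<times> real. fst (snd z)) \<in> borel_measurable borel"
  "(\<lambda>z::real \<times> real \<times> real. snd (snd z)) \<in> borel_measurable borel"
  by (simp_all add: borel_prod[symmetric])

lemma measurable_survivor_integrand:
  assumes u: "0 \<le> u" and A: "A \<in> sets borel" and z: "z \<in> borel_measurable N"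
  shows "(\<lambda>x. indicator {q. snd (snd (z (fst x))) <
      q 0} (snd x) * indicator A (resume u (z (fst x)) (snd x)) :: real)
     \<in> borel_measurable (N \<Otimes>\<^sub>M real_sequences)"
proof -
  have q: "(\<lambda>x. snd x n) \<in> borel_measurable (N \<Otimes>\<^sub>M real_sequences)" for n
    by (rule measurable_compose[OF measurable_snd measurable_component_singleton]) simp
  have z': "(\<lambda>x. z (fst x)) \<in> borel_measurable (N \<Otimes>\<^sub>M real_sequences)"
    by (rule measurable_compose[OF measurable_fst z])
  have r: "(\<lambda>x. resume u (z (fst x)) (snd x)) \<in> borel_measurable (N \<Otimes>\<^sub>M real_sequences)"
    by (rule measurable_resume[OF z' q u])
  have a: "(\<lambda>x. snd (snd (z (fst x)))) \<in> borel_measurable (N \<Otimes>\<^sub>M real_sequences)"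
    by (rule measurable_compose[OF z' measurable_fst_snd_snd(2)])
  have eq: "(\<lambda>x. indicator {q. snd (snd (z (fst x))) < q 0} (snd x) :: real) = (\<lambda>x.
      if snd (snd (z (fst x))) < snd x 0 then 1 else 0)"
    by (auto simp: fun_eq_iff indicator_def)
  have "(\<lambda>x. if snd (snd (z (fst x))) < snd x 0 then 1 else 0 :: real) \<in> borel_measurable (N \<Otimes>\<^sub>M real_sequences)"
    using a q[of 0] by measurable
  then have 1: "(\<lambda>x. indicator {q. snd (snd (z (fst x))) <
      q 0} (snd x) :: real) \<in> borel_measurable (N \<Otimes>\<^sub>M real_sequences)"
    by (subst eq)
  have 2: "(\<lambda>x. indicator A (resume u (z (fst x)) (snd x)) :: real) \<in> borel_measurable (N \<Otimes>\<^sub>M real_sequences)"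
    using A by (intro measurable_compose[OF r]) simp
  show ?thesis by (rule borel_measurable_times[OF 1 2])
qed

lemma measurable_transition:
  assumes u: "0 \<le> u" and A: "A \<in> sets borel"
  shows "transition u A \<in> borel_measurable borel"
proof -
  interpret S: prob_space "suffix_law i" for i by (rule prob_space_suffix_law)
  have cong: "borel_measurable (borel \<Otimes>\<^sub>M suffix_law i) =
      (borel_measurable (borel \<Otimes>\<^sub>M real_sequences) :: ((real \<times> real \<times> real) \<times> (nat \<Rightarrow> real) \<Rightarrow> real) set)" for i
    by (rule measurable_cong_sets[OF sets_pair_measure_cong[OF refl sets_distr] refl])
  have num: "survivor_integral u A i \<in> borel_measurable borel" for i
    unfolding survivor_integral_def[abs_def]
    using measurable_survivor_integrand[OF u A, of "\<lambda>z. z" borel]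
    by (intro S.borel_measurable_lebesgue_integral) (simp add: cong case_prod_beta')
  have den: "(\<lambda>z::real \<times> real \<times> real. survivor_mass i (snd (snd z))) \<in> borel_measurable borel" for i
    unfolding survivor_mass_def[abs_def]
    using measurable_survivor_integrand[OF u, of UNIV "\<lambda>z. z" borel]
    by (intro S.borel_measurable_lebesgue_integral) (simp add: cong case_prod_beta')
  note [measurable] = num den
  have "transition u A = (\<lambda>z. if fst (snd z) = 1 then survivor_integral u A 0 z / survivor_mass 0 (snd (snd z))
     else survivor_integral u A 1 z / survivor_mass 1 (snd (snd z)))"
    by (simp add: fun_eq_iff transition_def)
  also have "\<dots> \<in> borel_measurable borel" by measurable
  finally show ?thesis .
qed

text \<open>The numerator integrates a part of the event whose mass is the denominator; a zero
  denominator would be covered by \<open>x / 0 = 0\<close>.\<close>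

lemma transition_bounds:
  assumes u: "0 \<le> u" and A: "A \<in> sets borel" shows "0 \<le> transition u A z" "transition u A z \<le> 1"
proof -
  have b: "0 \<le> survivor_integral u A i z \<and> survivor_integral u A i z \<le> survivor_mass i (snd (snd z))" for i
  proof -
    interpret S: prob_space "suffix_law i" by (rule prob_space_suffix_law)
    have m: "(\<lambda>q. indicator {q. snd (snd z) < q 0} q *
        indicator A (resume u z q) :: real) \<in> borel_measurable (suffix_law i)"
      if "A \<in> sets borel" for A
    proof -
      have "(\<lambda>q. (\<lambda>x. indicator {q. snd (snd z) <
          q 0} (snd x) * indicator A (resume u z (snd x)) :: real) ((), q)) \<in> borel_measurable real_sequences"
        by (rule measurable_compose[OF _ measurable_survivor_integrand[OF u that, of "\<lambda>_. z" "count_space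
            UNIV"]]) auto
      then show ?thesis by simp
    qed
    have i: "integrable (suffix_law i) (\<lambda>q. indicator {q. snd (snd z) <
        q 0} q * indicator A (resume u z q) :: real)"
      if "A \<in> sets borel" for A
      by (rule S.integrable_const_bound[where B = 1]) (use m[OF that] in \<open>auto simp: indicator_def\<close>)
    have "integrable (suffix_law i) (\<lambda>q. indicator {q. snd (snd z) < q 0} q :: real)"
      using i[of UNIV] by simp
    then have "survivor_integral u A i z \<le> survivor_mass i (snd (snd z))"
      unfolding survivor_integral_def survivor_mass_def
    proof (rule integral_mono[OF i[OF A]])
      show "indicator {q. snd (snd z) < q 0} q * indicator A (resume u z q) \<le>
          (indicator {q. snd (snd z) < q 0} q :: real)" for q
        by (simp add: indicator_def)
    qed
    moreover have "0 \<le> survivor_integral u A i z"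
      unfolding survivor_integral_def by (intro integral_nonneg_AE AE_I2) (auto simp: indicator_def)
    ultimately show ?thesis by blast
  qed
  have d: "0 \<le> x / y \<and> x / y \<le> 1" if "0 \<le> x" "x \<le> y" for x y :: real
    using that by (cases "y = 0") (auto simp: divide_le_eq_1)
  show "0 \<le> transition u A z" "transition u A z \<le> 1"
    using d b unfolding transition_def Let_def by blast+
qed

lemma mult_in_unit_interval: "x \<in> {0..1} \<Longrightarrow> y \<in> {0..1} \<Longrightarrow> x * y \<in> {0..1::real}"
  by (auto intro: mult_le_one)

text \<open>Freeze the prefix. Integrating the suffix turns the left side into
  \<open>g * survivor_integral\<close> and the right side into
  \<open>g * transition * survivor_mass\<close>; these agree by the definition of
  \<open>transition\<close> as a quotient, once parity has replaced suffix \<open>k\<close> by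
  suffix 0 or 1.\<close>

lemma transition_prefix_integral:
  fixes s :: real
  assumes u: "0 \<le> u" and A: "A \<in> sets borel" and C: "C \<in> sets (PiM {1..k} (\<lambda>_. borel))"
  defines "g \<equiv> \<lambda>p. indicator C p * (if renewal_time p k \<le> s then 1 else 0 :: real)"
  defines "h \<equiv> \<lambda>p q. indicator {q. s - renewal_time p k < q 0} q :: real"
  shows "(\<integral>\<omega>. g (prefix k \<omega>) * (h (prefix k \<omega>) (suffix k \<omega>) *
      indicator A (resume u (prefix_state k s (prefix k \<omega>)) (suffix k \<omega>))) \<partial>M) =
    (\<integral>\<omega>. g (prefix k \<omega>) * transition u A (prefix_state k s (prefix k \<omega>)) * h (prefix k \<omega>) (suffix k \<omega>) \<partial>M)"
proof -
  let ?P = "PiM {1..k} (\<lambda>_. borel :: real measure)"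
  have [measurable]: "(\<lambda>p. renewal_time p k) \<in> borel_measurable ?P" by (rule measurable_renewal_time_prefix) simp
  have g: "g \<in> borel_measurable ?P" unfolding g_def using C by measurable
  have hA: "(\<lambda>x. h (fst x) (snd x) * indicator A (resume u (prefix_state k s (fst x)) (snd x))) \<in>
      borel_measurable (?P \<Otimes>\<^sub>M real_sequences)"
    if "A \<in> sets borel" for A
    using measurable_survivor_integrand[OF u that measurable_prefix_state[of k s]]
        by (simp add: h_def prefix_state_def)
  have hm: "(\<lambda>x. h (fst x) (snd x)) \<in> borel_measurable (?P \<Otimes>\<^sub>M real_sequences)" using hA[of UNIV] by simp
  have g1: "(\<lambda>x. g (fst x)) \<in> borel_measurable (?P \<Otimes>\<^sub>M real_sequences)"
      by (rule measurable_compose[OF measurable_fst g])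
  have t1: "(\<lambda>x. transition u A (prefix_state k s (fst x))) \<in> borel_measurable (?P \<Otimes>\<^sub>M real_sequences)"
    by (rule measurable_compose[OF measurable_compose[OF measurable_fst measurable_prefix_state]
        measurable_transition[OF u A]])
  have gb: "g p \<in> {0..1}" for p by (simp add: g_def indicator_def)
  have hb: "h p q \<in> {0..1}" for p q by (simp add: h_def indicator_def)
  have ib: "indicator A x \<in> {0..1::real}" for x by (simp add: indicator_def)
  have tb: "transition u A z \<in> {0..1}" for z using transition_bounds[OF u A] by simp
  define G1 where "G1 x = g (fst x) * (h (fst x) (snd x) *
      indicator A (resume u (prefix_state k s (fst x)) (snd x)))" for x
  define G2 where "G2 x = g (fst x) * transition u A (prefix_state k s (fst x)) * h (fst x) (snd x)" for x
  have G1: "G1 \<in> borel_measurable (?P \<Otimes>\<^sub>M real_sequences)" "\<bar>G1 (p, q)\<bar> \<le> 1" for p q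
  proof -
    show "G1 \<in> borel_measurable (?P \<Otimes>\<^sub>M real_sequences)"
      unfolding G1_def[abs_def] by (rule borel_measurable_times[OF g1 hA[OF A]])
    have "G1 (p, q) \<in> {0..1}" unfolding G1_def by (intro mult_in_unit_interval gb hb ib)
    then show "\<bar>G1 (p, q)\<bar> \<le> 1" by simp
  qed
  have G2: "G2 \<in> borel_measurable (?P \<Otimes>\<^sub>M real_sequences)" "\<bar>G2 (p, q)\<bar> \<le> 1" for p q
  proof -
    show "G2 \<in> borel_measurable (?P \<Otimes>\<^sub>M real_sequences)"
      unfolding G2_def[abs_def] by (intro borel_measurable_times g1 t1 hm)
    have "G2 (p, q) \<in> {0..1}" unfolding G2_def by (intro mult_in_unit_interval gb hb tb)
    then show "\<bar>G2 (p, q)\<bar> \<le> 1" by simp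
  qed
  have "(\<integral>\<omega>. g (prefix k \<omega>) * (h (prefix k \<omega>) (suffix k \<omega>) *
      indicator A (resume u (prefix_state k s (prefix k \<omega>)) (suffix k \<omega>))) \<partial>M) =
     (\<integral>\<omega>. (\<integral>q. g (prefix k \<omega>) * (h (prefix k \<omega>) q *
         indicator A (resume u (prefix_state k s (prefix k \<omega>)) q)) \<partial>suffix_law k) \<partial>M)"
    using prefix_suffix_integral[OF G1] by (simp only: G1_def fst_conv snd_conv)
  also have "\<dots> = (\<integral>\<omega>. (\<integral>q. g (prefix k \<omega>) * transition u A (prefix_state k s (prefix k \<omega>)) *
      h (prefix k \<omega>) q \<partial>suffix_law k) \<partial>M)"
  proof (rule Bochner_Integration.integral_cong[OF refl])
    fix \<omega>
    define p where "p = prefix k \<omega>"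
    define i where "i = (if even k then 0 else 1 :: nat)"
    have law: "suffix_law k = suffix_law i" by (rule suffix_law_cong) (simp add: i_def)
    have num: "(\<integral>q. h p q * indicator A (resume u (prefix_state k s p) q) \<partial>suffix_law i) =
        survivor_integral u A i (prefix_state k s p)"
      by (simp add: survivor_integral_def h_def prefix_state_def)
    have den: "(\<integral>q. h p q \<partial>suffix_law i) = survivor_mass i (s - renewal_time p k)"
      by (simp add: survivor_mass_def h_def)
    have "fst (snd (prefix_state k s p)) = 1 \<longleftrightarrow> even k" by (cases "even k") (auto simp: prefix_state_def)
    then have tr: "transition u A (prefix_state k s p) =
        survivor_integral u A i (prefix_state k s p) / survivor_mass i (s - renewal_time p k)"
      unfolding transition_def Let_def i_def by (auto simp: prefix_state_def)
    have "g p * survivor_integral u A i (prefix_state k s p) =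
        g p * transition u A (prefix_state k s p) * survivor_mass i (s - renewal_time p k)"
    \<comment> \<open>Where the \<open>k\<close>-th renewal comes after \<open>s\<close>, the age
      would be negative and \<open>survivor_mass_pos\<close> does not apply, but there
      \<open>g\<close> vanishes.\<close>
    proof (cases "renewal_time p k \<le> s")
      case True
      then have "0 < survivor_mass i (s - renewal_time p k)" by (intro survivor_mass_pos) simp
      then show ?thesis unfolding tr by simp
    qed (simp add: g_def)
    then show "(\<integral>q. g (prefix k \<omega>) * (h (prefix k \<omega>) q *
        indicator A (resume u (prefix_state k s (prefix k \<omega>)) q)) \<partial>suffix_law k) =
       (\<integral>q. g (prefix k \<omega>) * transition u A (prefix_state k s (prefix k \<omega>)) * h (prefix k \<omega>) q \<partial>suffix_law k)"
      unfolding p_def[symmetric] law by (simp add: num den)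
  qed
  also have "\<dots> = (\<integral>\<omega>. g (prefix k \<omega>) * transition u A (prefix_state k s (prefix k \<omega>)) *
      h (prefix k \<omega>) (suffix k \<omega>) \<partial>M)"
    using prefix_suffix_integral[OF G2, symmetric] by (simp only: G2_def fst_conv snd_conv)
  finally show ?thesis .
qed

end

section \<open>Natural filtrations and conditional expectations\<close>

lemma space_generated_sigma [simp]: "space (generated_sigma M Z I) = space M"
  unfolding generated_sigma_def by (rule space_measure_of) auto

lemma sets_generated_sigma:
  "sets (generated_sigma M Z I) = sigma_sets (space M) (\<Union>u\<in>I. {Z u -` A \<inter> space M |A. A \<in> sets borel})"
  unfolding generated_sigma_def by (rule sets_measure_of) auto

lemma measurable_generated_sigma:
  assumes "u \<in> I" shows "Z u \<in> borel_measurable (generated_sigma M Z I)"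
proof (rule measurableI)
  fix A :: "'b set" assume "A \<in> sets borel"
  then show "Z u -` A \<inter> space (generated_sigma M Z I) \<in> sets (generated_sigma M Z I)"
    unfolding sets_generated_sigma space_generated_sigma using assms by (intro sigma_sets.Basic) blast
qed simp

lemma sets_generated_sigma_le:
  assumes "\<And>u. u \<in> I \<Longrightarrow> Z u \<in> borel_measurable N" "space N = space M"
  shows "sets (generated_sigma M Z I) \<subseteq> sets N"
  unfolding sets_generated_sigma
proof (rule sets.sigma_sets_subset'[where M = N, simplified assms(2)[symmetric], unfolded assms(2)])
qed (use assms in \<open>auto simp: assms(2)[symmetric] intro: measurable_sets\<close>)

context alternating_renewal begin

abbreviation path :: "real \<Rightarrow> 'c \<Rightarrow> real \<times> real \<times> real" where
  "path t \<omega> \<equiv> limit_path (\<lambda>k. e k \<omega>) t"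

abbreviation epoch :: "nat \<Rightarrow> 'c \<Rightarrow> real" where
  "epoch k \<omega> \<equiv> renewal_time (\<lambda>j. e j \<omega>) k"

lemma measurable_path: "0 \<le> t \<Longrightarrow> path t \<in> borel_measurable M"
  by (rule measurable_limit_path) auto

lemma epoch_prefix: "j \<le> k \<Longrightarrow> renewal_time (prefix k \<omega>) j = epoch j \<omega>"
  unfolding renewal_time_def by (intro sum.cong) (auto simp: prefix_def)

text \<open>Induction over the generated sigma-algebra. For a generator at time
  \<open>u \<le> s\<close>, \<open>limit_path_prefix\<close> rewrites the path through the padded
  prefix; complements and countable unions carry over because the restricting event stays
  fixed.\<close>

lemma past_event_prefix:
  assumes s: "0 \<le> s" and B: "B \<in> sets (generated_sigma M path {0..s})"
  shows "\<exists>C\<in>sets (PiM {1..k} (\<lambda>_. borel)). \<forall>\<omega>\<in>space M. renewal_sequence (\<lambda>k. e k \<omega>) \<and> epoch k \<omega> \<le> s \<and>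
      s < epoch (Suc k) \<omega> \<longrightarrow>
     (\<omega> \<in> B \<longleftrightarrow> prefix k \<omega> \<in> C)"
  using B unfolding sets_generated_sigma
proof (induction rule: sigma_sets.induct)
  case (Basic B)
  then obtain u A where u: "u \<in> {0..s}" and A: "A \<in> sets borel" "B = path u -` A \<inter> space M" by blast
  let ?P = "PiM {1..k} (\<lambda>_. borel :: real measure)"
  have m: "(\<lambda>p. limit_path (\<lambda>j. if j \<in> {1..k} then p j else s + 1) u) \<in> borel_measurable ?P"
  proof (rule measurable_limit_path)
    show "\<forall>j. (\<lambda>p. if Suc j \<in> {1..k} then p (Suc j) else s + 1) \<in> borel_measurable ?P"
    proof
      fix j show "(\<lambda>p. if Suc j \<in> {1..k} then p (Suc j) else s + 1) \<in> borel_measurable ?P"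
        by (cases "Suc j \<in> {1..k}") (auto intro: measurable_component_singleton)
    qed
  qed (use u in auto)
  define C where "C = (\<lambda>p. limit_path (\<lambda>j. if j \<in> {1..k} then p j else s + 1) u) -` A \<inter> space ?P"
  have "C \<in> sets ?P" unfolding C_def by (rule measurable_sets[OF m A(1)])
  moreover have "\<omega> \<in> B \<longleftrightarrow> prefix k \<omega> \<in> C"
    if \<omega>: "\<omega> \<in> space M" "renewal_sequence (\<lambda>k. e k \<omega>)" "epoch k \<omega> \<le> s" "s < epoch (Suc k) \<omega>" for \<omega>
  proof -
    have "(\<lambda>j. if j \<in> {1..k} then prefix k \<omega> j else s + 1) = (\<lambda>j. if j \<in> {1..k} then e j \<omega> else s + 1)"
      by (auto simp: prefix_def)
    then have "limit_path (\<lambda>j. if j \<in> {1..k} then prefix k \<omega> j else s + 1) u = path u \<omega>"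
      using limit_path_prefix[OF \<omega>(2-4)] u by simp
    moreover have "prefix k \<omega> \<in> space ?P" by (rule measurable_space[OF measurable_prefix \<omega>(1)])
    ultimately show ?thesis using \<omega>(1) by (simp add: C_def A(2))
  qed
  ultimately show ?case by blast
next
  case Empty
  show ?case by (intro bexI[of _ "{}"]) auto
next
  case (Compl B)
  then obtain C where C: "C \<in> sets (PiM {1..k} (\<lambda>_. borel))"
    "\<forall>\<omega>\<in>space M. renewal_sequence (\<lambda>k. e k \<omega>) \<and> epoch k \<omega> \<le> s \<and>
        s < epoch (Suc k) \<omega> \<longrightarrow> (\<omega> \<in> B \<longleftrightarrow> prefix k \<omega> \<in> C)" by blast
  then show ?case
    using measurable_space[OF measurable_prefix[of k]]
    by (intro bexI[of _ "space (PiM {1..k} (\<lambda>_. borel)) - C"]) auto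
next
  case (Union B)
  then obtain C where C: "\<And>i::nat. C i \<in> sets (PiM {1..k} (\<lambda>_. borel))"
    "\<And>i. \<forall>\<omega>\<in>space M. renewal_sequence (\<lambda>k. e k \<omega>) \<and> epoch k \<omega> \<le> s \<and>
        s < epoch (Suc k) \<omega> \<longrightarrow> (\<omega> \<in> B i \<longleftrightarrow> prefix k \<omega> \<in> C i)"
    by metis
  then show ?case by (intro bexI[of _ "\<Union>i. C i"]) auto
qed

text \<open>On the event of exactly \<open>k\<close> renewals up to \<open>s\<close>, the past event
  becomes a condition \<open>C\<close> on the prefix, and the survival of the running waiting time a
  condition \<open>h\<close> linking prefix and suffix. Future and present become
  \<open>resume\<close> and \<open>prefix_state\<close>, so
  \<open>transition_prefix_integral\<close> applies.\<close>

lemma transition_integral_past_interval: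
  assumes s: "0 \<le> s" and u: "0 \<le> u" and A: "A \<in> sets borel" and B: "B \<in> sets (generated_sigma M path {0..s})"
  defines "D \<equiv> \<lambda>\<omega>. indicator A (path (s + u) \<omega>) - transition u A (path s \<omega>)"
  shows "(LINT \<omega>:(B \<inter> {\<omega>\<in>space M. epoch k \<omega> \<le> s \<and> s < epoch (Suc k) \<omega>})|M. D \<omega>) = 0"
proof -
  obtain C where C: "C \<in> sets (PiM {1..k} (\<lambda>_. borel))"
    "\<And>\<omega>. \<omega> \<in> space M \<Longrightarrow> renewal_sequence (\<lambda>k. e k \<omega>) \<Longrightarrow> epoch k \<omega> \<le> s \<Longrightarrow> s < epoch (Suc k) \<omega> \<Longrightarrow> \<omega> \<in> B \<longleftrightarrow> prefix k \<omega> \<in> C"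
    using past_event_prefix[OF s B, of k] by blast
  have B_meas: "B \<in> events"
    using sets_generated_sigma_le[of "{0..s}" path M M] measurable_path B by auto
  have [measurable]: "epoch j \<in> borel_measurable M" for j by (rule measurable_renewal_time) auto
  have [measurable]: "path s \<in> borel_measurable M" "path (s + u) \<in> borel_measurable M"
    using measurable_path s u by auto
  define E where "E = {\<omega>\<in>space M. epoch k \<omega> \<le> s \<and> s < epoch (Suc k) \<omega>}"
  have E_meas: "E \<in> events" unfolding E_def by measurable
  define g where "g p = indicator C p * (if renewal_time p k \<le> s then 1 else 0 :: real)" for p
  define h where "h p q = (indicator {q. s - renewal_time p k < q 0} q :: real)" for p and q :: "nat \<Rightarrow> real"
  have [measurable]: "(\<lambda>\<omega>. g (prefix k \<omega>)) \<in> borel_measurable M"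
  proof (rule measurable_compose[OF measurable_prefix])
    have [measurable]: "(\<lambda>p. renewal_time p k) \<in> borel_measurable (PiM {1..k} (\<lambda>_. borel))"
      by (rule measurable_renewal_time_prefix) simp
    show "g \<in> borel_measurable (PiM {1..k} (\<lambda>_. borel))" unfolding g_def[abs_def] using C(1) by measurable
  qed
  have tm: "(\<lambda>\<omega>. transition u A (prefix_state k s (prefix k \<omega>))) \<in> borel_measurable M"
    by (rule measurable_compose[OF measurable_compose[OF measurable_prefix measurable_prefix_state]
        measurable_transition[OF u A]])
  have rm: "(\<lambda>\<omega>. indicator A (resume u (prefix_state k s (prefix k \<omega>)) (suffix k \<omega>)) :: real) \<in> borel_measurable M"
  proof -
    have "(\<lambda>\<omega>. resume u (prefix_state k s (prefix k \<omega>)) (suffix k \<omega>)) \<in> borel_measurable M"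
      by (rule measurable_resume[OF measurable_compose[OF measurable_prefix measurable_prefix_state] _ u])
         (simp add: suffix_def)
    then show ?thesis by (rule measurable_compose) (use A in simp)
  qed
  have hm: "(\<lambda>\<omega>. h (prefix k \<omega>) (suffix k \<omega>)) \<in> borel_measurable M"
  proof -
    have "h (prefix k \<omega>) (suffix k \<omega>) = (if s - epoch k \<omega> < e (Suc k) \<omega> then 1 else 0)" for \<omega>
      by (simp add: h_def suffix_def epoch_prefix indicator_def)
    then show ?thesis by simp
  qed
  have key: "indicator (B \<inter> E) \<omega> = g (prefix k \<omega>) * h (prefix k \<omega>) (suffix k \<omega>)"
    "\<omega> \<in> B \<inter> E \<Longrightarrow> path s \<omega> = prefix_state k s (prefix k \<omega>)"
    "\<omega> \<in> B \<inter> E \<Longrightarrow> path (s + u) \<omega> = resume u (prefix_state k s (prefix k \<omega>)) (suffix k \<omega>)"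
    if \<omega>: "\<omega> \<in> space M" "renewal_sequence (\<lambda>k. e k \<omega>)" for \<omega>
  proof -
    have "(s - epoch k \<omega> < suffix k \<omega> 0) \<longleftrightarrow> s < epoch (Suc k) \<omega>"
      by (auto simp: suffix_def renewal_time_Suc)
    then show "indicator (B \<inter> E) \<omega> = g (prefix k \<omega>) * h (prefix k \<omega>) (suffix k \<omega>)"
      using C(2)[OF \<omega>] \<omega>(1) by (auto simp: g_def h_def E_def epoch_prefix indicator_def)
    assume "\<omega> \<in> B \<inter> E"
    then have E: "epoch k \<omega> \<le> s" "s < epoch (Suc k) \<omega>" by (auto simp: E_def)
    show st: "path s \<omega> = prefix_state k s (prefix k \<omega>)"
      using E \<omega>(2) epoch_prefix by (intro prefix_state_eq[symmetric]) auto
    show "path (s + u) \<omega> = resume u (prefix_state k s (prefix k \<omega>)) (suffix k \<omega>)"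
      unfolding st[symmetric] using limit_path_add[OF \<omega>(2) E _ u, of "suffix k \<omega>"] by (simp add: suffix_def)
  qed
  have D_meas: "D \<in> borel_measurable M"
    unfolding D_def using A measurable_compose[OF _ measurable_transition[OF u A], of "path s" M] by measurable
  have int: "integrable M (\<lambda>\<omega>. X \<omega> :: real)" if "X \<in> borel_measurable M" "\<And>\<omega>. X \<omega> \<in> {0..1}" for X
    using that by (intro integrable_const_bound[where B = 1]) (auto intro!: AE_I2)
  have gb: "g p \<in> {0..1}" for p by (simp add: g_def indicator_def)
  have hb: "h p q \<in> {0..1}" for p q by (simp add: h_def indicator_def)
  have ib: "indicator A x \<in> {0..1::real}" for x by (simp add: indicator_def)
  have tb: "transition u A z \<in> {0..1}" for z using transition_bounds[OF u A] by simp
  define F1 where "F1 \<omega> = g (prefix k \<omega>) * (h (prefix k \<omega>) (suffix k \<omega>) *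
      indicator A (resume u (prefix_state k s (prefix k \<omega>)) (suffix k \<omega>)))" for \<omega>
  define F2 where "F2 \<omega> = g (prefix k \<omega>) * transition u A (prefix_state k s (prefix k \<omega>)) *
      h (prefix k \<omega>) (suffix k \<omega>)" for \<omega>
  have F1: "integrable M F1"
    unfolding F1_def[abs_def] by (intro int mult_in_unit_interval gb hb ib borel_measurable_times rm hm) measurable
  have F2: "integrable M F2"
    unfolding F2_def[abs_def] by (intro int mult_in_unit_interval gb hb tb borel_measurable_times tm hm) measurable
  have "(LINT \<omega>:(B \<inter> E)|M. D \<omega>) = (\<integral>\<omega>. F1 \<omega> - F2 \<omega> \<partial>M)"
    unfolding set_lebesgue_integral_def
  proof (rule integral_cong_AE)
    show "(\<lambda>\<omega>. indicator (B \<inter> E) \<omega> *\<^sub>R D \<omega>) \<in> borel_measurable M"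
      using B_meas E_meas D_meas by measurable
    show "(\<lambda>\<omega>. F1 \<omega> - F2 \<omega>) \<in> borel_measurable M" using F1 F2 by measurable
    show "AE \<omega> in M. indicator (B \<inter> E) \<omega> *\<^sub>R D \<omega> = F1 \<omega> - F2 \<omega>"
    proof (rule AE_mp[OF AE_renewal_sequence], intro AE_I2 impI)
      fix \<omega> assume \<omega>: "\<omega> \<in> space M" "renewal_sequence (\<lambda>k. e k \<omega>)"
      show "indicator (B \<inter> E) \<omega> *\<^sub>R D \<omega> = F1 \<omega> - F2 \<omega>"
      proof (cases "\<omega> \<in> B \<inter> E")
        case True
        then have "g (prefix k \<omega>) * h (prefix k \<omega>) (suffix k \<omega>) = 1" using key(1)[OF \<omega>] by simp
        moreover have "F1 \<omega> - F2 \<omega> = (g (prefix k \<omega>) * h (prefix k \<omega>) (suffix k \<omega>)) * D \<omega>"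
          unfolding F1_def F2_def D_def key(2)[OF \<omega> True] key(3)[OF \<omega> True] by (simp only: algebra_simps)
        ultimately show ?thesis using True by simp
      next
        case False
        then have "g (prefix k \<omega>) * h (prefix k \<omega>) (suffix k \<omega>) = 0" using key(1)[OF \<omega>] by simp
        then have "g (prefix k \<omega>) = 0 \<or> h (prefix k \<omega>) (suffix k \<omega>) = 0" by simp
        then show ?thesis using False by (auto simp: F1_def F2_def)
      qed
    qed
  qed
  also have "\<dots> = (\<integral>\<omega>. F1 \<omega> \<partial>M) - (\<integral>\<omega>. F2 \<omega> \<partial>M)" by (rule Bochner_Integration.integral_diff[OF F1 F2])
  also have "\<dots> = 0"
    using transition_prefix_integral[OF u A C(1), of s] unfolding F1_def F2_def g_def h_def by simp
  finally show ?thesis unfolding E_def .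
qed

text \<open>Decompose \<open>B\<close> by the number of renewals up to \<open>s\<close> and sum the
  pieces, each of which contributes 0.\<close>

lemma transition_integral_past:
  assumes s: "0 \<le> s" and u: "0 \<le> u" and A: "A \<in> sets borel" and B: "B \<in> sets (generated_sigma M path {0..s})"
  shows "(LINT \<omega>:B|M. indicator A (path (s + u) \<omega>)) = (LINT \<omega>:B|M. transition u A (path s \<omega>))"
    and "integrable M (\<lambda>\<omega>. indicator A (path (s + u) \<omega>) :: real)" "integrable M (\<lambda>\<omega>. transition u A (path s \<omega>))"
proof -
  have B_meas: "B \<in> events"
    using sets_generated_sigma_le[of "{0..s}" path M M] measurable_path B by auto
  have [measurable]: "epoch j \<in> borel_measurable M" for j by (rule measurable_renewal_time) auto
  have [measurable]: "path s \<in> borel_measurable M" "path (s + u) \<in> borel_measurable M"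
    using measurable_path s u by auto
  show i1: "integrable M (\<lambda>\<omega>. indicator A (path (s + u) \<omega>) :: real)"
    using A by (intro integrable_const_bound[where B = 1]) (auto simp: indicator_def)
  show i2: "integrable M (\<lambda>\<omega>. transition u A (path s \<omega>))"
    using transition_bounds[OF u A] measurable_compose[OF _ measurable_transition[OF u A], of "path s" M]
    by (intro integrable_const_bound[where B = 1]) (auto intro!: AE_I2)
  define D where "D \<omega> = indicator A (path (s + u) \<omega>) - transition u A (path s \<omega>)" for \<omega>
  have D: "integrable M D" unfolding D_def[abs_def] using i1 i2 by simp
  \<comment> \<open>Intersecting with the renewal sequences makes the pieces disjoint everywhere, as
    countable additivity of the integral demands; the intersection removes only a null set.\<close>
  define E where "E k = B \<inter> {\<omega>\<in>space M. epoch k \<omega> \<le> s \<and>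
      s < epoch (Suc k) \<omega>} \<inter> {\<omega>\<in>space M. renewal_sequence (\<lambda>k. e k \<omega>)}" for k
  have good: "{\<omega>\<in>space M. renewal_sequence (\<lambda>k. e k \<omega>)} \<in> events"
    by (rule sets_renewal_sequence) simp
  have E_meas: "E k \<in> events" for k unfolding E_def using B_meas good by measurable
  have disj: "E j \<inter> E k = {}" if "j \<noteq> k" for j k
  proof -
    have "\<not> (\<omega> \<in> E j \<and> \<omega> \<in> E k)" for \<omega>
    proof
      assume a: "\<omega> \<in> E j \<and> \<omega> \<in> E k"
      then have e: "renewal_sequence (\<lambda>k. e k \<omega>)" by (simp add: E_def)
      have "i \<le> k \<longleftrightarrow> i \<le> j" for i
        using a renewal_time_le_iff_le[OF e, of k s i] renewal_time_le_iff_le[OF e, of j s i] by (simp add: E_def)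
      then show False using that by (metis order_antisym order_refl)
    qed
    then show ?thesis by blast
  qed
  have E0: "(LINT \<omega>:E k|M. D \<omega>) = 0" for k
  proof -
    have "(LINT \<omega>:E k|M. D \<omega>) = (LINT \<omega>:(B \<inter> {\<omega>\<in>space M. epoch k \<omega> \<le> s \<and> s < epoch (Suc k) \<omega>})|M. D \<omega>)"
      unfolding set_lebesgue_integral_def
    proof (rule integral_cong_AE)
      show "(\<lambda>\<omega>. indicator (E k) \<omega> *\<^sub>R D \<omega>) \<in> borel_measurable M" using E_meas D by measurable
      show "(\<lambda>\<omega>. indicator (B \<inter> {\<omega>\<in>space M. epoch k \<omega> \<le> s \<and> s < epoch (Suc k) \<omega>}) \<omega> *\<^sub>R D \<omega>) \<in> borel_measurable M"
        using B_meas D by measurable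
      show "AE \<omega> in M. indicator (E k) \<omega> *\<^sub>R D \<omega> = indicator (B \<inter> {\<omega>\<in>space M. epoch k \<omega> \<le> s \<and>
          s < epoch (Suc k) \<omega>}) \<omega> *\<^sub>R D \<omega>"
        using AE_renewal_sequence by eventually_elim (auto simp: E_def indicator_def)
    qed
    then show ?thesis using transition_integral_past_interval[OF s u A B, of k] by (simp add: D_def)
  qed
  have "(LINT \<omega>:B|M. D \<omega>) = (LINT \<omega>:(\<Union>k. E k)|M. D \<omega>)"
    unfolding set_lebesgue_integral_def
  proof (rule integral_cong_AE)
    show "(\<lambda>\<omega>. indicator B \<omega> *\<^sub>R D \<omega>) \<in> borel_measurable M" using B_meas D by measurable
    show "(\<lambda>\<omega>. indicator (\<Union>k. E k) \<omega> *\<^sub>R D \<omega>) \<in> borel_measurable M" using E_meas D by measurable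
    show "AE \<omega> in M. indicator B \<omega> *\<^sub>R D \<omega> = indicator (\<Union>k. E k) \<omega> *\<^sub>R D \<omega>"
    proof (rule AE_mp[OF AE_renewal_sequence], intro AE_I2 impI)
      fix \<omega> assume \<omega>: "\<omega> \<in> space M" "renewal_sequence (\<lambda>k. e k \<omega>)"
      obtain K where "s < epoch K \<omega>" using renewal_time_unbounded[OF \<omega>(2)] by blast
      then obtain k where "epoch k \<omega> \<le> s" "s < epoch (Suc k) \<omega>"
        using breakpoint_interval[of "\<lambda>k. epoch k \<omega>" s K] s by auto
      then have "\<omega> \<in> B \<longleftrightarrow> \<omega> \<in> (\<Union>k. E k)" using \<omega> by (auto simp: E_def)
      then show "indicator B \<omega> *\<^sub>R D \<omega> = indicator (\<Union>k. E k) \<omega> *\<^sub>R D \<omega>" by (simp add: indicator_def)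
    qed
  qed
  also have "\<dots> = (\<Sum>k. (LINT \<omega>:E k|M. D \<omega>))"
  proof (rule lebesgue_integral_countable_add[OF E_meas disj])
    show "set_integrable M (\<Union>k. E k) D"
      using E_meas D unfolding set_integrable_def by (intro integrable_mult_indicator) auto
  qed
  also have "\<dots> = 0" unfolding E0 by simp
  finally have "(LINT \<omega>:B|M. D \<omega>) = 0" .
  moreover have "(LINT \<omega>:B|M. D \<omega>) = (LINT \<omega>:B|M. indicator A (path (s + u) \<omega>)) -
      (LINT \<omega>:B|M. transition u A (path s \<omega>))"
    unfolding D_def using integrable_mult_indicator[OF B_meas i1] integrable_mult_indicator[OF B_meas i2]
    by (intro set_integral_diff) (simp_all only: set_integrable_def)
  ultimately show "(LINT \<omega>:B|M. indicator A (path (s + u) \<omega>)) = (LINT \<omega>:B|M. transition u A (path s \<omega>))" by simp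
qed

text \<open>The filtration of the image is contained in that of the path, so the identity for past
  events of the path applies. If the transition probability factors through \<open>\<pi>\<close>, it
  is measurable with respect to the present of the image and hence a version of the conditional
  expectation.\<close>

lemma markov_process_image:
  fixes \<pi> :: "real \<times> real \<times> real \<Rightarrow> 'x::topological_space"
  assumes \<pi>: "\<pi> \<in> borel_measurable borel"
    and factor: "\<And>u A. 0 \<le> u \<Longrightarrow> A \<in> sets borel \<Longrightarrow>
      \<exists>h\<in>borel_measurable borel. \<forall>z. transition u (\<pi> -` A) z = h (\<pi> z)"
  shows "markov_process M (\<lambda>t \<omega>. \<pi> (path t \<omega>))"
  unfolding markov_process_def
proof (intro conjI allI impI)
  show W: "(\<lambda>\<omega>. \<pi> (path t \<omega>)) \<in> borel_measurable M" if "0 \<le> t" for t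
    using \<pi> by (rule measurable_compose[OF measurable_path[OF that]])
  fix s t :: real and A :: "'x set"
  assume st: "0 \<le> s \<and> s \<le> t \<and> A \<in> sets borel"
  let ?W = "\<lambda>t \<omega>. \<pi> (path t \<omega>)"
  have A: "\<pi> -` A \<in> sets borel" using measurable_sets[OF \<pi>, of A] st by simp
  have u: "0 \<le> t - s" and s: "0 \<le> s" using st by auto
  obtain h where h: "h \<in> borel_measurable borel" "\<And>z. transition (t - s) (\<pi> -` A) z = h (\<pi> z)"
    using factor[OF u] st by blast
  have ind: "indicator A (?W t \<omega>) = (indicator (\<pi> -` A) (path (s + (t - s)) \<omega>) :: real)" for \<omega>
    by (simp add: indicator_def)
  \<comment> \<open>One argument serves both the past \<open>I = {0..s}\<close> and the present
    \<open>I = {s}\<close>; the two conditional expectations then agree with the same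
    function.\<close>
  have cond: "AE \<omega> in M. real_cond_exp M (generated_sigma M ?W I) (\<lambda>\<omega>. indicator A (?W t \<omega>)) \<omega> = h (?W s \<omega>)"
    if I: "s \<in> I" "I \<subseteq> {0..s}" for I
  proof -
    let ?F = "generated_sigma M ?W I"
    have "?W r \<in> borel_measurable M" if "r \<in> I" for r using that I by (intro W) auto
    then have sub: "subalgebra M ?F"
      unfolding subalgebra_def by (intro conjI sets_generated_sigma_le) auto
    interpret F: finite_measure_subalgebra M ?F by standard (rule sub)
    have "sets ?F \<subseteq> sets (generated_sigma M path {0..s})"
    proof (rule sets_generated_sigma_le)
      show "?W r \<in> borel_measurable (generated_sigma M path {0..s})" if "r \<in> I" for r
        using that I by (intro measurable_compose[OF measurable_generated_sigma \<pi>]) auto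
    qed simp
    then have past: "B \<in> sets (generated_sigma M path {0..s})" if "B \<in> sets ?F" for B using that by blast
    show ?thesis
    proof (rule F.real_cond_exp_charact)
      show "(LINT \<omega>:B|M. indicator A (?W t \<omega>)) = (LINT \<omega>:B|M. h (?W s \<omega>))" if "B \<in> sets ?F" for B
        using transition_integral_past(1)[OF s u A past[OF that]] unfolding ind h(2) .
      show "integrable M (\<lambda>\<omega>. indicator A (?W t \<omega>) :: real)"
        using transition_integral_past(2)[OF s u A sets.empty_sets] unfolding ind .
      show "integrable M (\<lambda>\<omega>. h (?W s \<omega>))"
        using transition_integral_past(3)[OF s u A sets.empty_sets] unfolding h(2) .
      show "(\<lambda>\<omega>. h (?W s \<omega>)) \<in> borel_measurable ?F"
        by (rule measurable_compose[OF measurable_generated_sigma[OF I(1)] h(1)])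
    qed
  qed
  have "AE \<omega> in M. real_cond_exp M (generated_sigma M ?W {0..s}) (\<lambda>\<omega>. indicator A (?W t \<omega>)) \<omega> = h (?W s \<omega>)"
    "AE \<omega> in M. real_cond_exp M (generated_sigma M ?W {s}) (\<lambda>\<omega>. indicator A (?W t \<omega>)) \<omega> = h (?W s \<omega>)"
    using s by (intro cond; simp)+
  then show "AE \<omega> in M. real_cond_exp M (generated_sigma M ?W {0..s}) (\<lambda>\<omega>. indicator A (?W t \<omega>)) \<omega> =
      real_cond_exp M (generated_sigma M ?W {s}) (\<lambda>\<omega>. indicator A (?W t \<omega>)) \<omega>"
    by eventually_elim simp
qed

lemma markov_process_path: "markov_process M path"
  using markov_process_image[of "\<lambda>z. z"] measurable_transition by auto

text \<open>For a target set that ignores the position, \<open>snd_resume_cong\<close> shows that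
  the starting position may be set to 0 in \<open>transition\<close>.\<close>

lemma markov_process_telegraph_age: "markov_process M (\<lambda>t \<omega>. snd (path t \<omega>))"
proof (rule markov_process_image)
  show "(snd :: real \<times> real \<times> real \<Rightarrow> real \<times> real) \<in> borel_measurable borel" by (simp add: borel_prod[symmetric])
  fix u :: real and A :: "(real \<times> real) set"
  assume u: "0 \<le> u" and A: "A \<in> sets borel"
  let ?A = "snd -` A :: (real \<times> real \<times> real) set"
  have A': "?A \<in> sets borel"
    using measurable_sets[OF \<open>(snd :: real \<times> real \<times> real \<Rightarrow> real \<times> real) \<in> borel_measurable borel\<close> A] by simp
  have "transition u ?A z = transition u ?A (0, snd z)" for z
  proof -
    have "indicator ?A (resume u z q) = (indicator ?A (resume u (0, snd z) q) :: real)" for q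
      using snd_resume_cong[of z "(0, snd z)" u q] by (simp add: indicator_def)
    then show ?thesis by (simp add: transition_def survivor_integral_def)
  qed
  moreover have "(\<lambda>y. transition u ?A (0, y)) \<in> borel_measurable borel"
    by (rule measurable_compose[OF _ measurable_transition[OF u A']]) (simp add: borel_prod[symmetric])
  ultimately show "\<exists>h\<in>borel_measurable borel. \<forall>z. transition u ?A z = h (snd z)"
    by (intro bexI[of _ "\<lambda>y. transition u ?A (0, y)"]) auto
qed

end

theorem theorem5p1:
  fixes f :: "nat \<Rightarrow> real \<Rightarrow> real"
    and M :: "'c measure" and e :: "nat \<Rightarrow> 'c \<Rightarrow> real"
    and \<epsilon>0 :: real
    and P :: "real \<Rightarrow> 'b measure"
    and X :: "real \<Rightarrow> nat \<Rightarrow> 'b \<Rightarrow> real" and A :: "real \<Rightarrow> nat \<Rightarrow> 'b \<Rightarrow> nat"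
    and \<alpha> \<alpha>t :: "real \<Rightarrow> nat \<Rightarrow> nat \<Rightarrow> real"
  assumes f_cadlag: "\<And>i. i \<in> {1, 2} \<Longrightarrow> cadlag (f i)"
    and f_pos: "\<And>i t. i \<in> {1, 2} \<Longrightarrow> t \<ge> 0 \<Longrightarrow> f i t > 0"
    and f_int: "\<And>i. i \<in> {1, 2} \<Longrightarrow> (\<integral>\<^sup>+u\<in>{0..}. ennreal (f i u) \<partial>lborel) = \<infinity>"
    and M: "prob_space M"
    and e_indep: "prob_space.indep_vars M (\<lambda>_. borel) e {1..}"
    and e_odd: "\<And>n t. n \<ge> 1 \<Longrightarrow> t \<ge> 0 \<Longrightarrow>
      \<P>(\<omega> in M. e (2 * n - 1) \<omega> > t) = exp (- (LBINT u:{0..t}. f 2 u))"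
    and e_even: "\<And>n t. n \<ge> 1 \<Longrightarrow> t \<ge> 0 \<Longrightarrow>
      \<P>(\<omega> in M. e (2 * n) \<omega> > t) = exp (- (LBINT u:{0..t}. f 1 u))"
    and \<epsilon>0: "\<epsilon>0 > 0"
    and P: "\<And>\<epsilon>. \<epsilon> \<in> {0<..<\<epsilon>0} \<Longrightarrow> prob_space (P \<epsilon>)"
    and chain: "\<And>\<epsilon>. \<epsilon> \<in> {0<..<\<epsilon>0} \<Longrightarrow>
      markov_chain (P \<epsilon>) prw_states (prw_kernel (\<alpha> \<epsilon>)) (\<lambda>n \<omega>. (X \<epsilon> n \<omega>, A \<epsilon> n \<omega>))"
    and start: "\<And>\<epsilon>. \<epsilon> \<in> {0<..<\<epsilon>0} \<Longrightarrow> AE \<omega> in P \<epsilon>. X \<epsilon> 0 \<omega> = 1 \<and> A \<epsilon> 0 \<omega> = 1"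
    and \<alpha>_range: "\<And>\<epsilon> i n. \<epsilon> \<in> {0<..<\<epsilon>0} \<Longrightarrow> i \<in> {1, 2} \<Longrightarrow> n \<ge> 1 \<Longrightarrow> 0 < \<alpha> \<epsilon> i n \<and> \<alpha> \<epsilon> i n < 1"
    and \<alpha>_eq: "\<And>\<epsilon> i n. \<epsilon> \<in> {0<..<\<epsilon>0} \<Longrightarrow> i \<in> {1, 2} \<Longrightarrow> n \<ge> 1 \<Longrightarrow>
      \<alpha> \<epsilon> i n = f i (real n * \<epsilon>) * \<epsilon> + \<alpha>t \<epsilon> i n * \<epsilon>"
    and \<alpha>t_lim: "((\<lambda>\<epsilon>. SUP i\<in>{1, 2}. SUP n\<in>{1..}. ereal \<bar>\<alpha>t \<epsilon> i n\<bar>) \<longlongrightarrow> 0) (at_right 0)"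
  shows "(\<forall>n\<ge>1. conv_in_distribution (product_topology (\<lambda>_. euclidean) {1..n})
        P (\<lambda>\<epsilon> \<omega>. \<lambda>k\<in>{1..n}. scaled_gap \<epsilon> (\<lambda>j. X \<epsilon> j \<omega>) k)
        M (\<lambda>\<omega>. \<lambda>k\<in>{1..n}. ereal (e k \<omega>)) (at_right 0)) \<and>
    conv_in_distribution skorohod_topology
        P (\<lambda>\<epsilon> \<omega> t. (scaled_walk \<epsilon> (\<lambda>j. X \<epsilon> j \<omega>) t, scaled_step \<epsilon> (\<lambda>j. X \<epsilon> j \<omega>) t,
                      scaled_age \<epsilon> (\<lambda>j. A \<epsilon> j \<omega>) t))
        M (\<lambda>\<omega> t. (integrated_telegraph (\<lambda>k. e k \<omega>) t, telegraph (\<lambda>k. e k \<omega>) t,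
                    renewal_age (\<lambda>k. e k \<omega>) t)) (at_right 0) \<and>
    markov_process M (\<lambda>t \<omega>. (integrated_telegraph (\<lambda>k. e k \<omega>) t, telegraph (\<lambda>k. e k \<omega>) t,
                    renewal_age (\<lambda>k. e k \<omega>) t)) \<and>
    markov_process M (\<lambda>t \<omega>. (telegraph (\<lambda>k. e k \<omega>) t, renewal_age (\<lambda>k. e k \<omega>) t))"
proof -
  interpret prob_space M by (rule M)
  \<comment> \<open>Sojourn \<open>k\<close> is \<open>e (Suc k)\<close>, so an even
    \<open>k\<close> belongs to an odd index and to the rate \<open>f 2\<close>.\<close>
  have tail: "prob {\<omega>\<in>space M. e (Suc k) \<omega> > t} = survival (f (rate_index k)) t" if "t \<ge> 0" for k t
  proof (cases "even k")
    case True
    then obtain m where "k = 2 * m" by (elim evenE)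
    then show ?thesis using e_odd[of "Suc m" t] that by (simp add: rate_index_def survival_def)
  next
    case False
    then obtain m where "k = 2 * m + 1" by (elim oddE)
    then show ?thesis using e_even[of "Suc m" t] that by (simp add: rate_index_def survival_def)
  qed
  interpret W: alternating_renewal M f e
    by unfold_locales (use f_cadlag f_pos f_int e_indep tail in auto)
  have range: "\<forall>i\<in>{1, 2}. \<forall>n\<ge>1. 0 < \<alpha> \<epsilon> i n \<and> \<alpha> \<epsilon> i n < 1" if "\<epsilon> \<in> {0<..<\<epsilon>0}" for \<epsilon>
    using \<alpha>_range[OF that] by blast
  \<comment> \<open>The supremum lives in the extended reals; once it is below \<open>\<eta>\<close>
    it bounds every perturbation uniformly in \<open>n\<close>.\<close>
  have small: "\<forall>\<^sub>F \<epsilon> in at_right 0. \<forall>n\<ge>1. \<bar>\<alpha>t \<epsilon> i n\<bar> \<le> \<eta>" if "\<eta> > 0" "i \<in> {1, 2}" for \<eta> i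
  proof -
    have "\<forall>\<^sub>F \<epsilon> in at_right 0. (SUP i\<in>{1, 2}. SUP n\<in>{1..}. ereal \<bar>\<alpha>t \<epsilon> i n\<bar>) < ereal \<eta>"
      using that(1) by (intro order_tendstoD(2)[OF \<alpha>t_lim]) simp
    then show ?thesis
    proof eventually_elim
      case (elim \<epsilon>)
      have "ereal \<bar>\<alpha>t \<epsilon> i n\<bar> \<le> ereal \<eta>" if "n \<ge> 1" for n
      proof -
        have "ereal \<bar>\<alpha>t \<epsilon> i n\<bar> \<le> (SUP n\<in>{1..}. ereal \<bar>\<alpha>t \<epsilon> i n\<bar>)"
          using that by (intro SUP_upper) simp
        also have "\<dots> \<le> (SUP i\<in>{1, 2}. SUP n\<in>{1..}. ereal \<bar>\<alpha>t \<epsilon> i n\<bar>)"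
          using \<open>i \<in> {1, 2}\<close> by (rule SUP_upper)
        also have "\<dots> \<le> ereal \<eta>" using elim by (rule less_imp_le)
        finally show ?thesis .
      qed
      then show ?case by simp
    qed
  qed
  have lim: "((\<lambda>\<epsilon>. discrete_survival (\<alpha> \<epsilon> i) (nat \<lfloor>t / \<epsilon>\<rfloor>)) \<longlongrightarrow> survival (f i) t) (at_right 0)"
    if "i \<in> {1, 2}" "t \<ge> 0" for i t
    unfolding discrete_survival_def survival_def
    using range that \<alpha>_eq small[OF _ that(1)]
    by (intro survival_product_tendsto[OF f_cadlag[OF that(1)] that(2) \<epsilon>0, where \<beta> = "\<lambda>\<epsilon>. \<alpha>t \<epsilon> i"]) blast+
  interpret W: persistent_walk_coupling M f e \<epsilon>0 \<alpha>
    by unfold_locales (fact \<epsilon>0 range lim)+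
  show ?thesis
    using W.gaps_converge_in_distribution[OF P chain start] W.paths_converge_in_distribution[OF P chain start]
      W.markov_process_path W.markov_process_telegraph_age
    by (simp add: limit_path_def[abs_def] chain_path_def[abs_def])
qed

end
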